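(* Let $d\ge1$, $\alpha>0$, $L>0$ and $C_0>0$. There exist a finite family $\mathcal{F}$ of probability densities on $\mathbb{R}^d$ belonging to the Hölder class $\Sigma(L,\alpha)$, satisfying conditions (C) and (S($\alpha$)), and uniformly bounded from above by $C_0$, and a constant $\mathcal{K}$, depending on $L$ and $\alpha$, such that when $$n\ge\frac{4^d\,8\log(32)}{V_d}\quad\text{and}\quad \delta\le\min\left\{\frac{\mathcal{K}}{16^\alpha(7C_0)^{\alpha/d}},\ \frac{\|p\|_\infty}{2^{d/2+1}}\right\},$$ where $p$ is the density of the sample, the following holds. If a cluster tree estimator is $(\delta,1/4)$-accurate when presented with an i.i.d. sample of size $n$ from a density function in $\mathcal{F}$, then it must be the case that $$n\ \ge\ \frac{C_0\,\mathcal{K}^{d/\alpha}}{C\,\delta^{2+d/\alpha}}$$ for some constant $C$ depending only on $d$.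
   Context: Notation: $B(x,r)$ is the closed Euclidean ball, $\mathcal{L}$ is Lebesgue measure on $\mathbb{R}^d$, $V_d=\mathcal{L}(B(0,1))$, $d(A,B)=\inf_{x\in A,y\in B}\|x-y\|$, $\|p\|_\infty=\sup_x|p(x)|$. Hölder class: $\lfloor\alpha\rfloor$ denotes the largest integer strictly smaller than $\alpha$. $\Sigma(L,\alpha)$ is the set of functions $p:\mathbb{R}^d\to\mathbb{R}$ that are $\lfloor\alpha\rfloor$-times continuously differentiable with $|D^sp(x)-D^sp(y)|\le L\|x-y\|^{\alpha-|s|}$ for all $x,y\in\mathbb{R}^d$ and all multi-indices $s\in\mathbb{N}^d$ with $|s|=\lfloor\alpha\rfloor$. Cluster tree estimator: a collection $\widehat T_n$ of subsets of the sample, indexed by $[0,\infty)$, such that each $\widehat T_n(\lambda)$ consists of disjoint subsets of $\{X_i\}_{i=1}^n$ (clusters), and for $\lambda_1\ge\lambda_2\ge0$, $A\in\widehat T_n(\lambda_1)$, $B\in\widehat T_n(\lambda_2)$, either $A\cap B=\emptyset$ or $A\subseteq B$. $\delta$-separation: for subsets $A,A'$ of the support of $p$ put $\lambda=\inf_{x\in A\cup A'}p(x)$; for $\delta\in(0,\lambda)$, $A$ and $A'$ are $\delta$-separated if they belong to distinct connected components of $\{x:p(x)>\lambda-\delta\}$. $(\delta,\gamma)$-accuracy: a cluster tree estimator based on an i.i.d. sample $\{X_i\}_{i=1}^n$ from $p$ is $(\delta,\gamma)$-accurate if, with probability at least $1-\gamma$, simultaneously for every pair of connected subsets $A,A'$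 of the support of $p$ that are $\delta$-separated, exactly one of the following holds: (1) at least one of $A\cap\{X_i\}_{i=1}^n$, $A'\cap\{X_i\}_{i=1}^n$ is empty; (2) the smallest clusters of the estimator containing $A\cap\{X_i\}_{i=1}^n$ and $A'\cap\{X_i\}_{i=1}^n$ are disjoint. Split level: $\lambda^*>0$ is a split level of the continuous density $p$ if some connected component $\mathcal{C}$ of $\{p\ge\lambda^*\}$ is such that $\mathcal{C}\cap\{p>\lambda^*\}$ has two or more connected components. A set $\Omega\subset\mathbb{R}^d$ satisfies (C1) with constants $r_I,c_I>0$ if $\mathcal{L}(B(x,r)\cap\Omega)\ge c_IV_dr^d$ for all $0\le r\le r_I$, $x\in\Omega$; it satisfies (C2) with constant $C_I$ if for every $0<r\le r_I$ there is $\mathcal{N}_r\subset\Omega$ with $\mathrm{card}(\mathcal{N}_r)\le C_Ir^{-d}$ and $\bigcup_{y\in\mathcal{N}_r}B(y,r)\supset\Omega$. Condition (C): there is $\delta_0>0$ such that for any split level $\lambda^*$ of $p$ and any $0<t\le\delta_0$, the set $\{p\ge\lambda^*+t\}$ satisfies (C1) and (C2) with constants $r_I,c_I,C_I$ depending only on $p$. Condition (S($\alpha$)): there are $\delta_S,c_S>0$ such that for each split level $\lambda^*$ of $p$, with $\{\mathcal{C}_k\}_{k}$ the connected components of $\{p>\lambda^*\}$, $\min_{k\ne k'}d\left(\mathcal{C}_k\cap\{p\ge\lambda^*+t\},\mathcal{C}_{k'}\cap\{p\ge\lambda^*+t\}\right)\ge c_St^{1/\alpha}$ for all $t\in(0,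\delta_S]$.
   Formalization: The family F may depend on δ (but not on n), and ‖p‖_∞ ≥ m > 0 on F with m independent of δ; with one F fixed for all δ the claim fails, since a fixed finite family can be identified from a fixed n and then clustered accurately for every δ. *)

theory Defs
  imports "HOL-Probability.Probability"
begin

section \<open>Hoelder classes on \<open>\<real>\<^sup>d\<close>\<close>

definition partial_deriv :: "'n::finite \<Rightarrow> (real ^ 'n \<Rightarrow> real) \<Rightarrow> real ^ 'n \<Rightarrow> real"
  where "partial_deriv i f = (\<lambda>x. deriv (\<lambda>t. f (x + t *\<^sub>R axis i 1)) 0)"

fun times_cont_differentiable :: "nat \<Rightarrow> (real ^ 'n::finite \<Rightarrow> real) \<Rightarrow> bool"
  where
    "times_cont_differentiable 0 f \<longleftrightarrow> continuous_on UNIV f"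
  | "times_cont_differentiable (Suc k) f \<longleftrightarrow>
       f differentiable_on UNIV \<and> (\<forall>i. times_cont_differentiable k (partial_deriv i f))"

text \<open>
  A multi-index is a function \<open>s\<close> from the coordinates to \<open>nat\<close>, of order \<open>sum s UNIV\<close>. The index
  type carries no linear order, so the order in which the partial derivatives are taken is an
  arbitrary one; it is irrelevant where the derivative is used below, since there \<open>f\<close> is
  \<open>sum s UNIV\<close> times continuously differentiable.
\<close>

definition mixed_partial :: "('n::finite \<Rightarrow> nat) \<Rightarrow> (real ^ 'n \<Rightarrow> real) \<Rightarrow> real ^ 'n \<Rightarrow> real"
  where "mixed_partial s f =
    foldr partial_deriv (SOME is. \<forall>i. count_list is i = s i) f"

text \<open>The largest integer strictly smaller than \<open>\<alpha>\<close>, for \<open>\<alpha> > 0\<close>; note that it is 0 at 1.\<close>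

definition strict_floor :: "real \<Rightarrow> nat"
  where "strict_floor \<alpha> = nat (\<lceil>\<alpha>\<rceil> - 1)"

definition hoelder_class :: "real \<Rightarrow> real \<Rightarrow> (real ^ 'n::finite \<Rightarrow> real) set"
  where "hoelder_class L \<alpha> =
    {p. times_cont_differentiable (strict_floor \<alpha>) p \<and>
        (\<forall>s. sum s UNIV = strict_floor \<alpha> \<longrightarrow>
          (\<forall>x y. \<bar>mixed_partial s p x - mixed_partial s p y\<bar>
                   \<le> L * norm (x - y) powr (\<alpha> - real (sum s UNIV))))}"


section \<open>Densities and samples\<close>

definition prob_density :: "(real ^ 'n::finite \<Rightarrow> real) \<Rightarrow> bool"
  where "prob_density p \<longleftrightarrow>
    p \<in> borel_measurable borel \<and> (\<forall>x. 0 \<le> p x) \<and> (\<integral>\<^sup>+ x. ennreal (p x) \<partial>lborel) = 1"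

definition supp :: "(real ^ 'n::finite \<Rightarrow> real) \<Rightarrow> (real ^ 'n) set"
  where "supp p = closure {x. p x \<noteq> 0}"

definition sup_norm :: "(real ^ 'n::finite \<Rightarrow> real) \<Rightarrow> real"
  where "sup_norm p = (SUP x. \<bar>p x\<bar>)"

text \<open>The law of an i.i.d. sample \<open>X 0, \<dots>, X (n - 1)\<close> from \<open>p\<close>.\<close>

definition sample_law :: "nat \<Rightarrow> (real ^ 'n::finite \<Rightarrow> real) \<Rightarrow> (nat \<Rightarrow> real ^ 'n) measure"
  where "sample_law n p = Pi\<^sub>M {..<n} (\<lambda>_. density lborel (\<lambda>x. ennreal (p x)))"


section \<open>Cluster tree estimators\<close>

text \<open>
  An estimator maps a sample \<open>X\<close> to the collection \<open>T X l\<close>, \<open>l \<ge> 0\<close>, of sets of clusters. The values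
  \<open>T X l\<close> at negative \<open>l\<close> are meaningless. No measurability is imposed.
\<close>

definition cluster_tree_estimator ::
  "nat \<Rightarrow> ((nat \<Rightarrow> real ^ 'n::finite) \<Rightarrow> real \<Rightarrow> (real ^ 'n) set set) \<Rightarrow> bool"
  where "cluster_tree_estimator n T \<longleftrightarrow>
    (\<forall>X \<in> {..<n} \<rightarrow>\<^sub>E UNIV.
       (\<forall>l\<ge>0. disjoint (T X l) \<and> (\<forall>A \<in> T X l. A \<subseteq> X ` {..<n})) \<and>
       (\<forall>l\<^sub>1 l\<^sub>2 A B. l\<^sub>1 \<ge> l\<^sub>2 \<and> l\<^sub>2 \<ge> 0 \<and> A \<in> T X l\<^sub>1 \<and> B \<in> T X l\<^sub>2 \<longrightarrow> A \<inter> B = {} \<or> A \<subseteq> B))"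

definition smallest_cluster :: "(real \<Rightarrow> 'a set set) \<Rightarrow> 'a set \<Rightarrow> 'a set \<Rightarrow> bool"
  where "smallest_cluster \<T> S D \<longleftrightarrow>
    D \<in> (\<Union>l\<in>{0..}. \<T> l) \<and> S \<subseteq> D \<and> (\<forall>D' \<in> (\<Union>l\<in>{0..}. \<T> l). S \<subseteq> D' \<longrightarrow> D \<subseteq> D')"

definition \<delta>_separated ::
  "(real ^ 'n::finite \<Rightarrow> real) \<Rightarrow> real \<Rightarrow> (real ^ 'n) set \<Rightarrow> (real ^ 'n) set \<Rightarrow> bool"
  where "\<delta>_separated p \<delta> A A' \<longleftrightarrow>
    A \<noteq> {} \<and> A' \<noteq> {} \<and> A \<subseteq> supp p \<and> A' \<subseteq> supp p \<and>
    (let l = (INF x \<in> A \<union> A'. p x) in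
       0 < \<delta> \<and> \<delta> < l \<and>
       (\<exists>U \<in> components {x. p x > l - \<delta>}. \<exists>U' \<in> components {x. p x > l - \<delta>}.
          U \<noteq> U' \<and> A \<subseteq> U \<and> A' \<subseteq> U'))"

text \<open>
  The set of samples on which the required property holds need not be measurable; it has
  probability at least \<open>1 - \<gamma>\<close> if it contains a measurable event of that probability. The
  negated equivalence says that exactly one of the two alternatives holds.
\<close>

definition accurate ::
  "nat \<Rightarrow> (real ^ 'n::finite \<Rightarrow> real) \<Rightarrow> real \<Rightarrow> real
    \<Rightarrow> ((nat \<Rightarrow> real ^ 'n) \<Rightarrow> real \<Rightarrow> (real ^ 'n) set set) \<Rightarrow> bool"
  where "accurate n p \<delta> \<gamma> T \<longleftrightarrow>
    (\<exists>E \<in> sets (sample_law n p). measure (sample_law n p) E \<ge> 1 - \<gamma> \<and>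
      (\<forall>X \<in> E. \<forall>A A'. connected A \<and> connected A' \<and> \<delta>_separated p \<delta> A A' \<longrightarrow>
         \<not> ((A \<inter> X ` {..<n} = {} \<or> A' \<inter> X ` {..<n} = {}) \<longleftrightarrow>
            (\<exists>D D'. smallest_cluster (T X) (A \<inter> X ` {..<n}) D \<and>
                    smallest_cluster (T X) (A' \<inter> X ` {..<n}) D' \<and> D \<inter> D' = {}))))"


section \<open>Split levels and the regularity conditions\<close>

definition split_level :: "(real ^ 'n::finite \<Rightarrow> real) \<Rightarrow> real \<Rightarrow> bool"
  where "split_level p l \<longleftrightarrow> l > 0 \<and>
    (\<exists>\<C> \<in> components {x. p x \<ge> l}.
       \<exists>U \<in> components (\<C> \<inter> {x. p x > l}). \<exists>U' \<in> components (\<C> \<inter> {x. p x > l}). U \<noteq> U')"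

abbreviation unit_ball_volume :: "'n::finite itself \<Rightarrow> real"
  where "unit_ball_volume _ \<equiv> measure lebesgue (cball (0 :: real ^ 'n) 1)"

definition cond_C1 :: "real \<Rightarrow> real \<Rightarrow> (real ^ 'n::finite) set \<Rightarrow> bool"
  where "cond_C1 r\<^sub>I c\<^sub>I \<Omega> \<longleftrightarrow>
    (\<forall>r x. 0 \<le> r \<and> r \<le> r\<^sub>I \<and> x \<in> \<Omega> \<longrightarrow>
       measure lebesgue (cball x r \<inter> \<Omega>) \<ge> c\<^sub>I * unit_ball_volume TYPE('n) * r ^ CARD('n))"

definition cond_C2 :: "real \<Rightarrow> real \<Rightarrow> (real ^ 'n::finite) set \<Rightarrow> bool"
  where "cond_C2 r\<^sub>I C\<^sub>I \<Omega> \<longleftrightarrow>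
    (\<forall>r. 0 < r \<and> r \<le> r\<^sub>I \<longrightarrow>
       (\<exists>N \<subseteq> \<Omega>. finite N \<and> real (card N) \<le> C\<^sub>I / r ^ CARD('n) \<and> \<Omega> \<subseteq> (\<Union>y\<in>N. cball y r)))"

definition cond_C :: "(real ^ 'n::finite \<Rightarrow> real) \<Rightarrow> bool"
  where "cond_C p \<longleftrightarrow>
    (\<exists>\<delta>\<^sub>0>0. \<exists>r\<^sub>I>0. \<exists>c\<^sub>I>0. \<exists>C\<^sub>I>0. \<forall>l t. split_level p l \<and> 0 < t \<and> t \<le> \<delta>\<^sub>0 \<longrightarrow>
       cond_C1 r\<^sub>I c\<^sub>I {x. p x \<ge> l + t} \<and> cond_C2 r\<^sub>I C\<^sub>I {x. p x \<ge> l + t})"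

text \<open>
  The distance to an empty set is infinite, while \<open>setdist\<close> is 0 there; hence the guards.
\<close>

definition cond_S :: "real \<Rightarrow> (real ^ 'n::finite \<Rightarrow> real) \<Rightarrow> bool"
  where "cond_S \<alpha> p \<longleftrightarrow>
    (\<exists>\<delta>\<^sub>S>0. \<exists>c\<^sub>S>0. \<forall>l. split_level p l \<longrightarrow>
       (\<forall>t. 0 < t \<and> t \<le> \<delta>\<^sub>S \<longrightarrow>
         (\<forall>U \<in> components {x. p x > l}. \<forall>U' \<in> components {x. p x > l}.
            U \<noteq> U' \<and> U \<inter> {x. p x \<ge> l + t} \<noteq> {} \<and> U' \<inter> {x. p x \<ge> l + t} \<noteq> {} \<longrightarrow>
            setdist (U \<inter> {x. p x \<ge> l + t}) (U' \<inter> {x. p x \<ge> l + t}) \<ge> c\<^sub>S * t powr (1 / \<alpha>))))"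

end

theory Submission
  imports Defs
begin

text \<open>
  The densities that defeat every estimator with a small sample are built as follows. A wide
  plateau of height \<open>lam\<close> carries \<open>M + 1\<close> parallel walls, thin layers of width of order
  \<open>h = (c \<delta>)\<^sup>1\<^sup>/\<^sup>\<alpha>\<close> in which the density is lowered by \<open>\<delta>\<close>; this \<open>h\<close> is the smallest width
  that Hoelder regularity of order \<open>\<alpha>\<close> permits. Every wall but one has a passage of diameter of
  order \<open>h\<close> in which the height of the plateau is kept. In the density \<open>p j\<close> the wall \<open>j\<close> is the
  one that is closed, so the parts of the plateau on its two sides are \<open>\<delta>\<close>-separated.

  An accurate estimator must reveal which wall is closed. Clusters form a laminar family: if the
  sample meets the left end of the plateau, the part between the walls \<open>i\<close> and \<open>j\<close>, and the right
  end, then the tree cannot separate the two sides of wall \<open>i\<close> and also the two sides of wall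
  \<open>j\<close> (\<open>crossing_separations_incompatible\<close>). So the events of success for different positions of
  the closed wall are disjoint, up to the small probability that some part of the plateau is not
  sampled, and under the law of \<open>p 0\<close> one of them has probability at most of order \<open>1 / M\<close>. On the
  other hand \<open>p j\<close> and \<open>p 0\<close> differ by at most \<open>\<delta>\<close> and only in two passages of volume of order
  \<open>h\<^sup>d\<close>, so their chi-square divergence is of order \<open>\<delta>\<^sup>2 h\<^sup>d / lam\<close>, which is a constant times
  \<open>\<delta>\<^bsup>2 + d/\<alpha>\<^esup>\<close>. By the Cauchy-Schwarz inequality success with probability near \<open>3 / 4\<close> under every
  \<open>p j\<close> requires that \<open>n\<close> times this quantity is at least \<open>ln (5 M / 4)\<close>
  (\<open>sample_size_lower_bound\<close>).

  The constants \<open>C = K = 1\<close> suffice. The lower bound \<open>m\<close> for the supremum norm may depend on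
  \<open>C\<^sub>0\<close>, but not on \<open>\<delta>\<close>, so only values of \<open>\<delta>\<close> that are small in terms of \<open>C\<^sub>0\<close> matter: for
  larger \<open>\<delta>\<close> a single density whose supremum norm lies below \<open>\<delta>\<close> makes the claim vacuous. For
  small \<open>\<delta>\<close> the family joins two constructions. Two walls (\<open>M = 1\<close>) already work for the smallest
  sample size in the statement and force \<open>n\<close> to be large; then a large fixed number of walls is
  usable, and the gain \<open>ln M\<close> absorbs \<open>C\<^sub>0\<close> and all other constants.

  The conditions on the level sets are easy to control because the density rises from any point
  towards the axis through the centres of the passages. Hence every superlevel set retracts to its
  trace on this axis, the only possible split level is \<open>lam - \<delta>\<close>, where the two sides of the
  closed wall meet, and every point of a superlevel set is the corner of a cube of fixed size that
  stays in the set. All functions are sums of tensor products of smooth functions of one variable,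
  which gives the mixed derivatives and their Hoelder bounds.
\<close>

section \<open>A smooth plateau function of one variable\<close>

definition plateau_bump :: "(real \<Rightarrow> real) \<Rightarrow> bool"
  where "plateau_bump w \<longleftrightarrow>
    (\<forall>t. 0 \<le> w t \<and> w t \<le> 1) \<and> (\<forall>t. \<bar>t\<bar> \<le> 1/2 \<longrightarrow> w t = 1) \<and> (\<forall>t. \<bar>t\<bar> \<ge> 1 \<longrightarrow> w t = 0) \<and>
    (\<forall>s t. \<bar>s\<bar> \<le> \<bar>t\<bar> \<longrightarrow> w t \<le> w s)"

text \<open>
  \<open>D n\<close> plays the role of the \<open>n\<close>-th derivative of \<open>D 0\<close>. With the whole sequence as the object,
  the derivatives of rescaled functions and of sums can be written down instead of being computed.
\<close>

definition deriv_seq :: "nat \<Rightarrow> (nat \<Rightarrow> real \<Rightarrow> real) \<Rightarrow> bool"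
  where "deriv_seq N D \<longleftrightarrow> (\<forall>n<N. \<forall>t. (D n has_real_derivative D (Suc n) t) (at t))"

text \<open>
  \<open>n\<close>-fold continuous differentiability with an unspecified derivative at each stage, so that the
  closure properties below are inductions on \<open>n\<close> without Leibniz formulas.
\<close>

fun smooth_upto :: "nat \<Rightarrow> (real \<Rightarrow> real) \<Rightarrow> bool"
  where
    "smooth_upto 0 f \<longleftrightarrow> continuous_on UNIV f"
  | "smooth_upto (Suc n) f \<longleftrightarrow> (\<exists>f'. (\<forall>t. (f has_real_derivative f' t) (at t)) \<and> smooth_upto n f')"

lemma smooth_upto_continuous: "smooth_upto n f \<Longrightarrow> continuous_on UNIV f"
  by (cases n) (auto intro!: continuous_at_imp_continuous_on intro: DERIV_isCont)

lemma smooth_upto_Suc_imp: "smooth_upto (Suc n) f \<Longrightarrow> smooth_upto n f"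
proof (induction n arbitrary: f)
  case 0
  then show ?case using smooth_upto_continuous[of "Suc 0" f] by simp
next
  case (Suc n)
  then obtain f' where "\<forall>t. (f has_real_derivative f' t) (at t)" "smooth_upto (Suc n) f'"
    by (meson smooth_upto.simps(2))
  then show ?case using Suc.IH[of f'] by (metis smooth_upto.simps(2))
qed

lemma smooth_upto_add: "smooth_upto n f \<Longrightarrow> smooth_upto n g \<Longrightarrow> smooth_upto n (\<lambda>t. f t + g t)"
proof (induction n arbitrary: f g)
  case 0
  then show ?case by (auto intro: continuous_on_add)
next
  case (Suc n)
  then obtain f' g' where fg: "\<forall>t. (f has_real_derivative f' t) (at t)" "smooth_upto n f'"
    "\<forall>t. (g has_real_derivative g' t) (at t)" "smooth_upto n g'" by auto
  have "\<forall>t. ((\<lambda>t. f t + g t) has_real_derivative (f' t + g' t)) (at t)"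
    using fg by (auto intro!: derivative_intros)
  then show ?case using Suc.IH[OF fg(2,4)] by (auto intro!: exI[of _ "\<lambda>t. f' t + g' t"])
qed

lemma smooth_upto_mult: "smooth_upto n f \<Longrightarrow> smooth_upto n g \<Longrightarrow> smooth_upto n (\<lambda>t. f t * g t)"
proof (induction n arbitrary: f g)
  case 0
  then show ?case by (auto intro: continuous_on_mult)
next
  case (Suc n)
  then obtain f' g' where fg: "\<forall>t. (f has_real_derivative f' t) (at t)" "smooth_upto n f'"
    "\<forall>t. (g has_real_derivative g' t) (at t)" "smooth_upto n g'" by auto
  have "\<forall>t. ((\<lambda>t. f t * g t) has_real_derivative (f' t * g t + f t * g' t)) (at t)"
    using fg by (auto intro!: derivative_eq_intros)
  moreover have "smooth_upto n (\<lambda>t. f' t * g t + f t * g' t)"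
    using Suc.IH fg smooth_upto_Suc_imp[OF Suc.prems(1)] smooth_upto_Suc_imp[OF Suc.prems(2)] by (intro smooth_upto_add) auto
  ultimately show ?case by (auto intro!: exI[of _ "\<lambda>t. f' t * g t + f t * g' t"])
qed

lemma smooth_upto_const: "smooth_upto n (\<lambda>t. c)"
proof (induction n arbitrary: c)
  case (Suc n)
  have "\<forall>t. ((\<lambda>t. c) has_real_derivative 0) (at t)" by auto
  then show ?case using Suc[of 0] by (auto intro!: exI[of _ "\<lambda>_. 0"])
qed auto

lemma smooth_upto_affine: "smooth_upto n f \<Longrightarrow> smooth_upto n (\<lambda>t. f (a + c * t))"
proof (induction n arbitrary: f)
  case 0
  then show ?case by (auto intro!: continuous_on_compose2[of UNIV f] continuous_intros)
next
  case (Suc n)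
  then obtain f' where f: "\<forall>t. (f has_real_derivative f' t) (at t)" "smooth_upto n f'" by auto
  have "\<forall>t. ((\<lambda>t. f (a + c * t)) has_real_derivative (c * f' (a + c * t))) (at t)"
  proof
    fix t
    have "((\<lambda>t. f (a + c * t)) has_real_derivative f' (a + c * t) * c) (at t)"
      by (rule DERIV_chain2[where f=f]) (use f in \<open>auto intro!: derivative_eq_intros\<close>)
    then show "((\<lambda>t. f (a + c * t)) has_real_derivative (c * f' (a + c * t))) (at t)"
      by (simp add: mult.commute)
  qed
  moreover have "smooth_upto n (\<lambda>t. c * f' (a + c * t))" by (intro smooth_upto_mult smooth_upto_const Suc.IH f)
  ultimately show ?case by (auto intro!: exI[of _ "\<lambda>t. c * f' (a + c * t)"])
qed

lemma smooth_upto_inverse: "smooth_upto n f \<Longrightarrow> (\<And>t. f t \<noteq> 0) \<Longrightarrow> smooth_upto n (\<lambda>t. inverse (f t))"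
proof (induction n)
  case 0
  then show ?case by (auto intro: continuous_on_inverse)
next
  case (Suc n)
  then obtain f' where f: "\<forall>t. (f has_real_derivative f' t) (at t)" "smooth_upto n f'" by auto
  let ?g = "\<lambda>t. -1 * (f' t * (inverse (f t) * inverse (f t)))"
  have "\<forall>t. ((\<lambda>t. inverse (f t)) has_real_derivative ?g t) (at t)"
    using f Suc.prems(2) by (auto intro!: derivative_eq_intros)
  moreover have "smooth_upto n ?g"
    using smooth_upto_Suc_imp[OF Suc.prems(1)] Suc.prems(2) f by (intro smooth_upto_mult smooth_upto_const Suc.IH)
  ultimately show ?case by (auto intro!: exI[of _ ?g])
qed

lemma smooth_upto_truncated_power: "smooth_upto n (\<lambda>t. max 0 t ^ Suc n)"
proof (induction n)
  case 0
  then show ?case by (auto intro!: continuous_intros)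
next
  case (Suc n)
  let ?g = "\<lambda>t::real. real (Suc (Suc n)) * max 0 t ^ Suc n"
  have "((\<lambda>t. max 0 t ^ Suc (Suc n)) has_real_derivative ?g t) (at t)" for t :: real
  proof (cases "t = 0")
    case True
    have "((\<lambda>y. (max 0 y ^ Suc (Suc n) - max 0 0 ^ Suc (Suc n)) / (y - 0)) \<longlongrightarrow> 0) (at (0::real))"
    proof (rule Lim_null_comparison)
      show "\<forall>\<^sub>F y in at (0::real). norm ((max 0 y ^ Suc (Suc n) - max 0 0 ^ Suc (Suc n)) / (y - 0)) \<le> \<bar>y\<bar> ^ Suc n"
      proof (intro always_eventually allI)
        fix y :: real
        show "norm ((max 0 y ^ Suc (Suc n) - max 0 0 ^ Suc (Suc n)) / (y - 0)) \<le> \<bar>y\<bar> ^ Suc n"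
        proof (cases "y > 0")
          case False
          then have "norm ((max 0 y ^ Suc (Suc n) - max 0 0 ^ Suc (Suc n)) / (y - 0)) = 0" by simp
          then show ?thesis by (metis abs_ge_zero zero_le_power)
        qed (simp add: abs_mult)
      qed
      show "((\<lambda>y::real. \<bar>y\<bar> ^ Suc n) \<longlongrightarrow> 0) (at 0)"
        by (auto intro!: tendsto_eq_intros)
    qed
    then show ?thesis using True by (simp add: has_field_derivative_iff)
  next
    case False
    then consider "t > 0" | "t < 0" by linarith
    then show ?thesis
    proof cases
      case 1
      have "((\<lambda>t. t ^ Suc (Suc n)) has_real_derivative ?g t) (at t)"
        using DERIV_pow[of "Suc (Suc n)" t UNIV] 1 by (simp add: max_def del: power_Suc of_nat_Suc)
      then show ?thesis
        by (rule has_field_derivative_transform_within_open[of _ _ _ "{0<..}"]) (use 1 in auto)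
    next
      case 2
      have "((\<lambda>t. 0) has_real_derivative ?g t) (at t)" using 2 by (auto simp: max_def)
      then show ?thesis
        by (rule has_field_derivative_transform_within_open[of _ _ _ "{..<0}"]) (use 2 in auto)
    qed
  qed
  moreover have "smooth_upto n ?g" by (intro smooth_upto_mult smooth_upto_const Suc)
  ultimately show ?case by (auto intro!: exI[of _ ?g])
qed

lemma smooth_upto_deriv_seq:
  "smooth_upto N f \<Longrightarrow> \<exists>D. D 0 = f \<and> deriv_seq N D \<and> (\<forall>n\<le>N. continuous_on UNIV (D n))"
proof (induction N arbitrary: f)
  case 0
  then show ?case by (intro exI[of _ "\<lambda>_. f"]) (auto simp: deriv_seq_def)
next
  case (Suc N)
  then obtain f' where f: "\<forall>t. (f has_real_derivative f' t) (at t)" "smooth_upto N f'" by auto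
  then obtain D where D: "D 0 = f'" "deriv_seq N D" "\<forall>n\<le>N. continuous_on UNIV (D n)"
    using Suc.IH by blast
  let ?E = "\<lambda>n. case n of 0 \<Rightarrow> f | Suc n \<Rightarrow> D n"
  have "deriv_seq (Suc N) ?E"
    using D f by (auto simp: deriv_seq_def split: nat.split)
  moreover have "\<forall>n\<le>Suc N. continuous_on UNIV (?E n)"
    using D smooth_upto_continuous[OF Suc.prems] by (auto split: nat.split)
  ultimately show ?case by (intro exI[of _ ?E]) auto
qed

text \<open>
  The quotient \<open>g t / (g t + g (1 - t))\<close> of truncated powers \<open>g t = (max 0 t)\<^bsup>N + 1\<^esup>\<close> climbs from
  0 to 1 on the unit interval, and its denominator never vanishes; a climb multiplied by its mirror
  image is a bump with a flat top. The power \<open>N + 1\<close> provides \<open>N\<close> continuous derivatives.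
\<close>

lemma plateau_bump_exists: "\<exists>w. plateau_bump w \<and> smooth_upto N w"
proof -
  define g where "g = (\<lambda>t::real. max 0 t ^ Suc N)"
  define s where "s = (\<lambda>t. g t * inverse (g t + g (1 - t)))"
  define w where "w = (\<lambda>t. s (2 - 2 * t) * s (2 + 2 * t))"
  have g0: "g t \<ge> 0" for t by (simp add: g_def)
  have gm: "g t \<le> g u" if "t \<le> u" for t u
    unfolding g_def using that by (intro power_mono) auto
  have pos: "g t + g (1 - t) > 0" for t
  proof (cases "t > 0")
    case True
    then have "g t > 0" by (simp add: g_def)
    then show ?thesis using g0[of "1-t"] by linarith
  next
    case False
    then have "g (1 - t) > 0" by (simp add: g_def)
    then show ?thesis using g0[of t] by linarith
  qed
  have s0: "0 \<le> s t" and s1: "s t \<le> 1" for t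
    using pos[of t] g0[of t] g0[of "1-t"] by (auto simp: s_def field_simps)
  have smono: "s t \<le> s u" if "t \<le> u" for t u
  proof -
    have "g t * g (1 - u) \<le> g u * g (1 - t)"
      using that by (intro mult_mono gm g0) auto
    then have "g t * (g u + g (1 - u)) \<le> g u * (g t + g (1 - t))" by (simp add: algebra_simps)
    then show ?thesis unfolding s_def using pos[of t] pos[of u] by (simp add: field_simps)
  qed
  have slow: "s t = 0" if "t \<le> 0" for t using that by (simp add: s_def g_def)
  have shigh: "s t = 1" if "t \<ge> 1" for t
  proof -
    have "g (1 - t) = 0" using that by (simp add: g_def)
    then show ?thesis using pos[of t] by (simp add: s_def)
  qed
  have wabs: "w t = s (2 - 2 * \<bar>t\<bar>)" for t
    by (cases "t \<ge> 0") (auto simp: w_def shigh)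
  have "plateau_bump w"
    unfolding plateau_bump_def wabs by (auto intro!: s0 s1 slow shigh smono)
  moreover have "smooth_upto N w"
  proof -
    have g: "smooth_upto N g" unfolding g_def by (rule smooth_upto_truncated_power)
    have "smooth_upto N (\<lambda>t. g (1 + (-1) * t))" by (rule smooth_upto_affine[OF g])
    then have "smooth_upto N (\<lambda>t. g (1 - t))" by simp
    then have "smooth_upto N (\<lambda>t. inverse (g t + g (1 - t)))"
      using pos[THEN less_imp_neq] by (intro smooth_upto_inverse smooth_upto_add g) auto
    then have s: "smooth_upto N s" unfolding s_def using g by (intro smooth_upto_mult)
    have "smooth_upto N (\<lambda>t. s (2 + (-2) * t) * s (2 + 2 * t))"
      by (intro smooth_upto_mult smooth_upto_affine s)
    then show ?thesis by (simp add: w_def)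
  qed
  ultimately show ?thesis by blast
qed

definition smooth_bump :: "nat \<Rightarrow> (real \<Rightarrow> real) \<Rightarrow> (nat \<Rightarrow> real \<Rightarrow> real) \<Rightarrow> real \<Rightarrow> bool"
  where "smooth_bump N w D A \<longleftrightarrow> plateau_bump w \<and> D 0 = w \<and> deriv_seq N D \<and> A \<ge> 1 \<and>
     (\<forall>n\<le>N. \<forall>t. \<bar>D n t\<bar> \<le> A \<and> (\<bar>t\<bar> > 1 \<longrightarrow> D n t = 0))"

text \<open>
  Outside the unit interval the bump is locally constant, so its derivatives vanish there; being
  continuous, they are bounded on the interval itself.
\<close>

lemma smooth_bump_exists: "\<exists>w D A. smooth_bump N w D A"
proof -
  obtain w where w: "plateau_bump w" "smooth_upto N w" using plateau_bump_exists by blast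
  obtain D where D: "D 0 = w" "deriv_seq N D" "\<forall>n\<le>N. continuous_on UNIV (D n)"
    using smooth_upto_deriv_seq[OF w(2)] by blast
  have supp0: "\<forall>t. \<bar>t\<bar> > 1 \<longrightarrow> D n t = 0" if "n \<le> N" for n
    using that
  proof (induction n)
    case 0
    then show ?case using w D by (auto simp: plateau_bump_def)
  next
    case (Suc n)
    have open_out: "open {t::real. \<bar>t\<bar> > 1}"
      by (intro open_Collect_less continuous_intros)
    show ?case
    proof (intro allI impI)
      fix t :: real assume t: "\<bar>t\<bar> > 1"
      have "((\<lambda>t. 0) has_real_derivative 0) (at t)" by simp
      then have "(D n has_real_derivative 0) (at t)"
        by (rule has_field_derivative_transform_within_open[OF _ open_out]) (use t Suc in auto)
      moreover have "(D n has_real_derivative D (Suc n) t) (at t)"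
        using D(2) Suc.prems by (auto simp: deriv_seq_def)
      ultimately show "D (Suc n) t = 0" by (rule DERIV_unique[symmetric])
    qed
  qed
  have "\<exists>B. \<forall>t. \<bar>D n t\<bar> \<le> B" if "n \<le> N" for n
  proof -
    have "compact (D n ` {-1..1})"
      using D(3) that by (intro compact_continuous_image) (auto intro: continuous_on_subset)
    then obtain B where B: "\<And>t. t \<in> {-1..1} \<Longrightarrow> \<bar>D n t\<bar> \<le> B"
      using compact_imp_bounded bounded_iff by (metis imageI real_norm_def)
    have "\<bar>D n t\<bar> \<le> max B 0" for t
    proof (cases "\<bar>t\<bar> \<le> 1")
      case True
      then have "\<bar>D n t\<bar> \<le> B" by (intro B) auto
      then show ?thesis by simp
    qed (use supp0[OF that] in auto)
    then show ?thesis by blast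
  qed
  then obtain B where B: "\<And>n t. n \<le> N \<Longrightarrow> \<bar>D n t\<bar> \<le> B n" by metis
  define A where "A = 1 + (\<Sum>n\<le>N. \<bar>B n\<bar>)"
  have "\<bar>D n t\<bar> \<le> A" if "n \<le> N" for n t
  proof -
    have "\<bar>B n\<bar> \<le> (\<Sum>n\<le>N. \<bar>B n\<bar>)" using that by (intro member_le_sum) auto
    then show ?thesis using B[OF that, of t] by (simp add: A_def)
  qed
  moreover have "A \<ge> 1" by (simp add: A_def sum_nonneg)
  ultimately have "smooth_bump N w D A" using w D supp0 by (simp add: smooth_bump_def)
  then show ?thesis by blast
qed

section \<open>Hoelder bounds for sums of tensor products\<close>

text \<open>
  The factor in coordinate \<open>i\<close> is the derivative of order \<open>m i\<close> of a function with derivative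
  sequence \<open>D i\<close>, so that differentiation only changes the multi-index \<open>m\<close>.
\<close>

definition tensor :: "('n::finite \<Rightarrow> nat \<Rightarrow> real \<Rightarrow> real) \<Rightarrow> ('n \<Rightarrow> nat) \<Rightarrow> real ^ 'n \<Rightarrow> real"
  where "tensor D m x = (\<Prod>i\<in>UNIV. D i (m i) (x $ i))"

definition tensor_sum ::
  "('a \<Rightarrow> real) \<Rightarrow> ('a \<Rightarrow> 'n::finite \<Rightarrow> nat \<Rightarrow> real \<Rightarrow> real) \<Rightarrow> 'a set \<Rightarrow> ('n \<Rightarrow> nat) \<Rightarrow> real ^ 'n \<Rightarrow> real"
  where "tensor_sum c D A m x = (\<Sum>a\<in>A. c a * tensor (D a) m x)"

lemma tensor_remove:
  "tensor D m x = D j (m j) (x $ j) * (\<Prod>i\<in>UNIV - {j}. D i (m i) (x $ i))"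
  unfolding tensor_def by (rule prod.remove) auto

lemma tensor_partial:
  assumes "deriv_seq N (D j)" "m j < N"
  shows "((\<lambda>t. tensor D m (x + t *\<^sub>R axis j 1)) has_real_derivative
           tensor D (m(j := Suc (m j))) x) (at 0)"
proof -
  let ?r = "\<Prod>i\<in>UNIV - {j}. D i (m i) (x $ i)"
  have "tensor D m (x + t *\<^sub>R axis j 1) = D j (m j) (x $ j + t) * ?r" for t
    unfolding tensor_remove[of _ _ _ j] by (auto intro!: prod.cong simp: axis_def)
  moreover have "((\<lambda>t. D j (m j) (x $ j + t) * ?r) has_real_derivative
      (D j (Suc (m j)) (x $ j + 0) * 1) * ?r) (at 0)"
    by (intro DERIV_cmult_right DERIV_chain2[where f = "D j (m j)"])
       (use assms in \<open>auto simp: deriv_seq_def intro!: derivative_eq_intros\<close>)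
  moreover have "tensor D (m(j := Suc (m j))) x = D j (Suc (m j)) (x $ j) * ?r"
    unfolding tensor_remove[of _ _ _ j] by (auto intro!: prod.cong)
  ultimately show ?thesis by simp
qed

lemma partial_deriv_tensor_sum:
  assumes "\<And>a. a \<in> A \<Longrightarrow> deriv_seq N (D a j)" "m j < N"
  shows "partial_deriv j (tensor_sum c D A m) = tensor_sum c D A (m(j := Suc (m j)))"
proof
  fix x
  have "((\<lambda>t. tensor_sum c D A m (x + t *\<^sub>R axis j 1)) has_real_derivative
         tensor_sum c D A (m(j := Suc (m j))) x) (at 0)"
    unfolding tensor_sum_def
    by (intro DERIV_sum DERIV_cmult tensor_partial) (use assms in auto)
  then show "partial_deriv j (tensor_sum c D A m) x = tensor_sum c D A (m(j := Suc (m j))) x"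
    unfolding partial_deriv_def by (rule DERIV_imp_deriv)
qed

lemma tensor_sum_differentiable:
  assumes "\<And>a i. a \<in> A \<Longrightarrow> deriv_seq N (D a i)" "\<And>i. m i < N"
  shows "tensor_sum c D A m differentiable (at x)"
proof -
  have factor: "(\<lambda>x. D a i (m i) (x $ i)) differentiable (at x)" if "a \<in> A" for a i
  proof -
    have "(D a i (m i) has_derivative (*) (D a i (Suc (m i)) (x $ i))) (at (x $ i))"
      using assms that unfolding deriv_seq_def has_field_derivative_def[symmetric] by blast
    from has_derivative_compose[OF bounded_linear_imp_has_derivative[OF bounded_linear_vec_nth] this]
    show ?thesis unfolding differentiable_def by blast
  qed
  have tens: "tensor (D a) m differentiable (at x)" if "a \<in> A" for a
  proof -
    have "\<forall>i. \<exists>f'. ((\<lambda>x. D a i (m i) (x $ i)) has_derivative f') (at x)"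
      using factor[OF that] unfolding differentiable_def by blast
    from choice[OF this]
    obtain f' where "\<And>i. ((\<lambda>x. D a i (m i) (x $ i)) has_derivative f' i) (at x)" by blast
    then have "((\<lambda>x. \<Prod>i\<in>UNIV. D a i (m i) (x $ i)) has_derivative
        (\<lambda>y. \<Sum>i\<in>UNIV. f' i y * (\<Prod>j\<in>UNIV - {i}. D a j (m j) (x $ j)))) (at x)"
      by (intro has_derivative_prod) auto
    then show ?thesis unfolding tensor_def[abs_def] differentiable_def by blast
  qed
  show ?thesis
  proof (cases "finite A")
    case True
    then show ?thesis unfolding tensor_sum_def[abs_def]
      by (intro differentiable_sum ballI differentiable_mult tens) auto
  next
    case False
    then show ?thesis unfolding tensor_sum_def[abs_def] by simp
  qed
qed

lemma times_cont_differentiable_tensor_sum: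
  assumes "\<And>a i. a \<in> A \<Longrightarrow> deriv_seq N (D a i)" "sum m UNIV + n < N"
  shows "times_cont_differentiable n (tensor_sum c D A m)"
  using assms(2)
proof (induction n arbitrary: m)
  have le: "m i \<le> sum m UNIV" for m :: "'b \<Rightarrow> nat" and i by (rule member_le_sum) auto
  have diff: "tensor_sum c D A m differentiable_on UNIV" if "sum m UNIV < N" for m
    unfolding differentiable_on_def
    using tensor_sum_differentiable[of A N D m c, OF assms(1)] le[of m] that
    by (metis differentiable_at_withinI le_less_trans)
  {
    case 0
    then show ?case using diff[of m] by (auto intro: differentiable_imp_continuous_on)
  next
    case (Suc n)
    have "times_cont_differentiable n (partial_deriv i (tensor_sum c D A m))" for i
    proof -
      have "sum (m(i := Suc (m i))) UNIV = Suc (sum m UNIV)"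
        by (simp add: sum.remove[of UNIV i])
      then have "times_cont_differentiable n (tensor_sum c D A (m(i := Suc (m i))))"
        using Suc by auto
      moreover have "m i < N" using le[of m i] Suc.prems by linarith
      ultimately show ?thesis
        by (subst partial_deriv_tensor_sum[where N = N]) (use assms(1) in auto)
    qed
    then show ?case using diff[of m] Suc.prems by auto
  }
qed

lemma foldr_partial_deriv_tensor_sum:
  assumes "\<And>a i. a \<in> A \<Longrightarrow> deriv_seq N (D a i)" "length is \<le> N"
  shows "foldr partial_deriv is (tensor_sum c D A (\<lambda>_. 0)) = tensor_sum c D A (count_list is)"
  using assms(2)
proof (induction "is")
  case (Cons i "is")
  have "count_list is i < N" using count_le_length[of "is" i] Cons.prems by simp
  moreover have "(count_list is)(i := Suc (count_list is i)) = count_list (i # is)"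
    by auto
  ultimately show ?case
    using Cons partial_deriv_tensor_sum[of A N D i "count_list is" c] assms(1)
    by (simp del: count_list.simps)
qed (simp add: fun_eq_iff tensor_sum_def tensor_def)

text \<open>
  This makes the choice of an order of differentiation in the definition of mixed partial
  derivatives meaningful.
\<close>

lemma count_list_exists: "\<exists>is. \<forall>i. count_list is i = s i" for s :: "'n::finite \<Rightarrow> nat"
proof -
  obtain "is" where "mset is = (\<Sum>i\<in>UNIV. replicate_mset (s i) i)" using ex_mset by blast
  then have "count_list is i = count (\<Sum>i\<in>UNIV. replicate_mset (s i) i) i" for i
    by (metis count_mset)
  then show ?thesis by (auto simp: count_sum)
qed

lemma mixed_partial_tensor_sum:
  assumes "\<And>a i. a \<in> A \<Longrightarrow> deriv_seq N (D a i)" "sum s UNIV \<le> N"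
  shows "mixed_partial s (tensor_sum c D A (\<lambda>_. 0)) = tensor_sum c D A s"
proof -
  define ixs where "ixs = (SOME is. \<forall>i. count_list is i = s i)"
  have eq: "count_list ixs = s"
    using someI_ex[OF count_list_exists[of s]] by (auto simp: ixs_def)
  have "length ixs = sum (count_list ixs) UNIV" by (rule sum_count_set[symmetric]) auto
  then have "foldr partial_deriv ixs (tensor_sum c D A (\<lambda>_. 0)) = tensor_sum c D A (count_list ixs)"
    using assms eq by (intro foldr_partial_deriv_tensor_sum[where N = N]) auto
  then show ?thesis by (simp add: mixed_partial_def eq flip: ixs_def)
qed

lemma tensor_bound:
  fixes D :: "'n::finite \<Rightarrow> nat \<Rightarrow> real \<Rightarrow> real"
  assumes bd: "\<And>i n t. n \<le> Suc (sum s UNIV) \<Longrightarrow> \<bar>D i n t\<bar> \<le> B / r ^ n" and "r > 0" "B > 0"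
  shows "\<bar>tensor D s x\<bar> \<le> B ^ CARD('n) / r ^ sum s UNIV"
proof -
  have le: "s i \<le> sum s UNIV" for i by (rule member_le_sum) auto
  have "\<bar>tensor D s x\<bar> \<le> (\<Prod>i\<in>UNIV. B / r ^ s i)"
    unfolding tensor_def abs_prod by (intro prod_mono conjI bd) (use le in \<open>auto simp: le_SucI\<close>)
  also have "\<dots> = B ^ CARD('n) / r ^ sum s UNIV" by (simp add: prod_dividef power_sum)
  finally show ?thesis .
qed

text \<open>
  Divided by their bounds \<open>B / r\<^bsup>s i\<^esup>\<close>, the factors have absolute value at most 1, and then the
  difference of two products is at most the sum of the differences of the factors.
\<close>

lemma tensor_lipschitz:
  fixes D :: "'n::finite \<Rightarrow> nat \<Rightarrow> real \<Rightarrow> real"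
  assumes bd: "\<And>i n t. n \<le> Suc (sum s UNIV) \<Longrightarrow> \<bar>D i n t\<bar> \<le> B / r ^ n" and pos: "r > 0" "B > 0"
    and D: "\<And>i. deriv_seq (Suc (sum s UNIV)) (D i)"
  shows "\<bar>tensor D s x - tensor D s y\<bar> \<le>
    real CARD('n) * B ^ CARD('n) / r ^ sum s UNIV * (norm (x - y) / r)"
proof -
  have le: "s i \<le> sum s UNIV" for i by (rule member_le_sum) auto
  define z where "z = (\<lambda>(x :: real ^ 'n) i. D i (s i) (x $ i) / (B / r ^ s i))"
  have z: "tensor D s x = B ^ CARD('n) / r ^ sum s UNIV * (\<Prod>i\<in>UNIV. z x i)" for x
  proof -
    have "(\<Prod>i\<in>UNIV. B / r ^ s i) = B ^ CARD('n) / r ^ sum s UNIV"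
      by (simp add: prod_dividef power_sum)
    moreover have "tensor D s x = (\<Prod>i\<in>UNIV. B / r ^ s i * z x i)"
      using pos by (simp add: z_def tensor_def)
    ultimately show ?thesis by (simp only: prod.distrib)
  qed
  have z1: "norm (z x i) \<le> 1" for x i
  proof -
    have q: "B / r ^ s i > 0" using pos by simp
    have "\<bar>D i (s i) (x $ i)\<bar> \<le> B / r ^ s i" using bd[of "s i" i "x $ i"] le[of i] by simp
    then show ?thesis
      using divide_le_eq_1_pos[OF q] by (simp only: z_def real_norm_def flip: abs_div_pos[OF q])
  qed
  have zd: "norm (z x i - z y i) \<le> norm (x - y) / r" for i
  proof -
    have "norm (D i (s i) (x $ i) - D i (s i) (y $ i)) \<le> (B / r ^ Suc (s i)) * norm (x $ i - y $ i)"
    proof (rule field_differentiable_bound[of UNIV])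
      show "(D i (s i) has_real_derivative D i (Suc (s i)) t) (at t within UNIV)" for t
        using D[of i] le[of i] by (auto simp: deriv_seq_def)
      show "norm (D i (Suc (s i)) t) \<le> B / r ^ Suc (s i)" for t
        using bd[of "Suc (s i)" i t] le[of i] by simp
    qed auto
    also have "\<dots> \<le> (B / r ^ Suc (s i)) * norm (x - y)"
      using component_le_norm_cart[of "x - y" i] pos by (intro mult_left_mono) auto
    finally have "norm (D i (s i) (x $ i) - D i (s i) (y $ i)) \<le> (B / r ^ s i) * (norm (x - y) / r)"
      by (simp add: field_simps)
    moreover have q: "B / r ^ s i > 0" using pos by simp
    moreover have "norm (z x i - z y i) = norm (D i (s i) (x $ i) - D i (s i) (y $ i)) / (B / r ^ s i)"
      unfolding z_def diff_divide_distrib[symmetric] norm_divide using pos by simp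
    ultimately show ?thesis
      by (metis pos_divide_le_eq mult.commute)
  qed
  have "\<bar>tensor D s x - tensor D s y\<bar> =
      B ^ CARD('n) / r ^ sum s UNIV * norm ((\<Prod>i\<in>UNIV. z x i) - (\<Prod>i\<in>UNIV. z y i))"
    using pos unfolding z right_diff_distrib[symmetric] abs_mult real_norm_def by simp
  also have "\<dots> \<le> B ^ CARD('n) / r ^ sum s UNIV * (\<Sum>i\<in>(UNIV::'n set). norm (z x i - z y i))"
    using pos by (intro mult_left_mono norm_prod_diff z1) auto
  also have "\<dots> \<le> B ^ CARD('n) / r ^ sum s UNIV * (\<Sum>i\<in>(UNIV::'n set). norm (x - y) / r)"
    using pos by (intro mult_left_mono sum_mono zd) auto
  finally show ?thesis by (simp add: mult.left_commute mult.commute)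
qed

text \<open>
  Interpolation between the supremum bound and the Lipschitz bound: points at distance at most the
  length scale \<open>r\<close> are compared by the latter, all others by the former.
\<close>

lemma tensor_hoelder:
  fixes D :: "'n::finite \<Rightarrow> nat \<Rightarrow> real \<Rightarrow> real"
  assumes bd: "\<And>i n t. n \<le> Suc (sum s UNIV) \<Longrightarrow> \<bar>D i n t\<bar> \<le> B / r ^ n" and pos: "r > 0" "B > 0"
    and D: "\<And>i. deriv_seq (Suc (sum s UNIV)) (D i)"
    and \<beta>: "0 < \<beta>" "\<beta> \<le> 1"
  shows "\<bar>tensor D s x - tensor D s y\<bar> \<le>
    (real CARD('n) + 2) * B ^ CARD('n) * r powr (- (real (sum s UNIV) + \<beta>)) * norm (x - y) powr \<beta>"
proof -
  let ?k = "sum s UNIV" and ?d = "real CARD('n)" and ?u = "norm (x - y) / r"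
  have u: "?u \<ge> 0" using pos by simp
  have lip: "\<bar>tensor D s x - tensor D s y\<bar> \<le> ?d * B ^ CARD('n) / r ^ ?k * ?u"
    by (rule tensor_lipschitz) (use bd pos D in auto)
  have tb: "\<bar>tensor D s x\<bar> \<le> B ^ CARD('n) / r ^ ?k" for x
    by (rule tensor_bound) (use bd pos in auto)
  have bound: "\<bar>tensor D s x - tensor D s y\<bar> \<le> (?d + 2) * B ^ CARD('n) / r ^ ?k * ?u powr \<beta>"
  proof (cases "?u \<le> 1")
    case True
    have "?u \<le> ?u powr \<beta>"
    proof (cases "?u = 0")
      case False
      have "?u = ?u powr 1" by (rule powr_one[OF u, symmetric])
      also have "\<dots> \<le> ?u powr \<beta>" using True \<beta> u by (intro powr_mono') auto
      finally show ?thesis .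
    qed auto
    then have "?d * B ^ CARD('n) / r ^ ?k * ?u \<le> ?d * B ^ CARD('n) / r ^ ?k * ?u powr \<beta>"
      using pos by (intro mult_left_mono) auto
    also have "\<dots> \<le> (?d + 2) * B ^ CARD('n) / r ^ ?k * ?u powr \<beta>"
      using pos by (intro mult_right_mono divide_right_mono) auto
    finally show ?thesis using lip by linarith
  next
    case False
    then have one: "1 \<le> ?u powr \<beta>" using \<beta> by (intro ge_one_powr_ge_zero) auto
    have "\<bar>tensor D s x - tensor D s y\<bar> \<le> 2 * (B ^ CARD('n) / r ^ ?k)"
      using tb[of x] tb[of y] by linarith
    also have "\<dots> \<le> ((?d + 2) * B ^ CARD('n) / r ^ ?k) * 1"
      using pos by (auto simp: divide_simps)
    also have "\<dots> \<le> (?d + 2) * B ^ CARD('n) / r ^ ?k * ?u powr \<beta>"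
      using pos one by (intro mult_left_mono) auto
    finally show ?thesis .
  qed
  have "r powr (- (real ?k + \<beta>)) = 1 / (r ^ ?k * r powr \<beta>)"
    using pos by (simp only: powr_minus_divide powr_add powr_realpow)
  moreover have "?u powr \<beta> = norm (x - y) powr \<beta> / r powr \<beta>"
    using pos by (intro powr_divide)
  ultimately show ?thesis using bound by simp
qed

text \<open>
  Each summand may have its own length scale \<open>r a\<close>; it contributes to the Hoelder constant of order
  \<open>\<alpha>\<close> with the factor \<open>(r a)\<^bsup>-\<alpha>\<^esup>\<close>.
\<close>

lemma tensor_sum_hoelder_class:
  fixes D :: "'a \<Rightarrow> 'n::finite \<Rightarrow> nat \<Rightarrow> real \<Rightarrow> real"
  assumes "\<alpha> > 0" and B: "B > 0" and r: "\<And>a. a \<in> A \<Longrightarrow> r a > 0"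
    and D: "\<And>a i. a \<in> A \<Longrightarrow> deriv_seq (Suc (strict_floor \<alpha>)) (D a i)"
    and bd: "\<And>a i n t. a \<in> A \<Longrightarrow> n \<le> Suc (strict_floor \<alpha>) \<Longrightarrow> \<bar>D a i n t\<bar> \<le> B / r a ^ n"
    and L: "(\<Sum>a\<in>A. \<bar>c a\<bar> * ((real CARD('n) + 2) * B ^ CARD('n) * r a powr (- \<alpha>))) \<le> L"
  shows "tensor_sum c D A (\<lambda>_. 0) \<in> hoelder_class L \<alpha>"
proof -
  let ?k = "strict_floor \<alpha>" and ?\<beta> = "\<alpha> - real (strict_floor \<alpha>)"
  have k: "real ?k = of_int \<lceil>\<alpha>\<rceil> - 1" using \<open>\<alpha> > 0\<close> by (simp add: strict_floor_def)
  have \<beta>: "0 < ?\<beta>" "?\<beta> \<le> 1" unfolding k using ceiling_correct[of \<alpha>] by linarith+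
  have "times_cont_differentiable ?k (tensor_sum c D A (\<lambda>_. 0))"
    using D by (intro times_cont_differentiable_tensor_sum[where N = "Suc ?k"]) auto
  moreover have "\<bar>mixed_partial s (tensor_sum c D A (\<lambda>_. 0)) x - mixed_partial s (tensor_sum c D A (\<lambda>_. 0)) y\<bar>
      \<le> L * norm (x - y) powr (\<alpha> - real (sum s UNIV))" if s: "sum s UNIV = ?k" for s x y
  proof -
    let ?v = "norm (x - y) powr ?\<beta>"
    have "mixed_partial s (tensor_sum c D A (\<lambda>_. 0)) = tensor_sum c D A s"
      using D s by (intro mixed_partial_tensor_sum[where N = "Suc ?k"]) auto
    then have "\<bar>mixed_partial s (tensor_sum c D A (\<lambda>_. 0)) x - mixed_partial s (tensor_sum c D A (\<lambda>_. 0)) y\<bar>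
        = \<bar>\<Sum>a\<in>A. c a * (tensor (D a) s x - tensor (D a) s y)\<bar>"
      by (simp add: tensor_sum_def sum_subtractf right_diff_distrib)
    also have "\<dots> \<le> (\<Sum>a\<in>A. \<bar>c a\<bar> * \<bar>tensor (D a) s x - tensor (D a) s y\<bar>)"
      by (rule order_trans[OF sum_abs]) (simp add: abs_mult)
    also have "\<dots> \<le> (\<Sum>a\<in>A. \<bar>c a\<bar> *
        ((real CARD('n) + 2) * B ^ CARD('n) * r a powr (- (real (sum s UNIV) + ?\<beta>)) * ?v))"
      by (intro sum_mono mult_left_mono tensor_hoelder) (use D bd s B r \<beta> in auto)
    also have "\<dots> = (\<Sum>a\<in>A. \<bar>c a\<bar> * ((real CARD('n) + 2) * B ^ CARD('n) * r a powr (- \<alpha>))) * ?v"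
      using s by (simp add: sum_distrib_right mult.assoc)
    also have "\<dots> \<le> L * ?v" using L by (intro mult_right_mono) auto
    finally show ?thesis using s by simp
  qed
  ultimately show ?thesis unfolding hoelder_class_def by auto
qed

section \<open>A plateau divided by walls\<close>

lemma plateau_bumpD:
  assumes "plateau_bump w"
  shows "0 \<le> w t" "w t \<le> 1" "\<bar>t\<bar> \<le> 1/2 \<Longrightarrow> w t = 1" "\<bar>t\<bar> \<ge> 1 \<Longrightarrow> w t = 0"
    "\<bar>s\<bar> \<le> \<bar>t\<bar> \<Longrightarrow> w t \<le> w s"
proof -
  note * = assms[unfolded plateau_bump_def]
  show "0 \<le> w t" "w t \<le> 1" using * by simp_all
  show "w t = 1" if "\<bar>t\<bar> \<le> 1/2" using * that by simp
  show "w t = 0" if "\<bar>t\<bar> \<ge> 1" using * that by simp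
  show "w t \<le> w s" if "\<bar>s\<bar> \<le> \<bar>t\<bar>" using * that by blast
qed

text \<open>
  The coordinate \<open>k\<close> runs across the walls. The plateau is the cube of half side \<open>R\<close> and the density
  vanishes outside the cube of half side \<open>2 R\<close>. The \<open>M + 1\<close> walls have equal distances
  \<open>2 R / (M + 2)\<close>, half width \<open>h\<close> and depth \<open>e\<close>; the bound on \<open>h\<close> keeps their centres at distance at
  least \<open>8 h\<close> from each other and from the boundary of the plateau.
\<close>

locale walled_plateau =
  fixes k :: "'n::finite" and w :: "real \<Rightarrow> real" and R h e lam :: real and M :: nat
  assumes bump: "plateau_bump w" and w_cont: "continuous_on UNIV w"
    and R: "R > 0" and h: "h > 0" "4 * h * (real M + 2) \<le> R"
    and e: "0 \<le> e" "e \<le> lam" and lam: "lam > 0"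
begin

definition wall :: "nat \<Rightarrow> real"
  where "wall m = - R + (real m + 1) * (2 * R / (real M + 2))"

definition base :: "real \<Rightarrow> real"
  where "base t = w (t / (2 * R))"

definition dip :: "nat \<Rightarrow> real \<Rightarrow> real"
  where "dip m t = w ((t - wall m) / h)"

definition dips :: "nat set \<Rightarrow> real \<Rightarrow> real"
  where "dips S t = (\<Sum>m\<in>S. dip m t)"

definition base_cross :: "real ^ 'n \<Rightarrow> real"
  where "base_cross x = (\<Prod>i\<in>- {k}. base (x $ i))"

definition neck :: "real ^ 'n \<Rightarrow> real"
  where "neck x = (\<Prod>i\<in>- {k}. w (x $ i / h))"

text \<open>
  The first summand lowers the density in all walls. The second one reopens a passage around the
  axis \<open>\<real> e\<^sub>k\<close> in every wall except the wall \<open>j\<close>: where \<open>neck\<close> is 1, it cancels the dips exactly.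
\<close>

definition p :: "nat \<Rightarrow> real ^ 'n \<Rightarrow> real"
  where "p j x = base_cross x * (lam * base (x $ k) - e * dips {..M} (x $ k))
                 + e * dips ({..M} - {j}) (x $ k) * neck x"

lemma h_le_R: "8 * h \<le> R"
proof -
  have "8 * h \<le> 4 * h * (real M + 2)" using h by (simp add: algebra_simps)
  then show ?thesis using h by linarith
qed

lemma h_le_spacing: "8 * h \<le> 2 * R / (real M + 2)"
  using h by (simp add: field_simps)

lemma wall_diff: "wall m - wall m' = (real m - real m') * (2 * R / (real M + 2))"
proof -
  have "- R + (real m + 1) * D - (- R + (real m' + 1) * D) = (real m - real m') * D" for D
    by (simp add: algebra_simps)
  then show ?thesis unfolding wall_def .
qed

lemma wall_separated: "m \<noteq> m' \<Longrightarrow> 8 * h \<le> \<bar>wall m - wall m'\<bar>"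
proof -
  assume "m \<noteq> m'"
  then have "1 * (8 * h) \<le> \<bar>real m - real m'\<bar> * (2 * R / (real M + 2))"
    using h h_le_spacing by (intro mult_mono) auto
  also have "\<dots> = \<bar>wall m - wall m'\<bar>"
    unfolding wall_diff abs_mult using R by simp
  finally show ?thesis by simp
qed

lemma wall_bounds:
  assumes "m \<le> M" shows "\<bar>wall m\<bar> + 8 * h \<le> R"
proof -
  let ?D = "2 * R / (real M + 2)"
  have D: "?D > 0" using R by simp
  have "1 * ?D \<le> (real m + 1) * ?D" using D by (intro mult_right_mono) auto
  moreover have "(real m + 1) * ?D \<le> (real M + 1) * ?D" using D assms by (intro mult_right_mono) auto
  moreover have "(real M + 1) * ?D = 2 * R - ?D" by (simp add: field_simps)
  ultimately show ?thesis using h_le_spacing unfolding wall_def by linarith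
qed

lemma dip_range: "0 \<le> dip m t" "dip m t \<le> 1"
  unfolding dip_def by (rule plateau_bumpD[OF bump])+

lemma dip_far: "h \<le> \<bar>t - wall m\<bar> \<Longrightarrow> dip m t = 0"
  unfolding dip_def using h by (intro plateau_bumpD(4)[OF bump]) (simp add: le_divide_eq)

lemma dip_near: "\<bar>t - wall m\<bar> \<le> h / 2 \<Longrightarrow> dip m t = 1"
  unfolding dip_def using h by (intro plateau_bumpD(3)[OF bump]) (simp add: field_simps)

lemma dip_mono: "\<bar>s - wall m\<bar> \<le> \<bar>t - wall m\<bar> \<Longrightarrow> dip m t \<le> dip m s"
  unfolding dip_def using h by (intro plateau_bumpD(5)[OF bump]) (simp add: divide_right_mono)

lemma base_range: "0 \<le> base t" "base t \<le> 1"
  unfolding base_def by (rule plateau_bumpD[OF bump])+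

lemma base_near: "\<bar>t\<bar> \<le> R \<Longrightarrow> base t = 1"
  unfolding base_def using R by (intro plateau_bumpD(3)[OF bump]) (simp add: field_simps)

lemma base_far: "2 * R \<le> \<bar>t\<bar> \<Longrightarrow> base t = 0"
  unfolding base_def using R by (intro plateau_bumpD(4)[OF bump]) (simp add: field_simps)

lemma base_mono: "\<bar>s\<bar> \<le> \<bar>t\<bar> \<Longrightarrow> base t \<le> base s"
  unfolding base_def using R by (intro plateau_bumpD(5)[OF bump]) (simp add: divide_right_mono)

lemma dip_imp_base: "m \<le> M \<Longrightarrow> dip m t \<noteq> 0 \<Longrightarrow> base t = 1"
proof (intro base_near)
  assume m: "m \<le> M" and "dip m t \<noteq> 0"
  then have "\<bar>t - wall m\<bar> < h" using dip_far[of t m] by (cases "h \<le> \<bar>t - wall m\<bar>") auto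
  then show "\<bar>t\<bar> \<le> R" using wall_bounds[OF m] h by linarith
qed

lemma dip_unique: "dip m t \<noteq> 0 \<Longrightarrow> m' \<noteq> m \<Longrightarrow> dip m' t = 0"
proof (intro dip_far)
  assume m: "m' \<noteq> m" and "dip m t \<noteq> 0"
  then have "\<bar>t - wall m\<bar> < h" using dip_far[of t m] by (cases "h \<le> \<bar>t - wall m\<bar>") auto
  then show "h \<le> \<bar>t - wall m'\<bar>" using wall_separated[OF m] h by linarith
qed

text \<open>
  No two walls overlap, so at each point at most one summand of \<open>dips\<close> is nonzero; since walls
  lie in the plateau, \<open>base\<close> is 1 there.
\<close>

lemma dips_cases:
  assumes "S \<subseteq> {..M}"
  obtains "\<And>m. m \<in> S \<Longrightarrow> dip m t = 0" "dips S t = 0"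
  | m where "m \<in> S" "dip m t \<noteq> 0" "dips S t = dip m t" "base t = 1"
proof (cases "\<exists>m\<in>S. dip m t \<noteq> 0")
  case True
  then obtain m where m: "m \<in> S" "dip m t \<noteq> 0" by blast
  have "finite S" using assms finite_subset by blast
  then have "dips S t = dip m t + (\<Sum>m\<in>S - {m}. dip m t)"
    unfolding dips_def using m by (intro sum.remove)
  also have "(\<Sum>m\<in>S - {m}. dip m t) = 0" using dip_unique[OF m(2)] by (intro sum.neutral) auto
  finally show ?thesis using that(2)[OF m] dip_imp_base[of m t] m assms by auto
next
  case False
  then show ?thesis using that(1) by (auto simp: dips_def)
qed

lemma dips_nonneg: "0 \<le> dips S t"
  unfolding dips_def by (intro sum_nonneg dip_range)

lemma dips_le_base:
  assumes "S \<subseteq> {..M}" shows "dips S t \<le> base t"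
  using assms by (cases rule: dips_cases[where t = t]) (simp_all add: dip_range base_range)

lemma dips_remove: "j \<le> M \<Longrightarrow> dips {..M} t = dip j t + dips ({..M} - {j}) t"
  unfolding dips_def by (intro sum.remove) auto

lemma base_cross_range: "0 \<le> base_cross x" "base_cross x \<le> 1"
  unfolding base_cross_def using base_range by (auto intro!: prod_nonneg prod_le_1)

lemma neck_nonneg: "0 \<le> neck x"
  unfolding neck_def by (intro prod_nonneg plateau_bumpD(1)[OF bump])

lemma neck_le_base_cross: "neck x \<le> base_cross x"
  unfolding neck_def base_cross_def
proof (intro prod_mono conjI)
  fix i
  show "0 \<le> w (x $ i / h)" by (rule plateau_bumpD(1)[OF bump])
  show "w (x $ i / h) \<le> base (x $ i)"
  proof (cases "\<bar>x $ i\<bar> \<le> R")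
    case True
    then show ?thesis using plateau_bumpD(2)[OF bump] base_near by auto
  next
    case False
    then have "w (x $ i / h) = 0"
      using h h_le_R by (intro plateau_bumpD(4)[OF bump]) (simp add: le_divide_eq)
    then show ?thesis using base_range by auto
  qed
qed

text \<open>
  In this form everything that lowers the density below \<open>lam\<close> times a product of bumps is visible
  as a product of nonnegative factors.
\<close>

lemma p_alt:
  assumes "j \<le> M"
  shows "p j x = lam * base_cross x * base (x $ k)
    - e * (dips ({..M} - {j}) (x $ k) * (base_cross x - neck x) + dip j (x $ k) * base_cross x)"
  unfolding p_def dips_remove[OF assms] by (simp add: algebra_simps)

lemma dent_le: "e * dips {..M} t \<le> lam * base t"
  using e lam dips_le_base[of "{..M}" t] dips_nonneg[of "{..M}" t] by (intro mult_mono) auto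

lemma p_nonneg: "0 \<le> p j x"
  unfolding p_def
  using dent_le[of "x $ k"] base_cross_range neck_nonneg dips_nonneg[of "{..M} - {j}" "x $ k"] e
  by (intro add_nonneg_nonneg mult_nonneg_nonneg) auto

lemma p_le:
  assumes "j \<le> M"
  shows "p j x \<le> lam - e * dip j (x $ k)"
proof -
  have "0 \<le> dips ({..M} - {j}) (x $ k) * (base_cross x - neck x)"
    using dips_nonneg[of "{..M} - {j}" "x $ k"] neck_le_base_cross by (intro mult_nonneg_nonneg) auto
  then have "0 \<le> e * (dips ({..M} - {j}) (x $ k) * (base_cross x - neck x))" using e by simp
  then have le: "p j x \<le> base_cross x * (lam * base (x $ k) - e * dip j (x $ k))"
    unfolding p_alt[OF assms] by (simp add: algebra_simps)
  have "e * dip j (x $ k) \<le> lam * base (x $ k)"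
    using dip_imp_base[OF assms, of "x $ k"] dip_range[of j "x $ k"] e lam base_range[of "x $ k"]
    by (cases "dip j (x $ k) = 0") (auto intro: mult_mono[of e lam _ 1, simplified])
  then have "base_cross x * (lam * base (x $ k) - e * dip j (x $ k))
      \<le> 1 * (lam * base (x $ k) - e * dip j (x $ k))"
    using base_cross_range by (intro mult_right_mono) auto
  also have "\<dots> \<le> lam - e * dip j (x $ k)" using lam base_range[of "x $ k"] by simp
  finally show ?thesis using le by linarith
qed

lemma p_le_lam: "j \<le> M \<Longrightarrow> p j x \<le> lam"
  using p_le[of j x] e dip_range[of j "x $ k"] mult_nonneg_nonneg[of e "dip j (x $ k)"] by linarith

lemma p_axis:
  assumes "j \<le> M"
  shows "p j (axis k t) = lam * base t - e * dip j t"
proof -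
  have "base_cross (axis k t) = 1" "neck (axis k t) = 1"
    unfolding base_cross_def neck_def using R plateau_bumpD(3)[OF bump, of 0]
    by (auto intro!: prod.neutral simp: axis_def base_near)
  then show ?thesis unfolding p_alt[OF assms] by simp
qed

text \<open>
  Towards the axis \<open>\<real> e\<^sub>k\<close> the density rises in every transversal coordinate, and along the
  axis it rises away from the walls.
\<close>

lemma p_mono:
  assumes j: "j \<le> M"
    and trans: "\<And>i. i \<noteq> k \<Longrightarrow> \<bar>y $ i\<bar> \<le> \<bar>x $ i\<bar> \<or> \<bar>y $ i\<bar> \<le> h / 2"
    and base: "base (x $ k) \<le> base (y $ k)" and dip: "\<And>m. m \<le> M \<Longrightarrow> dip m (y $ k) \<le> dip m (x $ k)"
  shows "p j x \<le> p j y"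
proof -
  have cross: "base_cross x \<le> base_cross y"
    unfolding base_cross_def
  proof (intro prod_mono conjI base_range)
    fix i assume "i \<in> - {k}"
    then consider "\<bar>y $ i\<bar> \<le> \<bar>x $ i\<bar>" | "\<bar>y $ i\<bar> \<le> h / 2" using trans[of i] by auto
    then show "base (x $ i) \<le> base (y $ i)"
      by cases (use base_mono base_near[of "y $ i"] h h_le_R base_range[of "x $ i"] in auto)
  qed
  have neck: "neck x \<le> neck y"
    unfolding neck_def
  proof (intro prod_mono conjI plateau_bumpD(1)[OF bump])
    fix i assume "i \<in> - {k}"
    then consider "\<bar>y $ i\<bar> \<le> \<bar>x $ i\<bar>" | "\<bar>y $ i\<bar> \<le> h / 2" using trans[of i] by auto
    then show "w (x $ i / h) \<le> w (y $ i / h)"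
    proof cases
      case 1
      then show ?thesis using h by (intro plateau_bumpD(5)[OF bump]) (simp add: divide_right_mono)
    next
      case 2
      then have "w (y $ i / h) = 1" using h by (intro plateau_bumpD(3)[OF bump]) (simp add: field_simps)
      then show ?thesis using plateau_bumpD(2)[OF bump] by simp
    qed
  qed
  let ?W = "dips ({..M} - {j})"
  have "p j x \<le> base_cross y * (lam * base (x $ k) - e * dips {..M} (x $ k)) + e * ?W (x $ k) * neck y"
    unfolding p_def
    using cross neck dent_le[of "x $ k"] e dips_nonneg[of "{..M} - {j}" "x $ k"]
    by (intro add_mono mult_right_mono mult_left_mono mult_nonneg_nonneg) auto
  also have "\<dots> = lam * base_cross y * base (x $ k)
    - e * (?W (x $ k) * (base_cross y - neck y) + dip j (x $ k) * base_cross y)"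
    unfolding dips_remove[OF j] by (simp add: algebra_simps)
  also have "\<dots> \<le> lam * base_cross y * base (y $ k)
    - e * (?W (y $ k) * (base_cross y - neck y) + dip j (y $ k) * base_cross y)"
  proof (intro diff_mono mult_left_mono add_mono mult_right_mono)
    show "?W (y $ k) \<le> ?W (x $ k)" unfolding dips_def using dip by (intro sum_mono) auto
  qed (use base dip j lam e base_cross_range neck_le_base_cross in auto)
  also have "\<dots> = p j y" unfolding p_alt[OF j] ..
  finally show ?thesis .
qed

lemma p_continuous: "continuous_on S (p j)"
proof -
  have c: "continuous_on UNIV (\<lambda>x. w (f x))" if "continuous_on UNIV f" for f :: "real ^ 'n \<Rightarrow> real"
    using continuous_on_compose2[OF w_cont that] by auto
  have "continuous_on UNIV (p j)"
    unfolding p_def base_cross_def neck_def base_def dips_def dip_def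
    using R h by (intro continuous_intros c) auto
  then show ?thesis by (rule continuous_on_subset) auto
qed

lemma p_support: "p j x \<noteq> 0 \<Longrightarrow> \<bar>x $ i\<bar> \<le> 2 * R"
proof (rule ccontr)
  assume nz: "p j x \<noteq> 0" and "\<not> \<bar>x $ i\<bar> \<le> 2 * R"
  then have b0: "base (x $ i) = 0" by (intro base_far) auto
  show False
  proof (cases "i = k")
    case True
    then have "dips {..M} (x $ k) = 0" "dips ({..M} - {j}) (x $ k) = 0"
      using dips_le_base[of "{..M}" "x $ k"] dips_le_base[of "{..M} - {j}" "x $ k"]
        dips_nonneg[of "{..M}" "x $ k"] dips_nonneg[of "{..M} - {j}" "x $ k"] b0 by auto
    then show ?thesis using nz b0 True by (simp add: p_def)
  next
    case False
    then have "base_cross x = 0" unfolding base_cross_def using b0 by (intro prod_zero) auto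
    then show ?thesis using nz neck_le_base_cross[of x] neck_nonneg[of x] by (simp add: p_def)
  qed
qed

subsection \<open>Superlevel sets retract to the axis\<close>

lemma connected_if_retracts_to_axis:
  fixes S :: "(real ^ 'n) set"
  assumes T: "connected {t. axis k t \<in> S}" and seg: "\<And>x. x \<in> S \<Longrightarrow> closed_segment x (axis k (x $ k)) \<subseteq> S"
  shows "connected S"
proof -
  let ?A = "axis k ` {t. axis k t \<in> S}"
  have eq: "axis k = (\<lambda>t::real. t *\<^sub>R axis k 1)" by (auto simp: fun_eq_iff axis_def vec_eq_iff)
  have "continuous_on {t. axis k t \<in> S} (axis k :: real \<Rightarrow> real ^ 'n)"
    by (subst eq) (intro continuous_intros)
  then have A: "connected ?A" using T by (rule connected_continuous_image)
  have to_axis: "connected_component S x (axis k (x $ k))" if "x \<in> S" for x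
    by (rule connected_componentI[OF connected_segment seg[OF that]]) auto
  have in_axis: "axis k (x $ k) \<in> ?A" if "x \<in> S" for x
    using seg[OF that] ends_in_segment(2)[of "axis k (x $ k)" x] by blast
  show ?thesis
    unfolding connected_iff_connected_component
  proof (intro ballI)
    fix x y assume xy: "x \<in> S" "y \<in> S"
    have "connected_component S (axis k (x $ k)) (axis k (y $ k))"
      by (rule connected_componentI[OF A]) (use in_axis xy in auto)
    then show "connected_component S x y"
      using to_axis xy by (metis connected_component_sym connected_component_trans)
  qed
qed

lemma segment_to_axis:
  assumes j: "j \<le> M" and y: "y \<in> closed_segment x (axis k (x $ k))"
  shows "y $ k = x $ k" "p j x \<le> p j y"
proof -
  obtain u where u: "0 \<le> u" "u \<le> 1" "y = (1 - u) *\<^sub>R x + u *\<^sub>R axis k (x $ k)"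
    using y by (auto simp: in_segment)
  show yk: "y $ k = x $ k" unfolding u(3) by (simp add: axis_def left_diff_distrib)
  have "\<bar>y $ i\<bar> \<le> \<bar>x $ i\<bar>" if "i \<noteq> k" for i
  proof -
    have "\<bar>y $ i\<bar> = (1 - u) * \<bar>x $ i\<bar>"
      unfolding u(3) using that u(1,2) by (simp add: axis_def abs_mult)
    also have "\<dots> \<le> 1 * \<bar>x $ i\<bar>" using u(1) by (intro mult_right_mono) auto
    finally show ?thesis by simp
  qed
  then show "p j x \<le> p j y" by (intro p_mono[OF j]) (auto simp: yk)
qed

text \<open>
  Superlevel sets with strict and with non-strict inequality are treated at once: \<open>Q\<close> is an
  upward closed condition on the value of the density.
\<close>

lemma superlevel_connected_if_axis:
  assumes j: "j \<le> M" and Q: "\<And>a b. Q a \<Longrightarrow> a \<le> b \<Longrightarrow> Q b"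
    and T: "\<And>s t u. \<lbrakk>Q (lam * base s - e * dip j s); s \<in> I; Q (lam * base u - e * dip j u); u \<in> I;
      s \<le> t; t \<le> u\<rbrakk> \<Longrightarrow> Q (lam * base t - e * dip j t) \<and> t \<in> I"
  shows "connected {x. Q (p j x) \<and> x $ k \<in> I}"
proof (rule connected_if_retracts_to_axis)
  have eq: "{t. axis k t \<in> {x. Q (p j x) \<and> x $ k \<in> I}} = {t. Q (lam * base t - e * dip j t) \<and> t \<in> I}"
    using p_axis[OF j] by (auto simp: axis_def)
  show "connected {t. axis k t \<in> {x. Q (p j x) \<and> x $ k \<in> I}}"
    unfolding eq is_interval_connected_1[symmetric] is_interval_1 using T by blast
  show "closed_segment x (axis k (x $ k)) \<subseteq> {x. Q (p j x) \<and> x $ k \<in> I}"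
    if "x \<in> {x. Q (p j x) \<and> x $ k \<in> I}" for x
    using that segment_to_axis[OF j] Q by (smt (verit) mem_Collect_eq subsetI)
qed

text \<open>
  Along the axis and to the left of the closed wall, the density first rises to the plateau and then
  falls into the wall, so that the points above a level form an interval.
\<close>

lemma superlevel_left_connected:
  assumes j: "j \<le> M" and Q: "\<And>a b. Q a \<Longrightarrow> a \<le> b \<Longrightarrow> Q b"
  shows "connected {x. Q (p j x) \<and> x $ k \<in> {..<wall j}}"
proof (rule superlevel_connected_if_axis[OF j Q])
  fix s t u
  assume *: "Q (lam * base s - e * dip j s)" "Q (lam * base u - e * dip j u)"
    "u \<in> {..<wall j}" "s \<le> t" "t \<le> u"
  have "lam * base s - e * dip j s \<le> lam * base t - e * dip j t \<or>
        lam * base u - e * dip j u \<le> lam * base t - e * dip j t"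
  proof (cases "t < - R")
    case True
    then have "dip j s = 0" "dip j t = 0" using * wall_bounds[OF j] h by (auto intro!: dip_far)
    moreover have "base s \<le> base t" using * True R by (intro base_mono) auto
    ultimately show ?thesis using lam by simp
  next
    case False
    then have "base t = 1" using * wall_bounds[OF j] h by (intro base_near) auto
    moreover have "dip j t \<le> dip j u" using * by (intro dip_mono) auto
    then have "e * dip j t \<le> e * dip j u" using e by (intro mult_left_mono)
    moreover have "lam * base u \<le> lam * 1" using lam base_range by (intro mult_left_mono) auto
    ultimately show ?thesis by (intro disjI2) simp
  qed
  then show "Q (lam * base t - e * dip j t) \<and> t \<in> {..<wall j}" using * Q by auto
qed

lemma superlevel_right_connected:
  assumes j: "j \<le> M" and Q: "\<And>a b. Q a \<Longrightarrow> a \<le> b \<Longrightarrow> Q b"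
  shows "connected {x. Q (p j x) \<and> x $ k \<in> {wall j<..}}"
proof (rule superlevel_connected_if_axis[OF j Q])
  fix s t u
  assume *: "Q (lam * base s - e * dip j s)" "Q (lam * base u - e * dip j u)"
    "s \<in> {wall j<..}" "s \<le> t" "t \<le> u"
  have "lam * base u - e * dip j u \<le> lam * base t - e * dip j t \<or>
        lam * base s - e * dip j s \<le> lam * base t - e * dip j t"
  proof (cases "t > R")
    case True
    then have "dip j u = 0" "dip j t = 0" using * wall_bounds[OF j] h by (auto intro!: dip_far)
    moreover have "base u \<le> base t" using * True R by (intro base_mono) auto
    ultimately show ?thesis using lam by simp
  next
    case False
    then have "base t = 1" using * wall_bounds[OF j] h by (intro base_near) auto
    moreover have "dip j t \<le> dip j s" using * by (intro dip_mono) auto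
    then have "e * dip j t \<le> e * dip j s" using e by (intro mult_left_mono)
    moreover have "lam * base s \<le> lam * 1" using lam base_range by (intro mult_left_mono) auto
    ultimately show ?thesis by (intro disjI2) simp
  qed
  then show "Q (lam * base t - e * dip j t) \<and> t \<in> {wall j<..}" using * Q by auto
qed

text \<open>
  Even in the closed wall the density on the axis does not fall below \<open>lam - e\<close>, so at such low
  levels the wall does not separate.
\<close>

lemma superlevel_low_connected:
  assumes j: "j \<le> M" and Q: "\<And>a b. Q a \<Longrightarrow> a \<le> b \<Longrightarrow> Q b" and low: "Q (lam - e)"
  shows "connected {x. Q (p j x)}"
proof -
  have "connected {x. Q (p j x) \<and> x $ k \<in> UNIV}"
  proof (rule superlevel_connected_if_axis[OF j Q])
    fix s t u
    assume *: "Q (lam * base s - e * dip j s)" "Q (lam * base u - e * dip j u)" "s \<le> t" "t \<le> u"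
    show "Q (lam * base t - e * dip j t) \<and> t \<in> UNIV"
    proof (cases "\<bar>t\<bar> \<le> R")
      case True
      have "e * dip j t \<le> e * 1" using e dip_range by (intro mult_left_mono) auto
      then have "lam - e \<le> lam * base t - e * dip j t" using base_near[OF True] by simp
      then show ?thesis using low Q by auto
    next
      case False
      then have t: "dip j t = 0" using wall_bounds[OF j] h by (intro dip_far) auto
      have nn: "0 \<le> e * dip j v" for v using e dip_range by simp
      have "base s \<le> base t \<or> base u \<le> base t"
        using False * base_mono[of t s] base_mono[of t u] by linarith
      then have "lam * base s \<le> lam * base t \<or> lam * base u \<le> lam * base t" using lam by auto
      then have "lam * base s - e * dip j s \<le> lam * base t - e * dip j t \<or>
          lam * base u - e * dip j u \<le> lam * base t - e * dip j t"
        using nn[of s] nn[of u] t by (auto simp: algebra_simps)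
      then show ?thesis using * Q by blast
    qed
  qed
  then show ?thesis by simp
qed

end

section \<open>Split levels and regularity of the level sets\<close>

lemma connected_one_side:
  fixes S :: "(real ^ 'n) set"
  assumes "connected S" "\<And>x. x \<in> S \<Longrightarrow> x $ k \<noteq> c"
  shows "S \<subseteq> {x. x $ k \<in> {..<c}} \<or> S \<subseteq> {x. x $ k \<in> {c<..}}"
proof (rule ccontr)
  assume "\<not> ?thesis"
  then obtain x y where "x \<in> S" "y \<in> S" "x $ k \<le> c" "c \<le> y $ k"
    by (auto simp: subset_eq not_less)
  then show False using connected_ivt_component_cart[OF assms(1)] assms(2) by metis
qed

lemma components_connected_subset_eq:
  assumes "U \<in> components S" "U' \<in> components S" "connected V" "V \<subseteq> S" "U \<inter> V \<noteq> {}" "U' \<inter> V \<noteq> {}"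
  shows "U = U'"
proof -
  have "V \<subseteq> U" "V \<subseteq> U'" using assms components_maximal by blast+
  then have "U \<inter> U' \<noteq> {}" using assms(5) by blast
  then show ?thesis using components_eq assms(1,2) by blast
qed

text \<open>
  One point is chosen in each cell of a grid of mesh \<open>r / d\<close> that meets the set; two points of one
  cell have distance at most \<open>r\<close>.
\<close>

lemma cond_C2_bounded:
  fixes c :: real
  assumes "c > 0" "r\<^sub>I > 0"
  shows "\<exists>C\<^sub>I>0. \<forall>\<Omega> :: (real ^ 'n::finite) set. (\<forall>x\<in>\<Omega>. \<forall>i. \<bar>x $ i\<bar> \<le> c) \<longrightarrow> cond_C2 r\<^sub>I C\<^sub>I \<Omega>"
proof (intro exI conjI allI impI)
  let ?d = "real CARD('n)"
  let ?C = "(2 * c * ?d + 2 * r\<^sub>I) ^ CARD('n)"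
  show "?C > 0" using assms by (simp add: add_pos_pos)
  fix \<Omega> :: "(real ^ 'n) set" assume \<Omega>: "\<forall>x\<in>\<Omega>. \<forall>i. \<bar>x $ i\<bar> \<le> c"
  show "cond_C2 r\<^sub>I ?C \<Omega>"
    unfolding cond_C2_def
  proof (intro allI impI, elim conjE)
    fix r :: real assume r: "0 < r" "r \<le> r\<^sub>I"
    define s where "s = r / ?d"
    have s: "s > 0" using r by (simp add: s_def)
    define g where "g = (\<lambda>(x :: real ^ 'n) i. \<lfloor>x $ i / s\<rfloor>)"
    define rep where "rep = (\<lambda>c. SOME x. x \<in> \<Omega> \<and> g x = c)"
    have rep: "rep (g x) \<in> \<Omega>" "g (rep (g x)) = g x" if "x \<in> \<Omega>" for x
      using someI[of "\<lambda>y. y \<in> \<Omega> \<and> g y = g x" x] that by (auto simp: rep_def)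
    let ?I = "{\<lfloor>- c / s\<rfloor>..\<lfloor>c / s\<rfloor>}"
    let ?G = "PiE (UNIV :: 'n set) (\<lambda>_. ?I)"
    have "g ` \<Omega> \<subseteq> ?G"
    proof clarify
      fix x assume "x \<in> \<Omega>"
      then have "- c \<le> x $ i" "x $ i \<le> c" for i
        using \<Omega>[rule_format, of x i] by linarith+
      then have "- c / s \<le> x $ i / s" "x $ i / s \<le> c / s" for i
        using s by (intro divide_right_mono; simp)+
      then show "g x \<in> ?G" by (auto simp: g_def intro!: floor_mono)
    qed
    moreover have finG: "finite ?G" by (intro finite_PiE) auto
    ultimately have fin: "finite (g ` \<Omega>)" and "card (g ` \<Omega>) \<le> card ?G"
      by (auto intro: finite_subset card_mono)
    have "real (card ?I) \<le> (2 * c * ?d + 2 * r\<^sub>I) / r"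
    proof -
      define lo hi where "lo = \<lfloor>- c / s\<rfloor>" and "hi = \<lfloor>c / s\<rfloor>"
      have "of_int hi \<le> c / s" unfolding hi_def by linarith
      moreover have "of_int lo \<ge> - (c / s) - 1" unfolding lo_def minus_divide_left by linarith
      moreover have "lo \<le> hi" unfolding lo_def hi_def using s assms by (intro floor_mono divide_right_mono) auto
      then have "real (card {lo..hi}) = of_int hi - of_int lo + 1" by simp
      ultimately have "real (card ?I) \<le> 2 * (c / s) + 2" unfolding lo_def[symmetric] hi_def[symmetric] by linarith
      also have "\<dots> = (2 * c * ?d + 2 * r) / r" using r by (simp add: s_def field_simps)
      also have "\<dots> \<le> (2 * c * ?d + 2 * r\<^sub>I) / r" using r by (intro divide_right_mono) auto
      finally show ?thesis .
    qed
    then have "real (card ?I) ^ CARD('n) \<le> ((2 * c * ?d + 2 * r\<^sub>I) / r) ^ CARD('n)"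
      by (intro power_mono) auto
    moreover have "card ?G = card ?I ^ CARD('n)" by (subst card_PiE) auto
    ultimately have cardG: "real (card ?G) \<le> ?C / r ^ CARD('n)" by (simp add: power_divide)
    have "card (rep ` g ` \<Omega>) \<le> card ?G"
      using card_image_le[OF fin, of rep] \<open>card (g ` \<Omega>) \<le> card ?G\<close> by linarith
    then have "real (card (rep ` g ` \<Omega>)) \<le> ?C / r ^ CARD('n)" using cardG by linarith
    moreover have "\<Omega> \<subseteq> (\<Union>y\<in>rep ` g ` \<Omega>. cball y r)"
    proof
      fix x assume x: "x \<in> \<Omega>"
      let ?y = "rep (g x)"
      have "\<bar>?y $ i - x $ i\<bar> \<le> s" for i
      proof -
        have "\<lfloor>?y $ i / s\<rfloor> = \<lfloor>x $ i / s\<rfloor>" using rep(2)[OF x] by (auto simp: g_def fun_eq_iff)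
        then have "\<bar>?y $ i / s - x $ i / s\<bar> \<le> 1" by linarith
        then have "\<bar>(?y $ i - x $ i) / s\<bar> \<le> 1" by (simp add: diff_divide_distrib)
        then show ?thesis using s by (simp add: divide_le_eq)
      qed
      then have "norm (?y - x) \<le> (\<Sum>i\<in>(UNIV :: 'n set). s)"
        by (intro order_trans[OF norm_le_l1_cart] sum_mono) auto
      then have "dist ?y x \<le> r" using r by (simp add: dist_norm s_def)
      then show "x \<in> (\<Union>y\<in>rep ` g ` \<Omega>. cball y r)" using x by auto
    qed
    moreover have "rep ` g ` \<Omega> \<subseteq> \<Omega>" using rep by auto
    ultimately show "\<exists>N\<subseteq>\<Omega>. finite N \<and> real (card N) \<le> ?C / r ^ CARD('n) \<and> \<Omega> \<subseteq> (\<Union>y\<in>N. cball y r)"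
      using fin by (intro exI[of _ "rep ` g ` \<Omega>"]) auto
  qed
qed

lemma unit_ball_volume_pos: "0 < unit_ball_volume TYPE('n::finite)"
  using content_cball_pos[of 1 "0 :: real ^ 'n"] by simp

text \<open>
  A closed set that contains, with each of its points, an axis-parallel cube of fixed side with
  a corner at this point has the inner volume property.
\<close>

lemma cond_C1_corner_cubes:
  fixes \<Omega> :: "(real ^ 'n::finite) set"
  assumes "closed \<Omega>" "\<rho> > 0"
    and cube: "\<And>x. x \<in> \<Omega> \<Longrightarrow> \<exists>\<sigma>. (\<forall>i. \<sigma> i \<in> {-1, 1}) \<and>
      (\<forall>y. (\<forall>i. \<exists>u. 0 \<le> u \<and> u \<le> \<rho> \<and> y $ i = x $ i + \<sigma> i * u) \<longrightarrow> y \<in> \<Omega>)"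
  shows "cond_C1 \<rho> (1 / (real CARD('n) ^ CARD('n) * unit_ball_volume TYPE('n))) \<Omega>"
  unfolding cond_C1_def
proof (intro allI impI, elim conjE)
  fix r :: real and x :: "real ^ 'n" assume r: "0 \<le> r" "r \<le> \<rho>" and x: "x \<in> \<Omega>"
  let ?d = "real CARD('n)"
  obtain \<sigma> :: "'n \<Rightarrow> real" where \<sigma>: "\<And>i. \<sigma> i \<in> {-1, 1}"
    "\<And>y. (\<And>i. \<exists>u. 0 \<le> u \<and> u \<le> \<rho> \<and> y $ i = x $ i + \<sigma> i * u) \<Longrightarrow> y \<in> \<Omega>"
    using cube[OF x] by metis
  define s where "s = r / ?d"
  have "real 1 \<le> ?d" by (simp add: Suc_leI)
  then have d1: "1 \<le> ?d" by simp
  have s0: "0 \<le> s" "s * ?d = r" using r by (simp_all add: s_def)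
  moreover have "s * 1 \<le> s * ?d" using d1 s0 by (intro mult_left_mono) auto
  ultimately have s: "0 \<le> s" "s \<le> \<rho>" "s * ?d = r" using r by auto
  define a where "a = (\<chi> i. min (x $ i) (x $ i + \<sigma> i * s))"
  define b where "b = (\<chi> i. max (x $ i) (x $ i + \<sigma> i * s))"
  have ab: "b $ i - a $ i = s" "a $ i \<le> b $ i" for i
    using \<sigma>(1)[of i] s by (auto simp: a_def b_def)
  have sub: "cbox a b \<subseteq> cball x r \<inter> \<Omega>"
  proof
    fix y assume "y \<in> cbox a b"
    then have y: "a $ i \<le> y $ i" "y $ i \<le> b $ i" for i by (auto simp: mem_box_cart)
    have u: "0 \<le> \<sigma> i * (y $ i - x $ i) \<and> \<sigma> i * (y $ i - x $ i) \<le> s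
        \<and> y $ i = x $ i + \<sigma> i * (\<sigma> i * (y $ i - x $ i))" for i
      using \<sigma>(1)[of i] y[of i] s by (auto simp: a_def b_def)
    have "y \<in> \<Omega>"
    proof (rule \<sigma>(2))
      fix i show "\<exists>u. 0 \<le> u \<and> u \<le> \<rho> \<and> y $ i = x $ i + \<sigma> i * u"
        using u[of i] s by (intro exI[of _ "\<sigma> i * (y $ i - x $ i)"]) auto
    qed
    have "\<bar>x $ i - y $ i\<bar> \<le> s" for i using u[of i] \<sigma>(1)[of i] by auto
    then have "norm (x - y) \<le> (\<Sum>i\<in>(UNIV :: 'n set). s)"
      by (intro order_trans[OF norm_le_l1_cart] sum_mono) auto
    then have "dist x y \<le> r" using s by (simp add: dist_norm mult.commute)
    with \<open>y \<in> \<Omega>\<close> show "y \<in> cball x r \<inter> \<Omega>" by simp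
  qed
  have "compact (cball x r \<inter> \<Omega>)" by (intro compact_Int_closed assms compact_cball)
  then have "measure lebesgue (cbox a b) \<le> measure lebesgue (cball x r \<inter> \<Omega>)"
    by (intro measure_mono_fmeasurable sub lmeasurable_compact) auto
  moreover have "cbox a b \<noteq> {}" using ab(2) by (simp add: interval_ne_empty_cart)
  then have "measure lebesgue (cbox a b) = (\<Prod>i\<in>UNIV. b $ i - a $ i)" by (simp add: content_cbox_cart)
  moreover have "\<dots> = s ^ CARD('n)" by (simp add: ab)
  moreover have "unit_ball_volume TYPE('n) > 0" by (rule unit_ball_volume_pos)
  then have "1 / (?d ^ CARD('n) * unit_ball_volume TYPE('n)) * unit_ball_volume TYPE('n) * r ^ CARD('n)
     = s ^ CARD('n)" by (simp add: s_def power_divide)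
  ultimately show "1 / (?d ^ CARD('n) * unit_ball_volume TYPE('n)) * unit_ball_volume TYPE('n) * r ^ CARD('n)
     \<le> measure lebesgue (cball x r \<inter> \<Omega>)" by simp
qed

context walled_plateau
begin

lemma p_low_at_wall: "j \<le> M \<Longrightarrow> \<bar>x $ k - wall j\<bar> \<le> h / 2 \<Longrightarrow> p j x \<le> lam - e"
  using p_le[of j x] dip_near[of "x $ k" j] by simp

text \<open>
  Below the level \<open>lam - e\<close> both superlevel sets, strict and non-strict, are connected. Above it
  they miss the closed wall, so a component of the non-strict one lies on one side of the wall, and
  the part of the strict one on this side is connected.
\<close>

lemma split_level_p:
  assumes j: "j \<le> M" and "split_level (p j) l"
  shows "l = lam - e"
proof (rule ccontr)
  assume l: "l \<noteq> lam - e"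
  let ?S = "{x. p j x \<ge> l}" and ?T = "{x. p j x > l}"
  obtain C U U' where C: "C \<in> components ?S" and U: "U \<in> components (C \<inter> ?T)"
    "U' \<in> components (C \<inter> ?T)" "U \<noteq> U'"
    using assms(2) unfolding split_level_def by blast
  have "connected (C \<inter> ?T)"
  proof (cases "l < lam - e")
    case True
    have "connected ?S" "connected ?T"
      using True by (auto intro!: superlevel_low_connected[OF j])
    moreover have "C \<subseteq> ?S" "C \<noteq> {}" using C in_components_subset in_components_nonempty by blast+
    ultimately have "C = ?S" using components_maximal[OF C, of ?S] by blast
    then have "C \<inter> ?T = ?T" by auto
    then show ?thesis using \<open>connected ?T\<close> by simp
  next
    case False
    have sub: "C \<subseteq> ?S" and ne: "C \<noteq> {}" and con: "connected C"
      using C in_components_subset in_components_nonempty in_components_connected by blast+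
    have "x $ k \<noteq> wall j" if "x \<in> C" for x
      using p_low_at_wall[OF j, of x] h sub that False l by auto
    from connected_one_side[OF con this]
    obtain I where I: "I = {..<wall j} \<or> I = {wall j<..}" and CI: "C \<subseteq> {x. x $ k \<in> I}" by metis
    have cS: "connected {x. p j x \<ge> l \<and> x $ k \<in> I}" and cT: "connected {x. p j x > l \<and> x $ k \<in> I}"
      using I superlevel_left_connected[OF j, of "\<lambda>v. v \<ge> l"] superlevel_right_connected[OF j, of "\<lambda>v. v \<ge> l"]
        superlevel_left_connected[OF j, of "\<lambda>v. v > l"] superlevel_right_connected[OF j, of "\<lambda>v. v > l"]
      by auto
    have "{x. p j x \<ge> l \<and> x $ k \<in> I} \<subseteq> C"
      using cS sub CI ne by (intro components_maximal[OF C]) auto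
    then have "C \<inter> ?T = {x. p j x > l \<and> x $ k \<in> I}" using CI by (auto simp: subset_eq)
    then show ?thesis using cT by simp
  qed
  moreover have "U \<inter> (C \<inter> ?T) \<noteq> {}" "U' \<inter> (C \<inter> ?T) \<noteq> {}"
    using U(1,2) in_components_subset in_components_nonempty by blast+
  ultimately have "U = U'" using components_connected_subset_eq[OF U(1,2)] by blast
  then show False using U(3) by simp
qed

text \<open>
  The components of \<open>{p j > lam - e}\<close> lie on opposite sides of the closed wall, and they keep the
  distance \<open>h / 2\<close> from its centre because the dip is flat there. So their distance is at least
  \<open>h\<close>, whatever \<open>t \<le> 1\<close> is.
\<close>

lemma cond_S_p:
  assumes j: "j \<le> M" and "\<alpha> > 0"
  shows "cond_S \<alpha> (p j)"
  unfolding cond_S_def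
proof (intro exI conjI allI ballI impI; (elim conjE)?)
  show "(1::real) > 0" "h > 0" using h by auto
  fix l t U U'
  assume "split_level (p j) l" and t: "0 < t" "t \<le> (1::real)"
    and U: "U \<in> components {x. p j x > l}" "U' \<in> components {x. p j x > l}" "U \<noteq> U'"
    and ne: "U \<inter> {x. p j x \<ge> l + t} \<noteq> {}" "U' \<inter> {x. p j x \<ge> l + t} \<noteq> {}"
  then have l: "l = lam - e" using split_level_p[OF j] by blast
  have far: "\<bar>x $ k - wall j\<bar> > h / 2" if "x \<in> U \<union> U'" for x
  proof -
    have "p j x > lam - e" using that U in_components_subset l by blast
    then show ?thesis using p_low_at_wall[OF j, of x] by linarith
  qed
  have side: "V \<subseteq> {x. x $ k \<in> {..<wall j}} \<or> V \<subseteq> {x. x $ k \<in> {wall j<..}}"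
    if "V \<in> {U, U'}" for V
  proof (rule connected_one_side)
    show "connected V" using that U in_components_connected by blast
    show "x $ k \<noteq> wall j" if "x \<in> V" for x using far[of x] that \<open>V \<in> {U, U'}\<close> h by auto
  qed
  have nonempty: "U \<noteq> {}" "U' \<noteq> {}" using U in_components_nonempty by blast+
  have not_same: False
    if "U \<subseteq> {x. x $ k \<in> I}" "U' \<subseteq> {x. x $ k \<in> I}" "I = {..<wall j} \<or> I = {wall j<..}" for I
  proof -
    have c: "connected {x. p j x > l \<and> x $ k \<in> I}"
      using that(3) superlevel_left_connected[OF j, of "\<lambda>v. v > l"]
        superlevel_right_connected[OF j, of "\<lambda>v. v > l"] by auto
    have "U \<inter> {x. p j x > l \<and> x $ k \<in> I} \<noteq> {}" "U' \<inter> {x. p j x > l \<and> x $ k \<in> I} \<noteq> {}"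
      using nonempty that U in_components_subset by blast+
    then have "U = U'" using components_connected_subset_eq[OF U(1,2) c] by blast
    then show False using U(3) by simp
  qed
  have opp: "(x $ k < wall j \<and> wall j < y $ k) \<or> (y $ k < wall j \<and> wall j < x $ k)"
    if "x \<in> U" "y \<in> U'" for x y
    using side[of U] side[of U'] not_same that by blast
  have "h \<le> setdist (U \<inter> {x. p j x \<ge> l + t}) (U' \<inter> {x. p j x \<ge> l + t})"
  proof (rule le_setdistI[OF ne])
    fix x y assume "x \<in> U \<inter> {x. p j x \<ge> l + t}" "y \<in> U' \<inter> {x. p j x \<ge> l + t}"
    then have "h \<le> \<bar>x $ k - y $ k\<bar>" using far[of x] far[of y] opp[of x y] by auto
    then show "h \<le> dist x y" using component_le_norm_cart[of "x - y" k] by (simp add: dist_norm)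
  qed
  moreover have "t powr (1 / \<alpha>) \<le> 1" using t assms(2) by (intro powr_le1) auto
  then have "h * t powr (1 / \<alpha>) \<le> h * 1" using h by (intro mult_left_mono) auto
  ultimately show "h * t powr (1 / \<alpha>) \<le> setdist (U \<inter> {x. p j x \<ge> l + t}) (U' \<inter> {x. p j x \<ge> l + t})"
    by simp
qed

text \<open>
  Next to a wall the density rises away from the wall; elsewhere it rises towards the centre.
\<close>

lemma axis_direction:
  "\<exists>\<tau>\<in>{-1, 1::real}. \<forall>u. 0 \<le> u \<and> u \<le> h / 2 \<longrightarrow>
     base t \<le> base (t + \<tau> * u) \<and> (\<forall>m\<le>M. dip m (t + \<tau> * u) \<le> dip m t)"
proof (cases "\<exists>m\<le>M. \<bar>t - wall m\<bar> \<le> 3 / 2 * h")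
  case True
  then obtain m where m: "m \<le> M" "\<bar>t - wall m\<bar> \<le> 3 / 2 * h" by blast
  define \<tau> :: real where "\<tau> = (if t \<ge> wall m then 1 else -1)"
  have "base t \<le> base (t + \<tau> * u) \<and> (\<forall>m'\<le>M. dip m' (t + \<tau> * u) \<le> dip m' t)"
    if u: "0 \<le> u \<and> u \<le> h / 2" for u
  proof (intro conjI allI impI)
    have v: "\<bar>t + \<tau> * u - wall m\<bar> \<le> 2 * h" "\<bar>t - wall m\<bar> \<le> \<bar>t + \<tau> * u - wall m\<bar>"
      using m u by (auto simp: \<tau>_def)
    then have "\<bar>t + \<tau> * u\<bar> \<le> R" using wall_bounds[OF m(1)] h by linarith
    then show "base t \<le> base (t + \<tau> * u)" using base_near base_range by auto
    show "dip m' (t + \<tau> * u) \<le> dip m' t" for m'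
    proof (cases "m' = m")
      case True
      then show ?thesis using v dip_mono by auto
    next
      case False
      then have "dip m' (t + \<tau> * u) = 0"
        using wall_separated[OF False] v h by (intro dip_far) linarith
      then show ?thesis using dip_range by auto
    qed
  qed
  moreover have "\<tau> \<in> {-1, 1}" by (simp add: \<tau>_def)
  ultimately show ?thesis by blast
next
  case False
  define \<tau> :: real where "\<tau> = (if t \<ge> 0 then -1 else 1)"
  have "base t \<le> base (t + \<tau> * u) \<and> (\<forall>m\<le>M. dip m (t + \<tau> * u) \<le> dip m t)"
    if u: "0 \<le> u \<and> u \<le> h / 2" for u
  proof (intro conjI allI impI)
    have "\<bar>t + \<tau> * u\<bar> \<le> \<bar>t\<bar> \<or> \<bar>t + \<tau> * u\<bar> \<le> R"
      using u h h_le_R by (auto simp: \<tau>_def)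
    then show "base t \<le> base (t + \<tau> * u)" using base_mono base_near base_range by auto
    fix m assume "m \<le> M"
    then have "\<bar>t - wall m\<bar> > 3 / 2 * h" using False by auto
    moreover have "\<bar>\<tau> * u\<bar> \<le> h / 2" using u by (simp add: \<tau>_def)
    ultimately have "dip m (t + \<tau> * u) = 0" by (intro dip_far) linarith
    then show "dip m (t + \<tau> * u) \<le> dip m t" using dip_range by auto
  qed
  moreover have "\<tau> \<in> {-1, 1}" by (simp add: \<tau>_def)
  ultimately show ?thesis by blast
qed

text \<open>
  The cube is directed towards the axis in the transversal coordinates; if it reaches beyond the
  axis, it does so within the flat part of \<open>base\<close> and of \<open>neck\<close>.
\<close>

lemma cond_C1_p:
  assumes j: "j \<le> M"
  shows "cond_C1 (h / 2) (1 / (real CARD('n) ^ CARD('n) * unit_ball_volume TYPE('n))) {x. p j x \<ge> l}"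
proof (rule cond_C1_corner_cubes)
  show "closed {x. p j x \<ge> l}" by (intro closed_Collect_le p_continuous continuous_intros)
  show "h / 2 > 0" using h by simp
  fix x assume x: "x \<in> {x. p j x \<ge> l}"
  obtain \<tau> where \<tau>: "\<tau> \<in> {-1, 1}" "\<And>u. 0 \<le> u \<Longrightarrow> u \<le> h / 2 \<Longrightarrow> base (x $ k) \<le> base (x $ k + \<tau> * u)"
    "\<And>u m. 0 \<le> u \<Longrightarrow> u \<le> h / 2 \<Longrightarrow> m \<le> M \<Longrightarrow> dip m (x $ k + \<tau> * u) \<le> dip m (x $ k)"
    using axis_direction[of "x $ k"] by metis
  define \<sigma> where "\<sigma> i = (if i = k then \<tau> else if x $ i \<ge> 0 then -1 else 1)" for i
  show "\<exists>\<sigma>. (\<forall>i. \<sigma> i \<in> {-1, 1}) \<and>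
      (\<forall>y. (\<forall>i. \<exists>u. 0 \<le> u \<and> u \<le> h / 2 \<and> y $ i = x $ i + \<sigma> i * u) \<longrightarrow> y \<in> {x. p j x \<ge> l})"
  proof (intro exI[of _ \<sigma>] conjI allI impI)
    show "\<sigma> i \<in> {-1, 1}" for i using \<tau>(1) by (auto simp: \<sigma>_def)
    fix y assume y: "\<forall>i. \<exists>u. 0 \<le> u \<and> u \<le> h / 2 \<and> y $ i = x $ i + \<sigma> i * u"
    have "p j x \<le> p j y"
    proof (rule p_mono[OF j])
      show "\<bar>y $ i\<bar> \<le> \<bar>x $ i\<bar> \<or> \<bar>y $ i\<bar> \<le> h / 2" if "i \<noteq> k" for i
      proof -
        obtain u where u: "0 \<le> u" "u \<le> h / 2" "y $ i = x $ i + \<sigma> i * u"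
          using y by blast
        have "\<sigma> i = (if x $ i \<ge> 0 then -1 else 1)" using that by (simp add: \<sigma>_def)
        then consider "y $ i = x $ i - u" "x $ i \<ge> 0" | "y $ i = x $ i + u" "x $ i < 0"
          using u(3) by (auto split: if_splits)
        then show ?thesis using u(1,2) by cases linarith+
      qed
      obtain u where u: "0 \<le> u" "u \<le> h / 2" "y $ k = x $ k + \<sigma> k * u" using y by blast
      then have yk: "y $ k = x $ k + \<tau> * u" by (simp add: \<sigma>_def)
      show "base (x $ k) \<le> base (y $ k)" unfolding yk by (rule \<tau>(2)[OF u(1,2)])
      show "dip m (y $ k) \<le> dip m (x $ k)" if "m \<le> M" for m
        unfolding yk by (rule \<tau>(3)[OF u(1,2) that])
    qed
    then show "y \<in> {x. p j x \<ge> l}" using x by simp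
  qed
qed

lemma cond_C_p:
  assumes j: "j \<le> M"
  shows "cond_C (p j)"
proof -
  have V: "unit_ball_volume TYPE('n) > 0" by (rule unit_ball_volume_pos)
  obtain C where C: "C > 0" "\<And>\<Omega> :: (real ^ 'n) set. (\<forall>x\<in>\<Omega>. \<forall>i. \<bar>x $ i\<bar> \<le> 2 * R) \<longrightarrow> cond_C2 (h / 2) C \<Omega>"
    using cond_C2_bounded[of "2 * R" "h / 2"] R h by auto
  let ?c = "1 / (real CARD('n) ^ CARD('n) * unit_ball_volume TYPE('n))"
  have "cond_C1 (h / 2) ?c {x. p j x \<ge> l + t} \<and> cond_C2 (h / 2) C {x. p j x \<ge> l + t}"
    if "split_level (p j) l \<and> 0 < t \<and> t \<le> 1" for l t
  proof
    have "l + t > 0" using that by (auto simp: split_level_def)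
    have "\<bar>x $ i\<bar> \<le> 2 * R" if "p j x \<ge> l + t" for x i
      using that \<open>l + t > 0\<close> by (intro p_support[of j]) auto
    then have "\<forall>x\<in>{x. p j x \<ge> l + t}. \<forall>i. \<bar>x $ i\<bar> \<le> 2 * R" by simp
    from C(2)[THEN mp, OF this] show "cond_C2 (h / 2) C {x. p j x \<ge> l + t}" .
    show "cond_C1 (h / 2) ?c {x. p j x \<ge> l + t}" by (rule cond_C1_p[OF j])
  qed
  moreover have "?c > 0" using V by (intro divide_pos_pos mult_pos_pos) auto
  moreover have "h / 2 > 0" using h by simp
  ultimately show ?thesis unfolding cond_C_def using C(1)
    by (intro exI[of _ "1::real"] exI[of _ "h / 2"] exI[of _ ?c] exI[of _ C] conjI) auto
qed

end

section \<open>Hoelder regularity of the walled plateau\<close>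

lemma deriv_seq_affine:
  assumes "deriv_seq N D" "c \<noteq> 0"
  shows "deriv_seq N (\<lambda>n t. D n ((t - a) / c) / c ^ n)"
  unfolding deriv_seq_def
proof (intro allI impI)
  fix n t assume "n < N"
  then have D: "(D n has_real_derivative D (Suc n) ((t - a) / c)) (at ((t - a) / c))"
    using assms by (auto simp: deriv_seq_def)
  have "((\<lambda>t. D n ((t - a) / c)) has_real_derivative D (Suc n) ((t - a) / c) * (1 / c)) (at t)"
    by (rule DERIV_chain2[where f = "D n" and g = "\<lambda>t. (t - a) / c" and x = t, OF D]) (use assms in \<open>auto intro!: derivative_eq_intros\<close>)
  from DERIV_cdivide[OF this, of "c ^ n"]
  show "((\<lambda>t. D n ((t - a) / c) / c ^ n) has_real_derivative D (Suc n) ((t - a) / c) / c ^ Suc n) (at t)"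
    by (simp add: mult.commute)
qed

lemma deriv_seq_sum:
  assumes "\<And>m. m \<in> S \<Longrightarrow> deriv_seq N (D m)"
  shows "deriv_seq N (\<lambda>n t. \<Sum>m\<in>S. D m n t)"
  using assms unfolding deriv_seq_def by (auto intro!: DERIV_sum)

text \<open>
  The density is a sum of three tensor products: the plateau at scale \<open>2 R\<close>, the walls and the
  passages at scale \<open>h\<close>. The bound does not grow with the number of walls, because at each point at
  most one of them contributes.
\<close>

lemma (in walled_plateau) p_hoelder_class:
  fixes \<alpha> A L :: real
  assumes \<alpha>: "\<alpha> > 0"
    and D: "D 0 = w" "deriv_seq (Suc (strict_floor \<alpha>)) D"
    and A: "A > 0" "\<And>n t. n \<le> Suc (strict_floor \<alpha>) \<Longrightarrow> \<bar>D n t\<bar> \<le> A"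
    and supp: "\<And>n t. n \<le> Suc (strict_floor \<alpha>) \<Longrightarrow> \<bar>t\<bar> > 1 \<Longrightarrow> D n t = 0"
    and L: "(real CARD('n) + 2) * A ^ CARD('n) * (lam * (2 * R) powr (- \<alpha>) + 2 * e * h powr (- \<alpha>)) \<le> L"
  shows "p j \<in> hoelder_class L \<alpha>"
proof -
  let ?N = "Suc (strict_floor \<alpha>)"
  define Db where "Db = (\<lambda>n t. D n ((t - 0) / (2 * R)) / (2 * R) ^ n)"
  define Dn where "Dn = (\<lambda>n t. D n ((t - 0) / h) / h ^ n)"
  define Dd where "Dd = (\<lambda>S n t. \<Sum>m\<in>S. D n ((t - wall m) / h) / h ^ n)"
  define T where "T = (\<lambda>a i. if a = (0::nat) then Db
    else if a = 1 then (if i = k then Dd {..M} else Db)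
    else (if i = k then Dd ({..M} - {j}) else Dn))"
  define c where "c = (\<lambda>a. if a = (0::nat) then lam else if a = 1 then - e else e)"
  define r where "r = (\<lambda>a. if a = (0::nat) then 2 * R else h)"
  have smooth: "deriv_seq ?N Db" "deriv_seq ?N Dn" "deriv_seq ?N (Dd S)" for S
    unfolding Db_def Dn_def Dd_def using D R h by (intro deriv_seq_affine deriv_seq_sum; simp)+
  have bdb: "\<bar>Db n t\<bar> \<le> A / (2 * R) ^ n" and bdn: "\<bar>Dn n t\<bar> \<le> A / h ^ n" if "n \<le> ?N" for n t
    unfolding Db_def Dn_def using A(2)[OF that] R h by (auto simp: abs_mult power_abs intro!: divide_right_mono)
  have bdb': "\<bar>Db n t\<bar> \<le> A / h ^ n" if "n \<le> ?N" for n t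
  proof -
    have "h ^ n \<le> (2 * R) ^ n" using h h_le_R by (intro power_mono) auto
    then have "A / (2 * R) ^ n \<le> A / h ^ n" using A h R by (intro divide_left_mono) auto
    then show ?thesis using bdb[OF that, of t] by linarith
  qed
  have bdd: "\<bar>Dd S n t\<bar> \<le> A / h ^ n" if n: "n \<le> ?N" and S: "S \<subseteq> {..M}" for S n t
  proof -
    have fin: "finite S" using S finite_subset by blast
    have far0: "D n ((t - wall m) / h) = 0" if "h < \<bar>t - wall m\<bar>" for m
      using that h by (intro supp[OF n]) (simp add: less_divide_eq)
    show ?thesis
    proof (cases "\<exists>m\<in>S. \<bar>t - wall m\<bar> \<le> h")
      case True
      then obtain m where m: "m \<in> S" "\<bar>t - wall m\<bar> \<le> h" by blast
      have "D n ((t - wall m') / h) / h ^ n = 0" if "m' \<in> S - {m}" for m'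
        using wall_separated[of m' m] that m(2) h far0[of m'] by auto
      then have "(\<Sum>m\<in>S - {m}. D n ((t - wall m) / h) / h ^ n) = 0" by (intro sum.neutral) auto
      then have "Dd S n t = D n ((t - wall m) / h) / h ^ n"
        unfolding Dd_def using sum.remove[OF fin m(1), of "\<lambda>m. D n ((t - wall m) / h) / h ^ n"] by simp
      then show ?thesis using A(2)[OF n] h by (auto simp: abs_mult intro!: divide_right_mono)
    next
      case False
      then have "Dd S n t = 0" unfolding Dd_def using far0 by (intro sum.neutral) auto
      then show ?thesis using A h by simp
    qed
  qed
  have "p j = tensor_sum c T {0, 1, 2} (\<lambda>_. 0)"
  proof
    fix x
    have prod_k: "(\<Prod>i\<in>UNIV. f i) = f k * (\<Prod>i\<in>- {k}. f i)" for f :: "'n \<Rightarrow> real"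
      using prod.remove[of UNIV k f] by (simp add: Compl_eq_Diff_UNIV)
    have "tensor (T 0) (\<lambda>_. 0) x = base (x $ k) * base_cross x"
      "tensor (T 1) (\<lambda>_. 0) x = dips {..M} (x $ k) * base_cross x"
      "tensor (T 2) (\<lambda>_. 0) x = dips ({..M} - {j}) (x $ k) * neck x"
      unfolding tensor_def prod_k base_cross_def neck_def
      by (auto simp: T_def Db_def Dn_def Dd_def D(1) base_def dips_def dip_def intro!: prod.cong)
    then show "p j x = tensor_sum c T {0, 1, 2} (\<lambda>_. 0) x"
      by (simp add: tensor_sum_def c_def p_def algebra_simps)
  qed
  also have "\<dots> \<in> hoelder_class L \<alpha>"
  proof (rule tensor_sum_hoelder_class[OF \<alpha> A(1)])
    show "r a > 0" if "a \<in> {0, 1, 2}" for a using R h by (simp add: r_def)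
    show "deriv_seq ?N (T a i)" if "a \<in> {0, 1, 2}" for a i using smooth by (simp add: T_def)
    show "\<bar>T a i n t\<bar> \<le> A / r a ^ n" if "a \<in> {0, 1, 2}" "n \<le> ?N" for a i n t
      using bdb bdb' bdn bdd that(2) by (auto simp: T_def r_def)
    have "(\<Sum>a\<in>{0, 1, 2}. \<bar>c a\<bar> * ((real CARD('n) + 2) * A ^ CARD('n) * r a powr (- \<alpha>)))
        = (real CARD('n) + 2) * A ^ CARD('n) * (lam * (2 * R) powr (- \<alpha>) + 2 * e * h powr (- \<alpha>))"
      using e lam by (simp add: c_def r_def algebra_simps)
    then show "(\<Sum>a\<in>{0, 1, 2}. \<bar>c a\<bar> * ((real CARD('n) + 2) * A ^ CARD('n) * r a powr (- \<alpha>))) \<le> L"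
      using L by simp
  qed
  finally show ?thesis .
qed

section \<open>Samples from nearby densities\<close>

lemma prob_density_prob_space:
  assumes "prob_density p" shows "prob_space (density lborel (\<lambda>x. ennreal (p x)))"
proof (rule prob_spaceI)
  have "(\<lambda>x. ennreal (p x)) \<in> borel_measurable lborel" using assms by (simp add: prob_density_def)
  then show "emeasure (density lborel (\<lambda>x. ennreal (p x))) (space (density lborel (\<lambda>x. ennreal (p x)))) = 1"
    using assms by (simp add: emeasure_density prob_density_def)
qed

lemma prob_space_sample_law: "prob_density p \<Longrightarrow> prob_space (sample_law n p)"
  unfolding sample_law_def by (intro prob_space_PiM prob_density_prob_space)

lemma sets_sample_law: "sets (sample_law n p) = sets (Pi\<^sub>M {..<n} (\<lambda>_. borel))"
  unfolding sample_law_def by (intro sets_PiM_cong) auto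

lemma sets_sample_law_eq: "sets (sample_law n p) = sets (sample_law n q)"
  by (simp add: sets_sample_law)

lemma space_sample_law: "space (sample_law n p) = {..<n} \<rightarrow>\<^sub>E UNIV"
  unfolding sample_law_def by (simp add: space_PiM)

text \<open>
  The likelihood ratio of the samples is the product of the likelihood ratios of the observations;
  it suffices to compare the two laws on boxes.
\<close>

lemma sample_law_density:
  fixes p q :: "real ^ 'n::finite \<Rightarrow> real"
  assumes p: "prob_density p" and q: "prob_density q" and ac: "\<And>x. q x = 0 \<Longrightarrow> p x = 0"
  shows "sample_law n p = density (sample_law n q) (\<lambda>X. \<Prod>i<n. ennreal (p (X i) / q (X i)))"
proof -
  let ?P = "\<lambda>_::nat. density lborel (\<lambda>x. ennreal (p x))"
  let ?Q = "\<lambda>_::nat. density lborel (\<lambda>x. ennreal (q x))"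
  let ?r = "\<lambda>x. ennreal (p x / q x)"
  have [measurable]: "p \<in> borel_measurable borel" "q \<in> borel_measurable borel"
    using p q by (auto simp: prob_density_def)
  interpret P: product_sigma_finite ?P
    by (intro product_sigma_finite.intro prob_space_imp_sigma_finite prob_density_prob_space p)
  interpret Q: product_sigma_finite ?Q
    by (intro product_sigma_finite.intro prob_space_imp_sigma_finite prob_density_prob_space q)
  have meas: "(\<lambda>X. \<Prod>i<n. ?r (X i)) \<in> borel_measurable (Pi\<^sub>M {..<n} ?Q)"
    by measurable
  have "density (Pi\<^sub>M {..<n} ?Q) (\<lambda>X. \<Prod>i<n. ?r (X i)) = Pi\<^sub>M {..<n} ?P"
  proof (rule P.PiM_eqI)
    show "sets (density (Pi\<^sub>M {..<n} ?Q) (\<lambda>X. \<Prod>i<n. ?r (X i))) = sets (Pi\<^sub>M {..<n} ?P)"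
      by (simp, intro sets_PiM_cong) auto
    fix A :: "nat \<Rightarrow> (real ^ 'n) set"
    assume "\<And>i. i \<in> {..<n} \<Longrightarrow> A i \<in> sets (?P i)"
    then have A: "A i \<in> sets borel" if "i < n" for i using that by auto
    have AE: "Pi\<^sub>E {..<n} A \<in> sets (Pi\<^sub>M {..<n} ?Q)" using A by (intro sets_PiM_I_finite) auto
    have "emeasure (density (Pi\<^sub>M {..<n} ?Q) (\<lambda>X. \<Prod>i<n. ?r (X i))) (Pi\<^sub>E {..<n} A)
        = (\<integral>\<^sup>+X. (\<Prod>i<n. ?r (X i)) * indicator (Pi\<^sub>E {..<n} A) X \<partial>Pi\<^sub>M {..<n} ?Q)"
      by (intro emeasure_density meas AE)
    also have "\<dots> = (\<integral>\<^sup>+X. (\<Prod>i<n. ?r (X i) * indicator (A i) (X i)) \<partial>Pi\<^sub>M {..<n} ?Q)"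
    proof (intro nn_integral_cong)
      fix X assume "X \<in> space (Pi\<^sub>M {..<n} ?Q)"
      then have "indicator (Pi\<^sub>E {..<n} A) X = (\<Prod>i<n. indicator (A i) (X i) :: ennreal)"
        by (auto simp: space_PiM indicator_def PiE_def Pi_def)
      then show "(\<Prod>i<n. ?r (X i)) * indicator (Pi\<^sub>E {..<n} A) X = (\<Prod>i<n. ?r (X i) * indicator (A i) (X i))"
        by (simp add: prod.distrib)
    qed
    also have "\<dots> = (\<Prod>i<n. \<integral>\<^sup>+x. ?r x * indicator (A i) x \<partial>?Q i)"
    proof (intro Q.product_nn_integral_prod)
      show "(\<lambda>x. ?r x * indicator (A i) x) \<in> borel_measurable (?Q i)" if "i \<in> {..<n}" for i
        using A[of i] that by auto
    qed simp
    also have "\<dots> = (\<Prod>i<n. emeasure (?P i) (A i))"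
    proof (intro prod.cong refl)
      fix i assume "i \<in> {..<n}"
      then have [measurable]: "A i \<in> sets borel" using A by auto
      have "(\<integral>\<^sup>+x. ?r x * indicator (A i) x \<partial>?Q i) = (\<integral>\<^sup>+x. ennreal (q x) * (?r x * indicator (A i) x) \<partial>lborel)"
        by (intro nn_integral_density) auto
      also have "\<dots> = (\<integral>\<^sup>+x. ennreal (p x) * indicator (A i) x \<partial>lborel)"
      proof (intro nn_integral_cong)
        fix x
        have "ennreal (q x) * ?r x = ennreal (p x)"
          using ac[of x] p q by (cases "q x = 0") (auto simp: prob_density_def ennreal_mult'[symmetric])
        then show "ennreal (q x) * (?r x * indicator (A i) x) = ennreal (p x) * indicator (A i) x"
          by (simp add: mult.assoc[symmetric])
      qed
      also have "\<dots> = emeasure (?P i) (A i)" by (intro emeasure_density[symmetric]) auto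
      finally show "(\<integral>\<^sup>+x. ?r x * indicator (A i) x \<partial>?Q i) = emeasure (?P i) (A i)" .
    qed
    finally show "emeasure (density (Pi\<^sub>M {..<n} ?Q) (\<lambda>X. \<Prod>i<n. ?r (X i))) (Pi\<^sub>E {..<n} A)
        = (\<Prod>i<n. emeasure (?P i) (A i))" .
  qed simp
  then show ?thesis unfolding sample_law_def by simp
qed

text \<open>
  Pointwise \<open>p\<^sup>2 / q = 2 p - q + (p - q)\<^sup>2 / q\<close>, and \<open>p\<close> and \<open>q\<close> have the same total mass. The assumed
  bound also covers points with \<open>q x = 0\<close>: it makes \<open>p x\<close> vanish there.
\<close>

lemma second_moment_bound:
  fixes p q :: "real ^ 'n::finite \<Rightarrow> real"
  assumes p: "prob_density p" and q: "prob_density q" and cv: "0 \<le> c" "0 \<le> v"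
    and G: "G \<in> sets borel" "emeasure lborel G \<le> ennreal v"
    and near: "\<And>x. (p x - q x)\<^sup>2 \<le> c * q x * indicator G x"
  shows "(\<integral>\<^sup>+x. ennreal ((p x)\<^sup>2 / q x) \<partial>lborel) \<le> ennreal (1 + c * v)"
proof -
  have [measurable]: "p \<in> borel_measurable borel" "q \<in> borel_measurable borel" "G \<in> sets borel"
    using p q G by (auto simp: prob_density_def)
  have nn: "0 \<le> p x" "0 \<le> q x" for x using p q by (auto simp: prob_density_def)
  have pt: "(p x)\<^sup>2 / q x + q x \<le> 2 * p x + c * indicator G x" for x
  proof (cases "q x = 0")
    case True
    then show ?thesis using nn cv by simp
  next
    case False
    then have "q x > 0" using nn[of x] by simp
    moreover have "(p x)\<^sup>2 + q x * q x \<le> (2 * p x + c * indicator G x) * q x"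
      using near[of x] by (simp add: power2_diff algebra_simps power2_eq_square)
    ultimately show ?thesis by (simp add: field_simps power2_eq_square)
  qed
  have "(\<integral>\<^sup>+x. ennreal ((p x)\<^sup>2 / q x) \<partial>lborel) + 1
      = (\<integral>\<^sup>+x. ennreal ((p x)\<^sup>2 / q x) + ennreal (q x) \<partial>lborel)"
    using q by (subst nn_integral_add) (auto simp: prob_density_def)
  also have "\<dots> \<le> (\<integral>\<^sup>+x. ennreal 2 * ennreal (p x) + ennreal c * indicator G x \<partial>lborel)"
  proof (intro nn_integral_mono)
    fix x
    have "ennreal ((p x)\<^sup>2 / q x) + ennreal (q x) = ennreal ((p x)\<^sup>2 / q x + q x)"
      using nn by (intro ennreal_plus[symmetric]) auto
    also have "\<dots> \<le> ennreal (2 * p x + c * indicator G x)" by (intro ennreal_leI pt)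
    also have "\<dots> = ennreal (2 * p x) + ennreal (c * indicator G x)"
      using nn cv by (intro ennreal_plus) auto
    also have "\<dots> = ennreal 2 * ennreal (p x) + ennreal c * indicator G x"
      using nn cv by (simp add: ennreal_mult' ennreal_indicator)
    finally show "ennreal ((p x)\<^sup>2 / q x) + ennreal (q x) \<le> ennreal 2 * ennreal (p x) + ennreal c * indicator G x" .
  qed
  also have "\<dots> = ennreal 2 * (\<integral>\<^sup>+x. ennreal (p x) \<partial>lborel) + ennreal c * emeasure lborel G"
    by (subst nn_integral_add) (auto simp: nn_integral_cmult nn_integral_cmult_indicator)
  also have "\<dots> \<le> ennreal 2 * 1 + ennreal c * ennreal v"
    using p G by (intro add_mono mult_left_mono) (auto simp: prob_density_def)
  also have "\<dots> = ennreal (1 + c * v) + 1"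
  proof -
    have "ennreal c * ennreal v = ennreal (c * v)" using cv by (intro ennreal_mult[symmetric])
    moreover have "ennreal 2 + ennreal (c * v) = ennreal (2 + c * v)"
      using cv by (intro ennreal_plus[symmetric]) auto
    moreover have "ennreal (1 + c * v) + ennreal 1 = ennreal ((1 + c * v) + 1)"
      using cv by (intro ennreal_plus[symmetric]) auto
    moreover have "(1 + c * v) + 1 = 2 + c * v" by simp
    ultimately show ?thesis by (simp only: ennreal_1 mult_1_right)
  qed
  finally have "(\<integral>\<^sup>+x. ennreal ((p x)\<^sup>2 / q x) \<partial>lborel) + 1 \<le> ennreal (1 + c * v) + 1" .
  then show ?thesis
    unfolding add.commute[of _ "1 :: ennreal"] ennreal_add_left_cancel_le by simp
qed

text \<open>
  The Cauchy-Schwarz inequality for the likelihood ratio and the indicator of \<open>E\<close>; the second moment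
  of the likelihood ratio of the sample is the \<open>n\<close>-th power of that of one observation.
\<close>

lemma sample_law_change_of_density:
  fixes p q :: "real ^ 'n::finite \<Rightarrow> real"
  assumes p: "prob_density p" and q: "prob_density q" and cv: "0 \<le> c" "0 \<le> v"
    and G: "G \<in> sets borel" "emeasure lborel G \<le> ennreal v"
    and near: "\<And>x. (p x - q x)\<^sup>2 \<le> c * q x * indicator G x"
    and E: "E \<in> sets (sample_law n q)"
  shows "(measure (sample_law n p) E)\<^sup>2 \<le> exp (real n * (c * v)) * measure (sample_law n q) E"
proof -
  let ?r = "\<lambda>x. ennreal (p x / q x)"
  let ?Q = "\<lambda>_::nat. density lborel (\<lambda>x. ennreal (q x))"
  let ?g = "\<lambda>X. \<Prod>i<n. ?r (X i)"
  have [measurable]: "p \<in> borel_measurable borel" "q \<in> borel_measurable borel"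
    using p q by (auto simp: prob_density_def)
  have nn: "0 \<le> p x" "0 \<le> q x" for x using p q by (auto simp: prob_density_def)
  have ac: "p x = 0" if "q x = 0" for x using near[of x] that by simp
  interpret Q: product_sigma_finite ?Q
    by (intro product_sigma_finite.intro prob_space_imp_sigma_finite prob_density_prob_space q)
  interpret SP: prob_space "sample_law n p" by (rule prob_space_sample_law[OF p])
  interpret SQ: prob_space "sample_law n q" by (rule prob_space_sample_law[OF q])
  have meas: "?g \<in> borel_measurable (sample_law n q)" unfolding sample_law_def by measurable
  have ind: "indicator E \<in> borel_measurable (sample_law n q)" using E by (intro borel_measurable_indicator)
  have dens: "sample_law n p = density (sample_law n q) ?g"
    using ac by (rule sample_law_density[OF p q])
  have "emeasure (sample_law n p) E = (\<integral>\<^sup>+X. ?g X * indicator E X \<partial>sample_law n q)"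
    by (subst dens) (intro emeasure_density meas E)
  then have "(emeasure (sample_law n p) E)\<^sup>2 \<le>
      (\<integral>\<^sup>+X. (?g X)\<^sup>2 \<partial>sample_law n q) * (\<integral>\<^sup>+X. (indicator E X)\<^sup>2 \<partial>sample_law n q)"
    using Cauchy_Schwarz_nn_integral[OF meas ind] by simp
  also have "(\<integral>\<^sup>+X. (indicator E X)\<^sup>2 \<partial>sample_law n q) = emeasure (sample_law n q) E"
    using E by (simp add: power2_eq_square indicator_inter_arith[symmetric])
  also have "(\<integral>\<^sup>+X. (?g X)\<^sup>2 \<partial>sample_law n q) = (\<integral>\<^sup>+X. (\<Prod>i<n. (?r (X i))\<^sup>2) \<partial>Pi\<^sub>M {..<n} ?Q)"
    unfolding sample_law_def by (simp add: prod_power_distrib)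
  also have "\<dots> = (\<Prod>i<n. \<integral>\<^sup>+x. (?r x)\<^sup>2 \<partial>?Q i)"
    by (intro Q.product_nn_integral_prod) auto
  also have "(\<integral>\<^sup>+x. (?r x)\<^sup>2 \<partial>?Q i) = (\<integral>\<^sup>+x. ennreal ((p x)\<^sup>2 / q x) \<partial>lborel)" for i :: nat
  proof -
    have "(\<integral>\<^sup>+x. (?r x)\<^sup>2 \<partial>?Q i) = (\<integral>\<^sup>+x. ennreal (q x) * (?r x)\<^sup>2 \<partial>lborel)"
      by (intro nn_integral_density) auto
    also have "\<dots> = (\<integral>\<^sup>+x. ennreal ((p x)\<^sup>2 / q x) \<partial>lborel)"
    proof (intro nn_integral_cong)
      fix x
      have "ennreal (q x) * (?r x)\<^sup>2 = ennreal (q x * (p x / q x)\<^sup>2)"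
        using nn[of x] by (simp add: ennreal_mult' ennreal_power)
      also have "q x * (p x / q x)\<^sup>2 = (p x)\<^sup>2 / q x" by (simp add: power2_eq_square)
      finally show "ennreal (q x) * (?r x)\<^sup>2 = ennreal ((p x)\<^sup>2 / q x)" .
    qed
    finally show ?thesis .
  qed
  also have "(\<Prod>i<n. \<integral>\<^sup>+x. ennreal ((p x)\<^sup>2 / q x) \<partial>lborel) \<le> ennreal ((1 + c * v) ^ n)"
  proof -
    have I: "(\<integral>\<^sup>+x. ennreal ((p x)\<^sup>2 / q x) \<partial>lborel) \<le> ennreal (1 + c * v)"
      by (rule second_moment_bound[OF p q cv G near])
    then obtain y where y: "0 \<le> y" "(\<integral>\<^sup>+x. ennreal ((p x)\<^sup>2 / q x) \<partial>lborel) = ennreal y"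
      by (cases "\<integral>\<^sup>+x. ennreal ((p x)\<^sup>2 / q x) \<partial>lborel") (auto simp: top_unique)
    have "0 \<le> 1 + c * v" using cv by simp
    with I have "y \<le> 1 + c * v" unfolding y(2) using y(1) by (subst (asm) ennreal_le_iff)
    then show ?thesis unfolding y(2) using y(1) by (simp add: ennreal_power power_mono)
  qed
  finally have "(emeasure (sample_law n p) E)\<^sup>2 \<le> ennreal ((1 + c * v) ^ n) * emeasure (sample_law n q) E"
    by (simp add: mult_right_mono)
  then have "ennreal ((measure (sample_law n p) E)\<^sup>2) \<le> ennreal ((1 + c * v) ^ n * measure (sample_law n q) E)"
    using cv by (simp add: SP.emeasure_eq_measure SQ.emeasure_eq_measure ennreal_power ennreal_mult')
  then have "(measure (sample_law n p) E)\<^sup>2 \<le> (1 + c * v) ^ n * measure (sample_law n q) E"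
    using cv by (subst (asm) ennreal_le_iff) auto
  also have "(1 + c * v) ^ n \<le> exp (c * v) ^ n"
    using cv by (intro power_mono) (auto simp: add.commute exp_ge_add_one_self)
  then have "(1 + c * v) ^ n * measure (sample_law n q) E \<le> exp (real n * (c * v)) * measure (sample_law n q) E"
    by (intro mult_right_mono) (auto simp: exp_of_nat_mult)
  finally show ?thesis .
qed

lemma sample_misses_region:
  fixes p :: "real ^ 'n::finite \<Rightarrow> real"
  assumes p: "prob_density p" and S: "S \<in> sets borel"
    and \<mu>: "\<mu> \<le> measure (density lborel (\<lambda>x. ennreal (p x))) S"
  shows "{X \<in> space (sample_law n p). \<forall>i<n. X i \<notin> S} \<in> sets (sample_law n p)"
    "measure (sample_law n p) {X \<in> space (sample_law n p). \<forall>i<n. X i \<notin> S} \<le> exp (- (real n * \<mu>))"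
proof -
  let ?P = "\<lambda>_::nat. density lborel (\<lambda>x. ennreal (p x))"
  interpret P: prob_space "?P 0" by (rule prob_density_prob_space[OF p])
  interpret PP: product_sigma_finite ?P
    by (intro product_sigma_finite.intro prob_space_imp_sigma_finite prob_density_prob_space p)
  have eq: "{X \<in> space (sample_law n p). \<forall>i<n. X i \<notin> S} = Pi\<^sub>E {..<n} (\<lambda>_. - S)"
    by (auto simp: space_sample_law PiE_def Pi_def)
  have mS: "- S \<in> sets (?P i)" for i using S borel_comp by simp
  show "{X \<in> space (sample_law n p). \<forall>i<n. X i \<notin> S} \<in> sets (sample_law n p)"
    unfolding eq unfolding sample_law_def using mS by (intro sets_PiM_I_finite) auto
  have "emeasure (sample_law n p) (Pi\<^sub>E {..<n} (\<lambda>_. - S)) = (\<Prod>i<n. emeasure (?P i) (- S))"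
    unfolding sample_law_def using mS by (intro PP.emeasure_PiM) auto
  also have "\<dots> = ennreal (measure (?P 0) (- S) ^ n)"
    by (simp add: P.emeasure_eq_measure ennreal_power)
  finally have "measure (sample_law n p) (Pi\<^sub>E {..<n} (\<lambda>_. - S)) = measure (?P 0) (- S) ^ n"
    by (simp add: measure_def)
  also have "measure (?P 0) (- S) = 1 - measure (?P 0) S"
    using P.prob_compl[of S] S by (simp add: Compl_eq_Diff_UNIV)
  also have "(1 - measure (?P 0) S) ^ n \<le> exp (- \<mu>) ^ n"
  proof (intro power_mono)
    show "1 - measure (?P 0) S \<le> exp (- \<mu>)" using exp_ge_add_one_self[of "- \<mu>"] \<mu> by linarith
  qed simp
  also have "\<dots> = exp (- (real n * \<mu>))" by (simp add: exp_of_nat_mult[symmetric])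
  finally show "measure (sample_law n p) {X \<in> space (sample_law n p). \<forall>i<n. X i \<notin> S} \<le> exp (- (real n * \<mu>))"
    unfolding eq .
qed

section \<open>Normalisation of the walled plateau\<close>

lemma coordinate_box:
  fixes l u :: "'n::finite \<Rightarrow> real"
  assumes "\<And>i. l i \<le> u i"
  shows "{x :: real ^ 'n. \<forall>i. l i \<le> x $ i \<and> x $ i \<le> u i} \<in> sets borel"
    "emeasure lborel {x :: real ^ 'n. \<forall>i. l i \<le> x $ i \<and> x $ i \<le> u i} = ennreal (\<Prod>i\<in>UNIV. u i - l i)"
proof -
  have eq: "{x :: real ^ 'n. \<forall>i. l i \<le> x $ i \<and> x $ i \<le> u i} = cbox (\<chi> i. l i) (\<chi> i. u i)"
    by (auto simp: mem_box_cart)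
  show "{x :: real ^ 'n. \<forall>i. l i \<le> x $ i \<and> x $ i \<le> u i} \<in> sets borel" unfolding eq by simp
  have "cbox (\<chi> i. l i) (\<chi> i. u i) \<noteq> {}" using assms by (simp add: interval_ne_empty_cart)
  from content_cbox_cart[OF this]
  have "measure lborel (cbox (\<chi> i. l i) (\<chi> i. u i)) = (\<Prod>i\<in>UNIV. u i - l i)" by simp
  then show "emeasure lborel {x :: real ^ 'n. \<forall>i. l i \<le> x $ i \<and> x $ i \<le> u i} = ennreal (\<Prod>i\<in>UNIV. u i - l i)"
    unfolding eq by (subst emeasure_eq_measure2) (auto intro: fmeasurable_cbox)
qed

lemma coordinate_cube:
  assumes "c \<ge> 0"
  shows "{x :: real ^ 'n::finite. \<forall>i. \<bar>x $ i\<bar> \<le> c} \<in> sets borel"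
    "emeasure lborel {x :: real ^ 'n. \<forall>i. \<bar>x $ i\<bar> \<le> c} = ennreal ((2 * c) ^ CARD('n))"
proof -
  have eq: "{x :: real ^ 'n::finite. \<forall>i. \<bar>x $ i\<bar> \<le> c} = {x. \<forall>i. - c \<le> x $ i \<and> x $ i \<le> c}"
  proof -
    have "\<bar>t\<bar> \<le> c \<longleftrightarrow> - c \<le> t \<and> t \<le> c" for t :: real by linarith
    then show ?thesis by simp
  qed
  show "{x :: real ^ 'n::finite. \<forall>i. \<bar>x $ i\<bar> \<le> c} \<in> sets borel"
    unfolding eq by (rule coordinate_box) (use assms in simp)
  have "emeasure lborel {x :: real ^ 'n. \<forall>i. \<bar>x $ i\<bar> \<le> c} = ennreal (\<Prod>i\<in>(UNIV :: 'n set). c - (- c))"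
    unfolding eq by (rule coordinate_box) (use assms in simp)
  then show "emeasure lborel {x :: real ^ 'n. \<forall>i. \<bar>x $ i\<bar> \<le> c} = ennreal ((2 * c) ^ CARD('n))" by simp
qed

lemma integrable_continuous_bounded_support:
  fixes f :: "real ^ 'n::finite \<Rightarrow> real"
  assumes "continuous_on UNIV f" and supp: "\<And>x i. f x \<noteq> 0 \<Longrightarrow> \<bar>x $ i\<bar> \<le> c"
  shows "integrable lborel f"
proof -
  let ?S = "cbox (\<chi> i. - c) (\<chi> i. c) :: (real ^ 'n) set"
  have "integrable lborel (\<lambda>x. indicator ?S x *\<^sub>R f x)"
    using assms(1) by (intro borel_integrable_compact compact_cbox) (auto intro: continuous_on_subset)
  moreover have "indicator ?S x *\<^sub>R f x = f x" for x
  proof (cases "f x = 0")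
    case False
    have "- c \<le> x $ i \<and> x $ i \<le> c" for i using supp[OF False, of i] by linarith
    then have "x \<in> ?S" by (simp add: mem_box_cart)
    then show ?thesis by simp
  qed simp
  ultimately show ?thesis by (simp only:)
qed

lemma integral_cube:
  assumes "c \<ge> 0"
  shows "integrable lborel (indicator {x :: real ^ 'n::finite. \<forall>i. \<bar>x $ i\<bar> \<le> c} :: _ \<Rightarrow> real)"
    "(\<integral>x. indicator {x :: real ^ 'n. \<forall>i. \<bar>x $ i\<bar> \<le> c} x \<partial>lborel) = (2 * c) ^ CARD('n)"
  using coordinate_cube[OF assms, where 'n = 'n] assms
  by (auto simp: measure_def)

lemma integral_lborel_translate:
  fixes f :: "'a::euclidean_space \<Rightarrow> real"
  assumes "f \<in> borel_measurable borel"
  shows "(\<integral>x. f (x - a) \<partial>lborel) = (\<integral>x. f x \<partial>lborel)"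
proof -
  have "(\<integral>x. f x \<partial>lborel) = (\<integral>x. f x \<partial>distr lborel borel ((+) (- a)))"
    by (simp add: lborel_distr_plus)
  also have "\<dots> = (\<integral>x. f (- a + x) \<partial>lborel)" using assms by (intro integral_distr) auto
  finally show ?thesis by simp
qed

context walled_plateau
begin

text \<open>
  \<open>bulk\<close> is the plateau of height 1 without walls, \<open>dent j\<close> the part that is cut out of it when the
  wall \<open>j\<close> is closed, and \<open>hump m\<close> the filling of the passage through the wall \<open>m\<close>.
\<close>

definition bulk :: "real ^ 'n \<Rightarrow> real"
  where "bulk x = base_cross x * base (x $ k)"

definition dent :: "nat \<Rightarrow> real ^ 'n \<Rightarrow> real"
  where "dent j x = dips {..M} (x $ k) * base_cross x - dips ({..M} - {j}) (x $ k) * neck x"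

definition hump :: "nat \<Rightarrow> real ^ 'n \<Rightarrow> real"
  where "hump m x = dip m (x $ k) * neck x"

lemma p_bulk_dent: "p j x = lam * bulk x - e * dent j x"
  by (simp add: p_def bulk_def dent_def algebra_simps)

lemma dent_hump: "dent j x = dips {..M} (x $ k) * base_cross x - (\<Sum>m\<in>{..M} - {j}. hump m x)"
  by (simp add: dent_def hump_def dips_def[of "{..M} - {j}"] sum_distrib_right)

lemma continuous_w: "continuous_on UNIV f \<Longrightarrow> continuous_on UNIV (\<lambda>x. w (f x))" for f :: "real ^ 'n \<Rightarrow> real"
  using continuous_on_compose2[OF w_cont] by auto

lemma bulk_continuous: "continuous_on UNIV bulk"
  unfolding bulk_def base_cross_def base_def using R by (intro continuous_intros continuous_w) auto

lemma hump_continuous: "continuous_on UNIV (hump m)"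
  unfolding hump_def neck_def dip_def using h by (intro continuous_intros continuous_w) auto

lemma walls_continuous: "continuous_on UNIV (\<lambda>x. dips {..M} (x $ k) * base_cross x)"
  unfolding dips_def dip_def base_cross_def base_def
  using h R by (intro continuous_intros continuous_w) auto

lemma bulk_range: "0 \<le> bulk x" "bulk x \<le> 1"
  unfolding bulk_def using base_cross_range base_range by (auto intro: mult_le_one)

lemma bulk_support:
  assumes "bulk x \<noteq> 0" shows "\<bar>x $ i\<bar> \<le> 2 * R"
proof (rule ccontr)
  assume "\<not> ?thesis"
  then have b0: "base (x $ i) = 0" by (intro base_far) auto
  have "bulk x = 0"
  proof (cases "i = k")
    case False
    then have "base_cross x = 0" unfolding base_cross_def using b0 by (intro prod_zero) auto
    then show ?thesis by (simp add: bulk_def)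
  qed (use b0 in \<open>simp add: bulk_def\<close>)
  then show False using assms by simp
qed

lemma bulk_plateau: "(\<And>i. \<bar>x $ i\<bar> \<le> R) \<Longrightarrow> bulk x = 1"
  unfolding bulk_def base_cross_def by (simp add: base_near)

lemma walls_le_bulk: "dips {..M} (x $ k) * base_cross x \<le> bulk x"
  unfolding bulk_def using dips_le_base[of "{..M}" "x $ k"] base_cross_range[of x]
  by (simp add: mult.commute mult_left_mono)

lemma dent_nonneg: "0 \<le> dent j x"
proof -
  have "dips ({..M} - {j}) (x $ k) \<le> dips {..M} (x $ k)"
    unfolding dips_def by (intro sum_mono2 dip_range) auto
  then have "dips ({..M} - {j}) (x $ k) * neck x \<le> dips {..M} (x $ k) * base_cross x"
    using neck_le_base_cross neck_nonneg dips_nonneg by (intro mult_mono) auto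
  then show ?thesis by (simp add: dent_def)
qed

lemma dent_le_bulk: "dent j x \<le> bulk x"
proof -
  have "0 \<le> dips ({..M} - {j}) (x $ k) * neck x" using dips_nonneg neck_nonneg by simp
  then show ?thesis using walls_le_bulk[of x] unfolding dent_def by linarith
qed

lemma hump_support:
  assumes "m \<le> M" "hump m x \<noteq> 0" shows "\<bar>x $ i\<bar> \<le> 2 * R"
proof -
  have "dip m (x $ k) \<noteq> 0" "neck x \<noteq> 0" using assms by (auto simp: hump_def)
  then have "base (x $ k) = 1" "base_cross x \<noteq> 0"
    using dip_imp_base[OF assms(1)] neck_le_base_cross[of x] neck_nonneg[of x] by auto
  then show ?thesis by (intro bulk_support) (simp add: bulk_def)
qed

lemma bulk_integrable: "integrable lborel bulk"
  by (rule integrable_continuous_bounded_support[OF bulk_continuous bulk_support])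

lemma walls_integrable: "integrable lborel (\<lambda>x. dips {..M} (x $ k) * base_cross x)"
proof (rule integrable_continuous_bounded_support[OF walls_continuous])
  fix x i assume "dips {..M} (x $ k) * base_cross x \<noteq> 0"
  then have "0 < dips {..M} (x $ k) * base_cross x"
    using dips_nonneg[of "{..M}" "x $ k"] base_cross_range[of x]
    by (metis less_eq_real_def mult_nonneg_nonneg)
  then show "\<bar>x $ i\<bar> \<le> 2 * R" using walls_le_bulk[of x] by (intro bulk_support) simp
qed

lemma hump_integrable: "m \<le> M \<Longrightarrow> integrable lborel (hump m)"
  by (rule integrable_continuous_bounded_support[OF hump_continuous hump_support])

lemma dent_integrable: "integrable lborel (dent j)"
proof -
  have "integrable lborel (\<lambda>x. dips {..M} (x $ k) * base_cross x - (\<Sum>m\<in>{..M} - {j}. hump m x))"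
    by (intro Bochner_Integration.integrable_diff walls_integrable Bochner_Integration.integrable_sum
        hump_integrable) auto
  then show ?thesis by (simp add: dent_hump[abs_def])
qed

text \<open>
  The passages through the walls are translates of one another, so closing one of them costs the
  same mass whichever it is.
\<close>

lemma integral_hump: "(\<integral>x. hump m x \<partial>lborel) = (\<integral>x. w (x $ k / h) * neck x \<partial>lborel)"
proof -
  let ?f = "\<lambda>x :: real ^ 'n. w (x $ k / h) * neck x"
  have "continuous_on UNIV ?f"
    unfolding neck_def using h by (intro continuous_intros continuous_w) auto
  then have m: "?f \<in> borel_measurable borel" by (rule borel_measurable_continuous_onI)
  have "neck (x - axis k (wall m)) = neck x" for x
    unfolding neck_def by (intro prod.cong) (auto simp: axis_def)
  then have "hump m = (\<lambda>x. ?f (x - axis k (wall m)))"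
    by (simp add: hump_def dip_def fun_eq_iff)
  then show ?thesis using integral_lborel_translate[OF m, of "axis k (wall m)"] by simp
qed

lemma integral_dent:
  assumes "j \<le> M"
  shows "(\<integral>x. dent j x \<partial>lborel) = (\<integral>x. dent 0 x \<partial>lborel)"
proof -
  have "(\<integral>x. dent i x \<partial>lborel) = (\<integral>x. dips {..M} (x $ k) * base_cross x \<partial>lborel)
      - real M * (\<integral>x. w (x $ k / h) * neck x \<partial>lborel)" if "i \<le> M" for i
  proof -
    have "(\<integral>x. dent i x \<partial>lborel) = (\<integral>x. dips {..M} (x $ k) * base_cross x \<partial>lborel)
        - (\<Sum>m\<in>{..M} - {i}. \<integral>x. hump m x \<partial>lborel)"
      unfolding dent_hump
      by (subst Bochner_Integration.integral_diff, rule walls_integrable)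
         (auto intro!: hump_integrable Bochner_Integration.integrable_sum Bochner_Integration.integral_sum)
    then show ?thesis using that by (simp add: integral_hump)
  qed
  then show ?thesis using assms by simp
qed

lemma integral_dent_bounds: "0 \<le> (\<integral>x. dent 0 x \<partial>lborel)" "(\<integral>x. dent 0 x \<partial>lborel) \<le> (\<integral>x. bulk x \<partial>lborel)"
  by (auto intro!: Bochner_Integration.integral_nonneg dent_nonneg integral_mono dent_integrable
      bulk_integrable dent_le_bulk)

lemma integral_bulk_bounds:
  "(2 * R) ^ CARD('n) \<le> (\<integral>x. bulk x \<partial>lborel)" "(\<integral>x. bulk x \<partial>lborel) \<le> (4 * R) ^ CARD('n)"
proof -
  let ?I = "\<lambda>c. indicator {x :: real ^ 'n. \<forall>i. \<bar>x $ i\<bar> \<le> c} :: _ \<Rightarrow> real"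
  have "(\<integral>x. ?I R x \<partial>lborel) \<le> (\<integral>x. bulk x \<partial>lborel)"
  proof (rule integral_mono[OF _ bulk_integrable])
    show "integrable lborel (?I R)" using R by (intro integral_cube) simp
    show "?I R x \<le> bulk x" for x using bulk_plateau[of x] bulk_range[of x] by (auto simp: indicator_def)
  qed
  then show "(2 * R) ^ CARD('n) \<le> (\<integral>x. bulk x \<partial>lborel)" using R integral_cube(2)[of R, where 'n = 'n] by simp
  have "(\<integral>x. bulk x \<partial>lborel) \<le> (\<integral>x. ?I (2 * R) x \<partial>lborel)"
  proof (rule integral_mono[OF bulk_integrable])
    show "integrable lborel (?I (2 * R))" using R by (intro integral_cube) simp
    show "bulk x \<le> ?I (2 * R) x" for x
      using bulk_support[of x] bulk_range[of x] by (cases "bulk x = 0") (auto simp: indicator_def)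
  qed
  then show "(\<integral>x. bulk x \<partial>lborel) \<le> (4 * R) ^ CARD('n)"
    using R integral_cube(2)[of "2 * R", where 'n = 'n] by simp
qed

end

text \<open>
  The height \<open>lam\<close> of the plateau is determined by total mass one; by the translation invariance
  above it is the same for all positions of the closed wall.
\<close>

locale walled_density = walled_plateau k w R h e lam M
  for k :: "'n::finite" and w R h e lam M +
  assumes mass: "lam * (\<integral>x. bulk x \<partial>lborel) = 1 + e * (\<integral>x. dent 0 x \<partial>lborel)"
begin

lemma p_measurable: "p j \<in> borel_measurable borel"
  by (rule borel_measurable_continuous_onI[OF p_continuous])

lemma prob_density_p:
  assumes "j \<le> M" shows "prob_density (p j)"
proof -
  have int: "integrable lborel (p j)"
    unfolding p_bulk_dent by (intro Bochner_Integration.integrable_diff integrable_mult_right bulk_integrable dent_integrable)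
  have "(\<integral>x. p j x \<partial>lborel) = lam * (\<integral>x. bulk x \<partial>lborel) - e * (\<integral>x. dent j x \<partial>lborel)"
    unfolding p_bulk_dent
    by (subst Bochner_Integration.integral_diff) (auto intro!: integrable_mult_right bulk_integrable dent_integrable)
  also have "\<dots> = 1" using mass integral_dent[OF assms] by simp
  finally have "(\<integral>\<^sup>+x. ennreal (p j x) \<partial>lborel) = 1"
    using nn_integral_eq_integral[OF int] p_nonneg by simp
  then show ?thesis unfolding prob_density_def using p_measurable p_nonneg by blast
qed

lemma lam_lower: "1 / (4 * R) ^ CARD('n) \<le> lam"
proof -
  have "1 \<le> lam * (\<integral>x. bulk x \<partial>lborel)" using mass e integral_dent_bounds by simp
  also have "\<dots> \<le> lam * (4 * R) ^ CARD('n)" using lam integral_bulk_bounds by (intro mult_left_mono) auto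
  finally show ?thesis using R by (simp add: divide_le_eq)
qed

end

text \<open>
  The total mass of \<open>dent 0\<close> and of \<open>bulk\<close> does not involve the height, so \<open>lam\<close> can be solved for;
  the smallness of \<open>e\<close> keeps it between \<open>1 / I\<close> and \<open>2 / I\<close>, where \<open>I\<close> is the mass of \<open>bulk\<close>.
\<close>

lemma walled_density_exists:
  fixes k :: "'n::finite"
  assumes "plateau_bump w" "continuous_on UNIV w" "R > 0" "h > 0" "4 * h * (real M + 2) \<le> R"
    and e: "0 \<le> e" "4 * e * (4 * R) ^ CARD('n) \<le> 1"
  shows "\<exists>lam. walled_density k w R h e lam M \<and> lam \<le> 2 / (2 * R) ^ CARD('n) \<and> 4 * e \<le> lam"
proof -
  \<comment> \<open>The masses are computed in an instance with arbitrary height and depth.\<close>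
  interpret W: walled_plateau k w R h 0 1 M
    using assms(1-5) by (intro walled_plateau.intro) auto
  define I J where "I = (\<integral>x. W.bulk x \<partial>lborel)" and "J = (\<integral>x. W.dent 0 x \<partial>lborel)"
  define lam where "lam = (1 + e * J) / I"
  have b: "(2 * R) ^ CARD('n) \<le> I" "I \<le> (4 * R) ^ CARD('n)" "0 \<le> J" "J \<le> I"
    unfolding I_def J_def by (rule W.integral_bulk_bounds W.integral_dent_bounds)+
  have "0 < (2 * R) ^ CARD('n)" using assms by simp
  then have I: "I > 0" using b by linarith
  have "4 * e * I \<le> 4 * e * (4 * R) ^ CARD('n)" using e b by (intro mult_left_mono) auto
  then have eI: "4 * e * I \<le> 1" using e by linarith
  have eJ: "0 \<le> e * J" "e * J \<le> e * I" using e b by (auto intro: mult_left_mono)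
  have lam: "lam > 0" using I eJ by (simp add: lam_def add_pos_nonneg)
  have e_lam: "4 * e \<le> lam"
    using I eI eJ unfolding lam_def by (simp add: le_divide_eq)
  have "lam \<le> 2 / I" using I eI eJ unfolding lam_def by (intro divide_right_mono) auto
  also have "\<dots> \<le> 2 / (2 * R) ^ CARD('n)" using b I assms by (intro divide_left_mono) auto
  finally have up: "lam \<le> 2 / (2 * R) ^ CARD('n)" .
  have "walled_density k w R h e lam M"
  proof (intro walled_density.intro walled_density_axioms.intro)
    show "walled_plateau w R h e lam M" 
      using assms(1-6) lam e_lam by (intro walled_plateau.intro) auto
    show "lam * (\<integral>x. W.bulk x \<partial>lborel) = 1 + e * (\<integral>x. W.dent 0 x \<partial>lborel)"
      using I by (simp add: lam_def I_def J_def)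
  qed
  then show ?thesis using up e_lam by blast
qed

section \<open>Locating the closed wall\<close>

text \<open>
  The clusters \<open>E\<close> and \<open>D'\<close> share \<open>b\<close>, so one contains the other. If \<open>E \<subseteq> D'\<close>, then \<open>a\<close> lies in \<open>D\<close> and
  in \<open>D'\<close>; if \<open>D' \<subseteq> E\<close>, then \<open>c\<close> lies in \<open>E\<close> and in \<open>E'\<close>.
\<close>

lemma crossing_separations_incompatible:
  assumes T: "cluster_tree_estimator n T" "X \<in> {..<n} \<rightarrow>\<^sub>E UNIV"
    and D: "smallest_cluster (T X) A D" "smallest_cluster (T X) A' D'" "D \<inter> D' = {}"
    and E: "smallest_cluster (T X) B E" "smallest_cluster (T X) B' E'" "E \<inter> E' = {}"
    and abc: "a \<in> A \<inter> B" "b \<in> A' \<inter> B" "c \<in> A' \<inter> B'"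
  shows False
proof -
  obtain l l' where l: "l \<ge> 0" "l' \<ge> 0" "E \<in> T X l" "D' \<in> T X l'"
    using D(2) E(1) unfolding smallest_cluster_def by auto
  have nested: "F \<inter> G = {} \<or> F \<subseteq> G" if "l\<^sub>1 \<ge> l\<^sub>2" "l\<^sub>2 \<ge> 0" "F \<in> T X l\<^sub>1" "G \<in> T X l\<^sub>2" for l\<^sub>1 l\<^sub>2 F G
    using T that unfolding cluster_tree_estimator_def by blast
  have mem: "a \<in> D" "a \<in> E" "b \<in> D'" "b \<in> E" "c \<in> D'" "c \<in> E'"
  proof -
    have "A \<subseteq> D" "A' \<subseteq> D'" "B \<subseteq> E" "B' \<subseteq> E'"
      using D(1,2) E(1,2) by (simp_all add: smallest_cluster_def)
    then show "a \<in> D" "a \<in> E" "b \<in> D'" "b \<in> E" "c \<in> D'" "c \<in> E'" using abc by blast+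
  qed
  have "E \<subseteq> D' \<or> D' \<subseteq> E"
  proof (cases "l \<le> l'")
    case True
    then have "D' \<inter> E = {} \<or> D' \<subseteq> E" using l by (intro nested[of l l']) auto
    then show ?thesis using mem by blast
  next
    case False
    then have "E \<inter> D' = {} \<or> E \<subseteq> D'" using l by (intro nested[of l' l]) auto
    then show ?thesis using mem by blast
  qed
  then show False using mem D(3) E(3) by blast
qed

context walled_density
begin

definition gap :: real
  where "gap = 2 * R / (real M + 2)"

text \<open>
  The part of the plateau between the walls \<open>m - 1\<close> and \<open>m\<close>. For \<open>m = 0\<close> it lies to the left of all
  walls and for \<open>m = M + 1\<close>, where \<open>wall m\<close> is the right end of the plateau, to the right of them.
\<close>

definition slab :: "nat \<Rightarrow> (real ^ 'n) set"
  where "slab m = {x. \<forall>i. (if i = k then wall m - gap + h else - R) \<le> x $ i \<and>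
                          x $ i \<le> (if i = k then wall m - h else R)}"

lemma gap_ge: "8 * h \<le> gap"
  using h_le_spacing by (simp add: gap_def)

lemma wall_gap: "wall m - wall m' = (real m - real m') * gap"
  by (simp add: wall_diff gap_def)

lemma wall_less: "m' < m \<Longrightarrow> wall m' + gap \<le> wall m"
proof -
  assume "m' < m"
  then have "1 * gap \<le> (real m - real m') * gap" using gap_ge h by (intro mult_right_mono) auto
  then show ?thesis using wall_gap[of m m'] by linarith
qed

lemma wall_le: "m' \<le> m \<Longrightarrow> wall m' \<le> wall m"
  using wall_less[of m' m] gap_ge h by (cases "m' = m") auto

lemma slab_coordinates:
  assumes "x \<in> slab m"
  shows "wall m - gap + h \<le> x $ k" "x $ k \<le> wall m - h" "i \<noteq> k \<Longrightarrow> \<bar>x $ i\<bar> \<le> R"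
proof -
  have c: "(if i = k then wall m - gap + h else - R) \<le> x $ i"
      "x $ i \<le> (if i = k then wall m - h else R)" for i
    using assms unfolding slab_def by blast+
  show "wall m - gap + h \<le> x $ k" "x $ k \<le> wall m - h" using c[of k] by simp_all
  show "\<bar>x $ i\<bar> \<le> R" if "i \<noteq> k" using c[of i] that by (simp add: abs_le_iff)
qed

lemma slab_side:
  assumes "x \<in> slab m"
  shows "m \<le> j \<Longrightarrow> x $ k < wall j" "j < m \<Longrightarrow> wall j < x $ k"
proof -
  show "x $ k < wall j" if "m \<le> j" using slab_coordinates[OF assms] wall_le[OF that] h by linarith
  show "wall j < x $ k" if "j < m" using slab_coordinates[OF assms] wall_less[OF that] h by linarith
qed

lemma p_on_slab:
  assumes x: "x \<in> slab m" and m: "m \<le> Suc M"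
  shows "p j x = lam"
proof -
  have "h \<le> \<bar>x $ k - wall m'\<bar>" for m'
    using slab_coordinates[OF x] wall_le[of m m'] wall_less[of m' m] by (cases "m \<le> m'") auto
  then have "dip m' (x $ k) = 0" for m' by (rule dip_far)
  then have dips: "dips S (x $ k) = 0" for S by (simp add: dips_def)
  have "wall 0 - gap \<le> wall m - gap" "wall m \<le> wall (Suc M)" using m by (auto intro: wall_le)
  moreover have "wall 0 - gap = - R" by (simp add: wall_def gap_def)
  moreover have "(real M + 2) * gap = 2 * R" by (simp add: gap_def)
  moreover have "wall (Suc M) = - R + (real M + 2) * gap"
    unfolding wall_def gap_def by (simp add: add.commute)
  ultimately have "\<bar>x $ k\<bar> \<le> R" using slab_coordinates[OF x] h by linarith
  then have "\<bar>x $ i\<bar> \<le> R" for i using slab_coordinates(3)[OF x] by (cases "i = k") blast+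
  then have "bulk x = 1" by (rule bulk_plateau)
  then show ?thesis by (simp add: p_bulk_dent dent_def dips)
qed

lemma slab_point: "axis k (wall m - h) \<in> slab m"
  unfolding slab_def using gap_ge h R by (auto simp: axis_def)

lemma slab_volume:
  "slab m \<in> sets borel" "emeasure lborel (slab m) = ennreal ((gap - 2 * h) * (2 * R) ^ (CARD('n) - 1))"
proof -
  let ?l = "\<lambda>i. if i = k then wall m - gap + h else - R" and ?u = "\<lambda>i. if i = k then wall m - h else R"
  have le: "?l i \<le> ?u i" for i using gap_ge h R by auto
  show "slab m \<in> sets borel" unfolding slab_def by (rule coordinate_box(1)[OF le])
  have "(\<Prod>i\<in>UNIV. ?u i - ?l i) = (?u k - ?l k) * (\<Prod>i\<in>UNIV - {k}. ?u i - ?l i)"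
    by (rule prod.remove) auto
  also have "(\<Prod>i\<in>UNIV - {k}. ?u i - ?l i) = (\<Prod>i\<in>UNIV - {k}. 2 * R)" by (intro prod.cong) auto
  also have "\<dots> = (2 * R) ^ (CARD('n) - 1)" by simp
  finally have "(\<Prod>i\<in>UNIV. ?u i - ?l i) = (gap - 2 * h) * (2 * R) ^ (CARD('n) - 1)" by simp
  then show "emeasure lborel (slab m) = ennreal ((gap - 2 * h) * (2 * R) ^ (CARD('n) - 1))"
    unfolding slab_def coordinate_box(2)[OF le] by simp
qed

text \<open>
  A slab has volume at least \<open>3/4 (2 R)\<^sup>d / (M + 2)\<close>, and the density equals \<open>lam \<ge> (4 R)\<^bsup>-d\<^esup>\<close> on
  it.
\<close>

lemma slab_mass:
  assumes "m \<le> Suc M"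
  shows "3 / (4 * 2 ^ CARD('n) * (real M + 2)) \<le> measure (density lborel (\<lambda>x. ennreal (p j x))) (slab m)"
proof -
  let ?v = "(gap - 2 * h) * (2 * R) ^ (CARD('n) - 1)"
  have v: "0 \<le> ?v" using gap_ge h R by simp
  have "emeasure (density lborel (\<lambda>x. ennreal (p j x))) (slab m)
      = (\<integral>\<^sup>+x. ennreal (p j x) * indicator (slab m) x \<partial>lborel)"
    using slab_volume(1) p_measurable by (intro emeasure_density) auto
  also have "\<dots> = (\<integral>\<^sup>+x. ennreal lam * indicator (slab m) x \<partial>lborel)"
    by (intro nn_integral_cong) (auto simp: indicator_def p_on_slab[OF _ assms])
  also have "\<dots> = ennreal lam * ennreal ?v"
    using slab_volume by (subst nn_integral_cmult_indicator) auto
  also have "\<dots> = ennreal (lam * ?v)" using lam v by (intro ennreal_mult[symmetric]) auto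
  finally have eq: "measure (density lborel (\<lambda>x. ennreal (p j x))) (slab m) = lam * ?v"
    using lam v by (simp add: measure_def)
  have d: "(2 * R) ^ CARD('n) = 2 * R * (2 * R) ^ (CARD('n) - 1)"
    by (rule power_eq_if[THEN trans]) simp
  have "3 / (4 * 2 ^ CARD('n) * (real M + 2))
      = 1 / (4 * R) ^ CARD('n) * (3 / 4 * ((2 * R) ^ CARD('n) / (real M + 2)))"
  proof -
    have "(4 * R) ^ CARD('n) = 2 ^ CARD('n) * (2 * R) ^ CARD('n)"
      unfolding power_mult_distrib[symmetric] by simp
    then show ?thesis using R by simp
  qed
  also have "\<dots> = 1 / (4 * R) ^ CARD('n) * (3 / 4 * gap * (2 * R) ^ (CARD('n) - 1))"
    unfolding gap_def d by simp
  also have "\<dots> \<le> lam * ?v"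
    using lam_lower lam gap_ge h R by (intro mult_mono) auto
  finally show ?thesis unfolding eq .
qed

definition left :: "nat \<Rightarrow> (real ^ 'n) set"
  where "left j = {x. p j x \<ge> lam \<and> x $ k \<in> {..<wall j}}"

definition right :: "nat \<Rightarrow> (real ^ 'n) set"
  where "right j = {x. p j x \<ge> lam \<and> x $ k \<in> {wall j<..}}"

lemma slab_left: "x \<in> slab m \<Longrightarrow> m \<le> j \<Longrightarrow> j \<le> M \<Longrightarrow> x \<in> left j"
  using p_on_slab[of x m j] slab_side(1)[of x m j] by (simp add: left_def)

lemma slab_right: "x \<in> slab m \<Longrightarrow> j < m \<Longrightarrow> m \<le> Suc M \<Longrightarrow> x \<in> right j"
  using p_on_slab[of x m j] slab_side(2)[of x m j] by (simp add: right_def)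

text \<open>
  Both sets lie at the level \<open>lam\<close>, and at the centre of the wall \<open>j\<close> the density is at most
  \<open>lam - e\<close>; a component of \<open>{p j > lam - e}\<close> that met both sides would have to cross the wall.
\<close>

lemma left_right_separated:
  assumes j: "j \<le> M" and e_pos: "0 < e" "e < lam"
  shows "connected (left j)" "connected (right j)" "\<delta>_separated (p j) e (left j) (right j)"
proof -
  show cl: "connected (left j)" unfolding left_def by (rule superlevel_left_connected[OF j]) simp
  show cr: "connected (right j)" unfolding right_def by (rule superlevel_right_connected[OF j]) simp
  obtain x y where x: "x \<in> left j" and y: "y \<in> right j"
    using slab_left[OF slab_point, of j j] slab_right[OF slab_point, of j "Suc j"] j by auto
  have top: "p j z = lam" if "z \<in> left j \<union> right j" for z
    using that p_le_lam[OF j, of z] by (auto simp: left_def right_def)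
  have "p j ` (left j \<union> right j) = {lam}" using top x by (auto simp: image_iff)
  then have inf: "(INF z \<in> left j \<union> right j. p j z) = lam" by simp
  have supp: "left j \<union> right j \<subseteq> supp (p j)"
  proof
    fix z assume "z \<in> left j \<union> right j"
    then have "z \<in> {z. p j z \<noteq> 0}" using top[of z] lam by simp
    then show "z \<in> supp (p j)" unfolding supp_def by (rule subsetD[OF closure_subset])
  qed
  let ?S = "{z. p j z > lam - e}"
  let ?U = "connected_component_set ?S x" and ?V = "connected_component_set ?S y"
  have "z \<in> ?S" if "z \<in> left j \<union> right j" for z using top[OF that] e_pos by simp
  then have sub: "left j \<subseteq> ?S" "right j \<subseteq> ?S" by blast+
  then have xS: "x \<in> ?S" and yS: "y \<in> ?S" using x y by blast+
  have U: "?U \<in> components ?S" "?V \<in> components ?S"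
    by (rule componentsI[OF xS], rule componentsI[OF yS])
  have lU: "left j \<subseteq> ?U" "right j \<subseteq> ?V"
    by (rule connected_component_maximal[OF x cl sub(1)], rule connected_component_maximal[OF y cr sub(2)])
  have "?U \<noteq> ?V"
  proof
    assume "?U = ?V"
    then have "x \<in> ?U" "y \<in> ?U" using x y lU by blast+
    moreover have "x $ k \<le> wall j" "wall j \<le> y $ k" using x y by (auto simp: left_def right_def)
    ultimately obtain z where z: "z \<in> ?U" "z $ k = wall j"
      using connected_ivt_component_cart[OF connected_connected_component[of ?S x]] by blast
    then have "p j z > lam - e" using connected_component_subset[of ?S x] by blast
    then show False using p_low_at_wall[OF j, of z] z(2) h by simp
  qed
  then show "\<delta>_separated (p j) e (left j) (right j)"
    unfolding \<delta>_separated_def Let_def inf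
    by (intro conjI bexI[of _ ?U] bexI[of _ ?V]) (use x y supp e_pos U lU in auto)
qed

text \<open>
  The densities of two positions of the closed wall differ only in the two passages, by at most
  \<open>e\<close>.
\<close>

definition passage :: "nat \<Rightarrow> (real ^ 'n) set"
  where "passage m = {x. \<forall>i. (if i = k then wall m - h else - h) \<le> x $ i \<and>
                             x $ i \<le> (if i = k then wall m + h else h)}"

lemma passage_volume:
  "passage m \<in> sets borel" "emeasure lborel (passage m) = ennreal ((2 * h) ^ CARD('n))"
proof -
  let ?l = "\<lambda>i. if i = k then wall m - h else - h" and ?u = "\<lambda>i. if i = k then wall m + h else h"
  have le: "?l i \<le> ?u i" for i using h by auto
  show "passage m \<in> sets borel" unfolding passage_def by (rule coordinate_box(1)[OF le])
  have "(\<Prod>i\<in>UNIV. ?u i - ?l i) = (\<Prod>i\<in>(UNIV :: 'n set). 2 * h)" by (intro prod.cong) auto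
  then show "emeasure lborel (passage m) = ennreal ((2 * h) ^ CARD('n))"
    unfolding passage_def coordinate_box(2)[OF le] by simp
qed

lemma p_lower_in_passage:
  assumes "x \<in> passage m" "m \<le> M"
  shows "lam - e \<le> p j x"
proof -
  have c: "(if i = k then wall m - h else - h) \<le> x $ i"
      "x $ i \<le> (if i = k then wall m + h else h)" for i
    using assms(1) unfolding passage_def by blast+
  have "\<bar>x $ i\<bar> \<le> R" for i
  proof (cases "i = k")
    case True
    then have "wall m - h \<le> x $ i" "x $ i \<le> wall m + h" using c[of i] by simp_all
    then show ?thesis using wall_bounds[OF assms(2)] h by linarith
  next
    case False
    then have "- h \<le> x $ i" "x $ i \<le> h" using c[of i] by simp_all
    then show ?thesis using h h_le_R by linarith
  qed
  then have b: "bulk x = 1" by (rule bulk_plateau)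
  have "e * dent j x \<le> e * 1" using dent_le_bulk[of j x] b e by (intro mult_left_mono) auto
  then show ?thesis unfolding p_bulk_dent b by simp
qed

lemma neck_le_1: "neck x \<le> 1"
  using neck_le_base_cross[of x] base_cross_range[of x] by linarith

lemma outside_passage:
  assumes "x \<notin> passage m" shows "dip m (x $ k) * neck x = 0"
proof -
  obtain i where "\<not> ((if i = k then wall m - h else - h) \<le> x $ i \<and> x $ i \<le> (if i = k then wall m + h else h))"
    using assms unfolding passage_def by blast
  then consider "i = k" "h \<le> \<bar>x $ k - wall m\<bar>" | "i \<noteq> k" "h \<le> \<bar>x $ i\<bar>"
    by (cases "i = k") auto
  then show ?thesis
  proof cases
    case 1
    then show ?thesis by (simp add: dip_far)
  next
    case 2
    then have "w (x $ i / h) = 0" using h by (intro plateau_bumpD(4)[OF bump]) (simp add: le_divide_eq)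
    then have "neck x = 0" unfolding neck_def using 2 by (intro prod_zero) auto
    then show ?thesis by simp
  qed
qed

lemma p_difference:
  assumes j: "j \<le> M" and e_small: "2 * e \<le> lam"
  shows "(p j x - p 0 x)\<^sup>2 \<le> (2 * e\<^sup>2 / lam) * p 0 x * indicator (passage 0 \<union> passage j) x"
proof -
  have "dips ({..M} - {j}) (x $ k) = dips {..M} (x $ k) - dip j (x $ k)"
    "dips ({..M} - {0}) (x $ k) = dips {..M} (x $ k) - dip 0 (x $ k)"
    using dips_remove[OF j, of "x $ k"] dips_remove[of 0 "x $ k"] by simp_all
  then have diff: "p j x - p 0 x = e * (dip 0 (x $ k) * neck x - dip j (x $ k) * neck x)"
    by (simp only: p_def) (simp add: algebra_simps)
  show ?thesis
  proof (cases "x \<in> passage 0 \<union> passage j")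
    case False
    then show ?thesis using diff outside_passage[of x 0] outside_passage[of x j] by simp
  next
    case True
    have r: "0 \<le> dip m (x $ k) * neck x" "dip m (x $ k) * neck x \<le> 1" for m
      using dip_range neck_nonneg neck_le_1 by (auto intro: mult_le_one)
    have "\<bar>dip 0 (x $ k) * neck x - dip j (x $ k) * neck x\<bar> \<le> 1"
      using r[of 0] r[of j] by linarith
    then have "\<bar>p j x - p 0 x\<bar> \<le> e * 1"
      unfolding diff abs_mult using e by (intro mult_mono) auto
    then have "\<bar>p j x - p 0 x\<bar> \<le> \<bar>e\<bar>" using e by simp
    then have "(p j x - p 0 x)\<^sup>2 \<le> e\<^sup>2" by (rule abs_le_square_iff[THEN iffD1])
    also have "e\<^sup>2 = (2 * e\<^sup>2 / lam) * (lam / 2)" using lam by simp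
    also have "\<dots> \<le> (2 * e\<^sup>2 / lam) * p 0 x"
    proof (intro mult_left_mono)
      have "lam - e \<le> p 0 x" using True j p_lower_in_passage[of x 0 0] p_lower_in_passage[of x j 0] by blast
      then show "lam / 2 \<le> p 0 x" using e_small by linarith
    qed (use lam in simp)
    finally show ?thesis using True by simp
  qed
qed

end

text \<open>
  Where both sets meet the sample, the first of the two exclusive alternatives fails, hence the
  second holds.
\<close>

lemma accurate_separates:
  assumes acc: "accurate n q \<delta> \<gamma> T"
    and A: "connected A" "connected A'" "\<delta>_separated q \<delta> A A'"
  shows "\<exists>E. E \<in> sets (sample_law n q) \<and> 1 - \<gamma> \<le> measure (sample_law n q) E \<and>
    (\<forall>X\<in>E. A \<inter> X ` {..<n} \<noteq> {} \<and> A' \<inter> X ` {..<n} \<noteq> {} \<longrightarrow>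
      (\<exists>D D'. smallest_cluster (T X) (A \<inter> X ` {..<n}) D \<and>
              smallest_cluster (T X) (A' \<inter> X ` {..<n}) D' \<and> D \<inter> D' = {}))"
proof -
  from acc[unfolded accurate_def] obtain E where E: "E \<in> sets (sample_law n q)"
    "1 - \<gamma> \<le> measure (sample_law n q) E"
    and sep: "\<forall>X \<in> E. \<forall>A A'. connected A \<and> connected A' \<and> \<delta>_separated q \<delta> A A' \<longrightarrow>
         \<not> ((A \<inter> X ` {..<n} = {} \<or> A' \<inter> X ` {..<n} = {}) \<longleftrightarrow>
            (\<exists>D D'. smallest_cluster (T X) (A \<inter> X ` {..<n}) D \<and>
                    smallest_cluster (T X) (A' \<inter> X ` {..<n}) D' \<and> D \<inter> D' = {}))"
    by (elim bexE conjE)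
  show ?thesis
  proof (intro exI[of _ E] conjI E ballI impI)
    fix X assume X: "X \<in> E" and ne: "A \<inter> X ` {..<n} \<noteq> {} \<and> A' \<inter> X ` {..<n} \<noteq> {}"
    from sep[THEN bspec, OF X, THEN spec, THEN spec, of A A', THEN mp] A ne
    show "\<exists>D D'. smallest_cluster (T X) (A \<inter> X ` {..<n}) D \<and>
              smallest_cluster (T X) (A' \<inter> X ` {..<n}) D' \<and> D \<inter> D' = {}" by simp
  qed
qed

context walled_density
begin

subsection \<open>Too few samples cannot locate the closed wall\<close>

text \<open>
  \<open>F j\<close> is the event that the estimator separates the two sides of the wall \<open>j\<close> and that the sample
  hits all slabs. Under the law of \<open>p j\<close> it has probability at least \<open>3/4 - 3/32 = 21/32\<close>. These
  events are disjoint, so under the law of \<open>p 0\<close> the events \<open>F 1, \<dots>, F M\<close> share the probability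
  \<open>11/32\<close> that \<open>F 0\<close> leaves, and some \<open>F j\<close> receives at most \<open>11 / (32 M)\<close>. The change from \<open>p 0\<close> to
  \<open>p j\<close> has to make up for the difference.
\<close>

lemma sample_size_lower_bound:
  assumes M: "1 \<le> M" and e_pos: "0 < e" "4 * e \<le> lam"
    and T: "cluster_tree_estimator n T" and acc: "\<And>j. j \<le> M \<Longrightarrow> accurate n (p j) e (1 / 4) T"
    and hit: "(real M + 2) * exp (- (real n * (3 / (4 * 2 ^ CARD('n) * (real M + 2))))) \<le> 3 / 32"
  shows "ln (5 / 4 * real M) \<le> real n * ((2 * e\<^sup>2 / lam) * (2 * (2 * h) ^ CARD('n)))"
proof -
  let ?P = "\<lambda>j. sample_law n (p j)"
  let ?\<mu> = "3 / (4 * 2 ^ CARD('n) * (real M + 2))"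
  let ?miss = "\<lambda>m. {X \<in> {..<n} \<rightarrow>\<^sub>E UNIV. \<forall>i<n. X i \<notin> slab m}"
  let ?\<kappa> = "real n * ((2 * e\<^sup>2 / lam) * (2 * (2 * h) ^ CARD('n)))"
  have e_lam: "e < lam" "2 * e \<le> lam" using e_pos lam by linarith+
  have dens: "prob_density (p j)" if "j \<le> M" for j using that by (rule prob_density_p)
  let ?apart = "\<lambda>j X. \<exists>D D'. smallest_cluster (T X) (left j \<inter> X ` {..<n}) D \<and>
    smallest_cluster (T X) (right j \<inter> X ` {..<n}) D' \<and> D \<inter> D' = {}"
  have "\<forall>j\<in>{..M}. \<exists>E. E \<in> sets (?P j) \<and> 1 - 1 / 4 \<le> measure (?P j) E \<and>
      (\<forall>X\<in>E. left j \<inter> X ` {..<n} \<noteq> {} \<and> right j \<inter> X ` {..<n} \<noteq> {} \<longrightarrow> ?apart j X)"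
  proof
    fix j assume "j \<in> {..M}"
    then have j: "j \<le> M" by simp
    show "\<exists>E. E \<in> sets (?P j) \<and> 1 - 1 / 4 \<le> measure (?P j) E \<and>
      (\<forall>X\<in>E. left j \<inter> X ` {..<n} \<noteq> {} \<and> right j \<inter> X ` {..<n} \<noteq> {} \<longrightarrow> ?apart j X)"
      by (rule accurate_separates[OF acc[OF j] left_right_separated[OF j e_pos(1) e_lam(1)]])
  qed
  from bchoice[OF this] obtain E where E0: "\<forall>j\<in>{..M}. E j \<in> sets (?P j) \<and> 1 - 1 / 4 \<le> measure (?P j) (E j) \<and>
      (\<forall>X\<in>E j. left j \<inter> X ` {..<n} \<noteq> {} \<and> right j \<inter> X ` {..<n} \<noteq> {} \<longrightarrow> ?apart j X)"
    by (elim exE)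
  have E: "E j \<in> sets (?P j)" "3 / 4 \<le> measure (?P j) (E j)"
    and E_sep: "\<And>X. X \<in> E j \<Longrightarrow> left j \<inter> X ` {..<n} \<noteq> {} \<Longrightarrow> right j \<inter> X ` {..<n} \<noteq> {} \<Longrightarrow> ?apart j X"
    if "j \<le> M" for j
    using bspec[OF E0, of j] that by simp_all
  define F where "F j = E j - (\<Union>m\<in>{..Suc M}. ?miss m)" for j
  have sets_eq: "sets (?P i) = sets (?P j)" for i j by (rule sets_sample_law_eq)
  have miss: "?miss m \<in> sets (?P j)" "measure (?P j) (?miss m) \<le> exp (- (real n * ?\<mu>))"
    if "m \<le> Suc M" "j \<le> M" for m j
    by (rule sample_misses_region[OF dens[OF that(2)] slab_volume(1) slab_mass[OF that(1)],
          of n, unfolded space_sample_law])+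
  have missU: "(\<Union>m\<in>{..Suc M}. ?miss m) \<in> sets (?P j)" if "j \<le> M" for j
  proof (rule sets.finite_UN)
    show "?miss m \<in> sets (?P j)" if "m \<in> {..Suc M}" for m
      using that by (intro miss(1) \<open>j \<le> M\<close>) simp
  qed simp
  have F_sets: "F j \<in> sets (?P i)" if "j \<le> M" "i \<le> M" for i j
  proof -
    have "E j \<in> sets (?P i)" using E(1)[OF that(1)] sets_eq[of j i] by (rule back_subst[of "\<lambda>\<A>. E j \<in> \<A>"])
    then show ?thesis unfolding F_def using missU[OF that(2)] by (rule sets.Diff)
  qed
  have F_large: "21 / 32 \<le> measure (?P j) (F j)" if j: "j \<le> M" for j
  proof -
    interpret prob_space "?P j" by (rule prob_space_sample_law[OF dens[OF j]])
    have "prob (\<Union>m\<in>{..Suc M}. ?miss m) \<le> (\<Sum>m\<in>{..Suc M}. prob (?miss m))"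
      by (rule finite_measure_subadditive_finite) (auto intro!: miss(1) j)
    also have "\<dots> \<le> (\<Sum>m\<in>{..Suc M}. exp (- (real n * ?\<mu>)))"
      by (intro sum_mono miss(2) j) simp
    also have "\<dots> = (real M + 2) * exp (- (real n * ?\<mu>))" by (simp add: algebra_simps)
    finally have "prob (\<Union>m\<in>{..Suc M}. ?miss m) \<le> 3 / 32" using hit by linarith
    moreover have "prob (E j) \<le> prob (F j \<union> (\<Union>m\<in>{..Suc M}. ?miss m))"
    proof (rule finite_measure_mono)
      show "E j \<subseteq> F j \<union> (\<Union>m\<in>{..Suc M}. ?miss m)" unfolding F_def by blast
    qed (rule sets.Un[OF F_sets[OF j j] missU[OF j]])
    moreover have "\<dots> \<le> prob (F j) + prob (\<Union>m\<in>{..Suc M}. ?miss m)"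
      by (rule measure_Un_le[OF F_sets[OF j j] missU[OF j]])
    ultimately show ?thesis using E(2)[OF j] by linarith
  qed
  have F_disjoint: "F i \<inter> F j = {}" if ij: "i < j" "j \<le> M" for i j
  proof (rule ccontr)
    assume "F i \<inter> F j \<noteq> {}"
    then obtain X where X: "X \<in> E i" "X \<in> E j" "\<And>m. m \<le> Suc M \<Longrightarrow> X \<notin> ?miss m"
      unfolding F_def by blast
    have i: "i \<le> M" using ij by simp
    have "X \<in> space (?P j)" using X(2) E(1)[OF ij(2)] sets.sets_into_space by blast
    then have X_ext: "X \<in> {..<n} \<rightarrow>\<^sub>E UNIV" by (simp add: space_sample_law)
    have point: "\<exists>x\<in>X ` {..<n}. x \<in> slab m" if "m \<le> Suc M" for m
      using X(3)[OF that] X_ext by blast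
    \<comment> \<open>One sample point left of both walls, one between them, and one right of both.\<close>
    obtain a b c where a: "a \<in> X ` {..<n}" "a \<in> slab 0" and b: "b \<in> X ` {..<n}" "b \<in> slab (Suc i)"
      and c: "c \<in> X ` {..<n}" "c \<in> slab (Suc j)"
      using point[of 0] point[of "Suc i"] point[of "Suc j"] ij by auto
    let ?S = "X ` {..<n}"
    have abc: "a \<in> left i \<inter> ?S \<inter> (left j \<inter> ?S)" "b \<in> right i \<inter> ?S \<inter> (left j \<inter> ?S)"
      "c \<in> right i \<inter> ?S \<inter> (right j \<inter> ?S)"
      using a b c ij slab_left[of a 0 i] slab_left[of a 0 j] slab_left[of b "Suc i" j]
        slab_right[of b "Suc i" i] slab_right[of c "Suc j" i] slab_right[of c "Suc j" j] by simp_all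
    have "?apart i X" using abc by (intro E_sep[OF i X(1)]) blast+
    then obtain D D' where
      D: "smallest_cluster (T X) (left i \<inter> ?S) D" "smallest_cluster (T X) (right i \<inter> ?S) D'" "D \<inter> D' = {}"
      by (elim exE conjE)
    have "?apart j X" using abc by (intro E_sep[OF ij(2) X(2)]) blast+
    then obtain D2 D2' where
      D2: "smallest_cluster (T X) (left j \<inter> ?S) D2" "smallest_cluster (T X) (right j \<inter> ?S) D2'" "D2 \<inter> D2' = {}"
      by (elim exE conjE)
    show False by (rule crossing_separations_incompatible[OF T X_ext D D2 abc])
  qed
  interpret Q: prob_space "?P 0" by (rule prob_space_sample_law[OF dens]) simp
  have disj: "disjoint_family_on F {..M}"
    unfolding disjoint_family_on_def
  proof (intro ballI impI)
    fix i j assume "i \<in> {..M}" "j \<in> {..M}" "i \<noteq> j"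
    then show "F i \<inter> F j = {}" using F_disjoint[of i j] F_disjoint[of j i] by (cases "i < j") auto
  qed
  have "(\<Sum>j\<in>{..M}. Q.prob (F j)) = Q.prob (\<Union>j\<in>{..M}. F j)"
    using F_sets disj by (intro Q.finite_measure_finite_Union[symmetric]) auto
  also have "\<dots> \<le> 1" by (rule Q.prob_le_1)
  finally have "(\<Sum>j\<in>{..M}. Q.prob (F j)) \<le> 1" .
  moreover have "(\<Sum>j\<in>{..M}. Q.prob (F j)) = Q.prob (F 0) + (\<Sum>j\<in>{1..M}. Q.prob (F j))"
  proof -
    have "{..M} = insert 0 {1..M}" by auto
    then show ?thesis by simp
  qed
  ultimately have sum_le: "(\<Sum>j\<in>{1..M}. Q.prob (F j)) \<le> 11 / 32" using F_large[of 0] by simp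
  have "\<exists>j\<in>{1..M}. Q.prob (F j) \<le> 11 / (32 * real M)"
  proof (rule ccontr)
    assume "\<not> ?thesis"
    then have "(\<Sum>j\<in>{1..M}. 11 / (32 * real M)) < (\<Sum>j\<in>{1..M}. Q.prob (F j))"
      using M by (intro sum_strict_mono) (auto simp: not_le)
    then show False using sum_le M by simp
  qed
  then obtain j where j: "j \<in> {1..M}" "Q.prob (F j) \<le> 11 / (32 * real M)" by blast
  have jM: "j \<le> M" using j by simp
  have "(21 / 32)\<^sup>2 \<le> (measure (?P j) (F j))\<^sup>2" using F_large[OF jM] by (intro power_mono) auto
  also have "\<dots> \<le> exp ?\<kappa> * Q.prob (F j)"
  proof (rule sample_law_change_of_density[OF dens[OF jM] dens])
    show "passage 0 \<union> passage j \<in> sets borel" using passage_volume(1) by auto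
    have "emeasure lborel (passage 0 \<union> passage j) \<le> emeasure lborel (passage 0) + emeasure lborel (passage j)"
      using passage_volume(1) by (intro emeasure_subadditive) auto
    also have "\<dots> = ennreal ((2 * h) ^ CARD('n) + (2 * h) ^ CARD('n))"
      unfolding passage_volume(2) using h by (intro ennreal_plus[symmetric]) auto
    finally show "emeasure lborel (passage 0 \<union> passage j) \<le> ennreal (2 * (2 * h) ^ CARD('n))"
      by (simp only: mult_2[of "(2 * h) ^ CARD('n)"])
    show "(p j x - p 0 x)\<^sup>2 \<le> 2 * e\<^sup>2 / lam * p 0 x * indicator (passage 0 \<union> passage j) x" for x
      by (rule p_difference[OF jM e_lam(2)])
    show "F j \<in> sets (?P 0)" using F_sets[OF jM] by simp
  qed (use lam h in auto)
  also have "\<dots> \<le> exp ?\<kappa> * (11 / (32 * real M))" using j(2) by (intro mult_left_mono) auto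
  finally have "(21 / 32)\<^sup>2 * (32 * real M / 11) \<le> exp ?\<kappa>" using M by (simp add: field_simps)
  \<comment> \<open>The factor on the right is 441/352, slightly more than 5/4.\<close>
  moreover have "5 / 4 * real M \<le> (21 / 32)\<^sup>2 * (32 * real M / 11)" by (simp add: power2_eq_square)
  ultimately have "5 / 4 * real M \<le> exp ?\<kappa>" by linarith
  then have "ln (5 / 4 * real M) \<le> ln (exp ?\<kappa>)" using M by (subst ln_le_cancel_iff) auto
  then show ?thesis by simp
qed

lemma sup_norm_p:
  assumes "j \<le> M" shows "sup_norm (p j) = lam"
  unfolding sup_norm_def
proof (rule cSup_eq_maximum)
  have "p j (axis k (wall 0 - h)) = lam" using p_on_slab[OF slab_point] by simp
  then show "lam \<in> range (\<lambda>x. \<bar>p j x\<bar>)" using lam by (metis abs_of_pos rangeI)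
  show "y \<le> lam" if "y \<in> range (\<lambda>x. \<bar>p j x\<bar>)" for y
    using that p_le_lam[OF assms] p_nonneg by auto
qed

end

section \<open>The lower bound\<close>

lemma unit_ball_volume_le: "unit_ball_volume TYPE('n::finite) \<le> 2 ^ CARD('n)"
proof -
  have sub: "cball (0 :: real ^ 'n) 1 \<subseteq> cbox (\<chi> i. - 1) (\<chi> i. 1)"
  proof
    fix x :: "real ^ 'n" assume "x \<in> cball 0 1"
    then have "\<bar>x $ i\<bar> \<le> 1" for i using component_le_norm_cart[of x i] by (simp add: dist_norm)
    then have "- 1 \<le> x $ i \<and> x $ i \<le> 1" for i by (metis abs_le_iff minus_le_iff)
    then show "x \<in> cbox (\<chi> i. - 1) (\<chi> i. 1)" by (simp add: mem_box_cart)
  qed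
  have "measure lebesgue (cball (0 :: real ^ 'n) 1) \<le> measure lebesgue (cbox (\<chi> i. - 1) (\<chi> i. 1) :: (real ^ 'n) set)"
    by (intro measure_mono_fmeasurable sub lmeasurable_cbox) auto
  also have "\<dots> = (\<Prod>i\<in>(UNIV :: 'n set). 1 - (- 1))"
    by (subst measure_completion) (auto simp: content_cbox_cart interval_ne_empty_cart)
  also have "\<dots> = 2 ^ CARD('n)" by simp
  finally show ?thesis .
qed

lemma powr_small:
  fixes a B y :: real
  assumes "a > 0" "B > 0" "y > 0"
  shows "\<exists>s>0. \<forall>t. 0 < t \<and> t \<le> s \<longrightarrow> B * t powr a \<le> y"
proof (intro exI conjI allI impI)
  show "0 < (y / B) powr (1 / a)" using assms by simp
  fix t :: real assume t: "0 < t \<and> t \<le> (y / B) powr (1 / a)"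
  then have "t powr a \<le> ((y / B) powr (1 / a)) powr a" using assms by (intro powr_mono2) auto
  also have "\<dots> = y / B" using assms by (simp add: powr_powr)
  finally show "B * t powr a \<le> y" using assms by (simp add: le_divide_eq mult.commute)
qed

lemma smooth_bump_continuous:
  assumes "smooth_bump (Suc N) w D A" shows "continuous_on UNIV w"
proof -
  have "(w has_real_derivative D 1 t) (at t)" for t
    using assms by (auto simp: smooth_bump_def deriv_seq_def)
  then show ?thesis by (intro continuous_at_imp_continuous_on ballI DERIV_isCont)
qed

definition regular_density :: "real \<Rightarrow> real \<Rightarrow> real \<Rightarrow> real \<Rightarrow> (real ^ 'n::finite \<Rightarrow> real) \<Rightarrow> bool"
  where "regular_density L \<alpha> C\<^sub>0 m p \<longleftrightarrow>
    prob_density p \<and> p \<in> hoelder_class L \<alpha> \<and> cond_C p \<and> cond_S \<alpha> p \<and> (\<forall>x. p x \<le> C\<^sub>0) \<and> m \<le> sup_norm p"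

text \<open>
  The dimensional factor in the Hoelder constant of a tensor product whose factors have derivatives
  bounded by \<open>A\<close> at scale 1.
\<close>

definition hoelder_factor :: "nat \<Rightarrow> real \<Rightarrow> real"
  where "hoelder_factor d A = (real d + 2) * A ^ d"

lemma hoelder_factor_pos: "A \<ge> 1 \<Longrightarrow> hoelder_factor d A > 0"
  unfolding hoelder_factor_def by (intro mult_pos_pos) (auto intro: add_nonneg_pos)

text \<open>
  A wide plateau is low, which gives the bound by \<open>C\<^sub>0\<close>, and flat, so that it uses at most one half
  of the Hoelder constant \<open>L\<close>; the other half is left for the walls.
\<close>

lemma (in walled_density) regular_density_p:
  fixes \<alpha> A L C\<^sub>0 :: real
  assumes j: "j \<le> M" and pos: "\<alpha> > 0" "L > 0" "C\<^sub>0 > 0"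
    and bump_D: "smooth_bump (Suc (strict_floor \<alpha>)) w D A"
    and R_large: "1 \<le> R" "1 / C\<^sub>0 \<le> R" "(4 * hoelder_factor CARD('n) A / L) powr (1 / \<alpha>) \<le> R"
    and lam_le: "lam \<le> 2 / (2 * R) ^ CARD('n)"
    and walls: "hoelder_factor CARD('n) A * (2 * e * h powr (- \<alpha>)) \<le> L / 2"
  shows "regular_density L \<alpha> C\<^sub>0 (1 / (4 * R) ^ CARD('n)) (p j)" "lam \<le> 1 / R"
proof -
  let ?H = "hoelder_factor CARD('n) A"
  have D: "D 0 = w" "deriv_seq (Suc (strict_floor \<alpha>)) D" and A: "A > 0"
    and D_le: "\<And>n t. n \<le> Suc (strict_floor \<alpha>) \<Longrightarrow> \<bar>D n t\<bar> \<le> A"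
    and D_supp: "\<And>n t. n \<le> Suc (strict_floor \<alpha>) \<Longrightarrow> \<bar>t\<bar> > 1 \<Longrightarrow> D n t = 0"
    using bump_D unfolding smooth_bump_def by auto
  have H0: "?H > 0" using bump_D by (intro hoelder_factor_pos) (simp add: smooth_bump_def)
  have "(2 * R) ^ 1 \<le> (2 * R) ^ CARD('n)" using R_large by (intro power_increasing) (auto simp: Suc_leI)
  then have "2 / (2 * R) ^ CARD('n) \<le> 2 / (2 * R)" using R by (intro divide_left_mono) auto
  then show lam_R: "lam \<le> 1 / R" using lam_le R by simp
  have "1 / R \<le> C\<^sub>0" using R_large(2) R pos by (simp add: divide_le_eq mult.commute)
  then have lam_C: "lam \<le> C\<^sub>0" using lam_R by linarith
  have "1 / R \<le> 1" using R_large(1) by simp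
  then have lam_1: "lam \<le> 1" using lam_R by linarith
  have "4 * ?H / L = ((4 * ?H / L) powr (1 / \<alpha>)) powr \<alpha>" using H0 pos by (simp add: powr_powr)
  also have "\<dots> \<le> R powr \<alpha>" using R_large pos by (intro powr_mono2) auto
  also have "\<dots> \<le> (2 * R) powr \<alpha>" using R pos by (intro powr_mono2) auto
  finally have "4 * ?H / L \<le> (2 * R) powr \<alpha>" .
  then have "?H / (2 * R) powr \<alpha> \<le> L / 4" using pos R by (simp add: field_simps)
  then have "?H * (2 * R) powr (- \<alpha>) \<le> L / 4" by (simp add: powr_minus_divide)
  moreover have "lam * (?H * (2 * R) powr (- \<alpha>)) \<le> 1 * (?H * (2 * R) powr (- \<alpha>))"
    using lam_1 H0 by (intro mult_right_mono) auto
  ultimately have "?H * (lam * (2 * R) powr (- \<alpha>) + 2 * e * h powr (- \<alpha>)) \<le> L"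
    using walls pos by (simp add: algebra_simps)
  then have "p j \<in> hoelder_class L \<alpha>"
    unfolding hoelder_factor_def by (intro p_hoelder_class[OF pos(1) D A D_le D_supp])
  moreover have "p j x \<le> C\<^sub>0" for x using p_le_lam[OF j, of x] lam_C by linarith
  ultimately show "regular_density L \<alpha> C\<^sub>0 (1 / (4 * R) ^ CARD('n)) (p j)"
    unfolding regular_density_def
    using prob_density_p[OF j] cond_C_p[OF j] cond_S_p[OF j pos(1)] lam_lower sup_norm_p[OF j] by simp
qed

text \<open>
  A wall of depth 0 leaves a plain plateau, and the wider it is, the lower.
\<close>

lemma flat_density_exists:
  fixes \<alpha> A L C\<^sub>0 :: real
  assumes pos: "\<alpha> > 0" "L > 0" "C\<^sub>0 > 0"
    and bump_D: "smooth_bump (Suc (strict_floor \<alpha>)) w D A"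
    and R: "1 \<le> R" "1 / C\<^sub>0 \<le> R" "(4 * hoelder_factor CARD('n) A / L) powr (1 / \<alpha>) \<le> R"
  shows "\<exists>p :: real ^ 'n::finite \<Rightarrow> real.
    regular_density L \<alpha> C\<^sub>0 (1 / (4 * R) ^ CARD('n)) p \<and> sup_norm p \<le> 1 / R"
proof -
  have "plateau_bump w" using bump_D by (simp add: smooth_bump_def)
  then obtain lam where W: "walled_density (undefined :: 'n) w R (R / 8) 0 lam 0"
    and lam: "lam \<le> 2 / (2 * R) ^ CARD('n)"
    using walled_density_exists[of w R "R / 8" 0 0 "undefined :: 'n"] smooth_bump_continuous[OF bump_D] R by auto
  interpret W: walled_density "undefined :: 'n" w R "R / 8" 0 lam 0 by (rule W)
  have "regular_density L \<alpha> C\<^sub>0 (1 / (4 * R) ^ CARD('n)) (W.p 0)" "lam \<le> 1 / R"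
    by (rule W.regular_density_p[OF _ pos bump_D R lam]; use pos in simp)+
  then show ?thesis using W.sup_norm_p[of 0] by (intro exI[of _ "W.p 0"]) simp
qed

lemma divergence_bound:
  fixes R c \<delta> \<alpha> lam :: real
  assumes pos: "R > 0" "c > 0" "\<delta> > 0" "\<alpha> > 0" "lam > 0" and lam: "1 / (4 * R) ^ d \<le> lam"
    and h: "h = (c * \<delta>) powr (1 / \<alpha>)"
  shows "(2 * \<delta>\<^sup>2 / lam) * (2 * (2 * h) ^ d)
    \<le> 4 * (8 * R) ^ d * c powr (real d / \<alpha>) * \<delta> powr (2 + real d / \<alpha>)"
proof -
  have h0: "h > 0" using pos by (simp add: h)
  have "1 / lam \<le> (4 * R) ^ d" using lam pos by (simp add: field_simps)
  then have "(1 / lam) * (4 * \<delta>\<^sup>2 * (2 * h) ^ d) \<le> (4 * R) ^ d * (4 * \<delta>\<^sup>2 * (2 * h) ^ d)"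
    using h0 by (intro mult_right_mono) auto
  also have "\<dots> = 4 * \<delta>\<^sup>2 * ((4 * R) ^ d * (2 * h) ^ d)" by (simp only: mult_ac)
  also have "(4 * R) ^ d * (2 * h) ^ d = (4 * R * (2 * h)) ^ d" by (rule power_mult_distrib[symmetric])
  also have "4 * R * (2 * h) = 8 * R * h" by simp
  also have "(8 * R * h) ^ d = (8 * R) ^ d * h ^ d" by (rule power_mult_distrib)
  also have "h ^ d = c powr (real d / \<alpha>) * \<delta> powr (real d / \<alpha>)"
  proof -
    have "h ^ d = h powr real d" using h0 by (simp add: powr_realpow)
    also have "\<dots> = (c * \<delta>) powr (real d / \<alpha>)" by (simp add: h powr_powr)
    also have "\<dots> = c powr (real d / \<alpha>) * \<delta> powr (real d / \<alpha>)" using pos by (intro powr_mult)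
    finally show ?thesis .
  qed
  also have "4 * \<delta>\<^sup>2 * ((8 * R) ^ d * (c powr (real d / \<alpha>) * \<delta> powr (real d / \<alpha>)))
      = 4 * (8 * R) ^ d * c powr (real d / \<alpha>) * (\<delta>\<^sup>2 * \<delta> powr (real d / \<alpha>))" by (simp only: mult_ac)
  also have "\<delta>\<^sup>2 * \<delta> powr (real d / \<alpha>) = \<delta> powr (2 + real d / \<alpha>)"
    using pos by (simp add: powr_add powr_numeral)
  also have "(1 / lam) * (4 * \<delta>\<^sup>2 * (2 * h) ^ d) = (2 * \<delta>\<^sup>2 / lam) * (2 * (2 * h) ^ d)" by simp
  finally show ?thesis .
qed

text \<open>
  With depth \<open>\<delta>\<close> and half width \<open>h = (c \<delta>)\<^sup>1\<^sup>/\<^sup>\<alpha>\<close> the walls have the same Hoelder constant for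
  every \<open>\<delta>\<close>, and the factor of \<open>n\<close> in the lower bound becomes a multiple of \<open>\<delta>\<^bsup>2 + d/\<alpha>\<^esup>\<close> that is
  independent of \<open>N\<close>.
\<close>

lemma hard_family_exists:
  fixes \<alpha> A L C\<^sub>0 :: real
  assumes pos: "\<alpha> > 0" "L > 0" "C\<^sub>0 > 0" and bump_D: "smooth_bump (Suc (strict_floor \<alpha>)) w D A"
    and c: "c = 4 * hoelder_factor CARD('n) A / L"
    and R: "1 \<le> R" "1 / C\<^sub>0 \<le> R" "c powr (1 / \<alpha>) \<le> R"
    and N: "1 \<le> N" and \<delta>: "\<delta> > 0" "4 * \<delta> * (4 * R) ^ CARD('n) \<le> 1"
      "4 * (c * \<delta>) powr (1 / \<alpha>) * (real N + 2) \<le> R"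
  shows "\<exists>F :: (real ^ 'n::finite \<Rightarrow> real) set. finite F \<and> F \<noteq> {} \<and>
    (\<forall>p\<in>F. regular_density L \<alpha> C\<^sub>0 (1 / (4 * R) ^ CARD('n)) p) \<and>
    (\<forall>n T. cluster_tree_estimator n T \<and> (\<forall>p\<in>F. accurate n p \<delta> (1 / 4) T) \<and>
       (real N + 2) * exp (- (real n * (3 / (4 * 2 ^ CARD('n) * (real N + 2))))) \<le> 3 / 32 \<longrightarrow>
       ln (5 / 4 * real N) \<le> real n *
         (4 * (8 * R) ^ CARD('n) * c powr (real CARD('n) / \<alpha>) * \<delta> powr (2 + real CARD('n) / \<alpha>)))"
proof -
  let ?H = "hoelder_factor CARD('n) A"
  define h where "h = (c * \<delta>) powr (1 / \<alpha>)"
  have H0: "?H > 0" using bump_D by (intro hoelder_factor_pos) (simp add: smooth_bump_def)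
  then have c0: "c > 0" using pos by (simp add: c)
  have h0: "h > 0" using c0 \<delta> by (simp add: h_def)
  have R0: "R > 0" using R by linarith
  have "h powr (- \<alpha>) = 1 / (c * \<delta>)"
    using pos c0 \<delta> by (simp add: h_def powr_powr powr_minus_divide)
  then have walls: "?H * (2 * \<delta> * h powr (- \<alpha>)) \<le> L / 2" using \<delta> H0 pos by (simp add: c)
  have "plateau_bump w" using bump_D by (simp add: smooth_bump_def)
  then obtain lam where W: "walled_density (undefined :: 'n) w R h \<delta> lam N"
    and lam: "lam \<le> 2 / (2 * R) ^ CARD('n)" "4 * \<delta> \<le> lam"
    using walled_density_exists[of w R h N \<delta> "undefined :: 'n"] smooth_bump_continuous[OF bump_D] R0 h0 \<delta>
    unfolding h_def by auto
  interpret W: walled_density "undefined :: 'n" w R h \<delta> lam N by (rule W)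
  have regular: "regular_density L \<alpha> C\<^sub>0 (1 / (4 * R) ^ CARD('n)) (W.p j)" if "j \<le> N" for j
    by (rule W.regular_density_p[OF that pos bump_D R(1,2) R(3)[unfolded c] lam(1) walls])
  have bound: "ln (5 / 4 * real N) \<le> real n *
      (4 * (8 * R) ^ CARD('n) * c powr (real CARD('n) / \<alpha>) * \<delta> powr (2 + real CARD('n) / \<alpha>))"
    if T: "cluster_tree_estimator n T" "\<forall>p\<in>W.p ` {..N}. accurate n p \<delta> (1 / 4) T"
      and hit: "(real N + 2) * exp (- (real n * (3 / (4 * 2 ^ CARD('n) * (real N + 2))))) \<le> 3 / 32" for n T
  proof -
    have "ln (5 / 4 * real N) \<le> real n * ((2 * \<delta>\<^sup>2 / lam) * (2 * (2 * h) ^ CARD('n)))"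
      by (rule W.sample_size_lower_bound[OF N \<delta>(1) lam(2) T(1) _ hit]) (use T(2) in auto)
    also have "\<dots> \<le> real n * (4 * (8 * R) ^ CARD('n) * c powr (real CARD('n) / \<alpha>) * \<delta> powr (2 + real CARD('n) / \<alpha>))"
      by (intro mult_left_mono divergence_bound R0 c0 \<delta> pos W.lam W.lam_lower h_def) simp
    finally show ?thesis .
  qed
  show ?thesis
    by (rule exI[of _ "W.p ` {..N}"]) (use regular bound in auto)
qed

text \<open>
  Two walls leave three slabs. As \<open>V\<^sub>d \<le> 2\<^sup>d\<close>, the assumed sample size makes each of them empty with
  probability at most \<open>1/32\<close>.
\<close>

lemma first_stage_sample_size:
  assumes "4 ^ CARD('n) * 8 * ln 32 / unit_ball_volume TYPE('n::finite) \<le> real n"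
  shows "(real 1 + 2) * exp (- (real n * (3 / (4 * 2 ^ CARD('n) * (real 1 + 2))))) \<le> 3 / 32"
proof -
  let ?d = "CARD('n)"
  define V where "V = unit_ball_volume TYPE('n)"
  have V: "0 < V" unfolding V_def by (rule unit_ball_volume_pos)
  have V_le: "V \<le> 2 ^ ?d" unfolding V_def by (rule unit_ball_volume_le)
  have "(2::real) ^ ?d * (2 ^ ?d * 8 * ln 32) = 4 ^ ?d * 8 * ln 32"
  proof -
    have "(4::real) ^ ?d = (2 * 2) ^ ?d" by simp
    also have "\<dots> = 2 ^ ?d * 2 ^ ?d" by (rule power_mult_distrib)
    finally show ?thesis by simp
  qed
  moreover have "V * (2 ^ ?d * 8 * ln 32) \<le> 2 ^ ?d * (2 ^ ?d * 8 * ln 32)"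
    using V_le by (intro mult_right_mono) auto
  ultimately have "2 ^ ?d * 8 * ln 32 \<le> 4 ^ ?d * 8 * ln 32 / V"
    using V by (simp add: le_divide_eq mult.commute)
  then have n: "2 ^ ?d * 8 * ln 32 \<le> real n" using assms unfolding V_def by linarith
  have "ln 32 * (4 * 2 ^ ?d) \<le> 2 ^ ?d * 8 * ln (32::real)" by simp
  then have "ln 32 * (4 * 2 ^ ?d) \<le> real n" using n by linarith
  then have "ln 32 \<le> real n / (4 * 2 ^ ?d)" by (subst pos_le_divide_eq) auto
  also have "\<dots> = real n * (3 / (4 * 2 ^ ?d * (real 1 + 2)))" by simp
  finally have "exp (- (real n * (3 / (4 * 2 ^ ?d * (real 1 + 2))))) \<le> exp (- ln 32)"
    by (intro exp_le_cancel_iff[THEN iffD2]) linarith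
  then show ?thesis by (simp add: exp_minus)
qed

lemma slabs_hit_eventually:
  assumes "n\<^sub>1 \<le> real n" "ln ((real M + 2) * (32 / 3)) \<le> n\<^sub>1 * \<mu>" "\<mu> > 0"
  shows "(real M + 2) * exp (- (real n * \<mu>)) \<le> 3 / 32"
proof -
  have "n\<^sub>1 * \<mu> \<le> real n * \<mu>" using assms by (intro mult_right_mono) auto
  then have "ln ((real M + 2) * (32 / 3)) \<le> real n * \<mu>" using assms(2) by linarith
  then have "exp (- (real n * \<mu>)) \<le> exp (- ln ((real M + 2) * (32 / 3)))"
    by (simp only: exp_le_cancel_iff neg_le_iff_le)
  also have "\<dots> = 1 / ((real M + 2) * (32 / 3))"
    by (simp add: exp_minus exp_ln add_nonneg_pos inverse_eq_divide)
  finally have "(real M + 2) * exp (- (real n * \<mu>)) \<le> (real M + 2) * (1 / ((real M + 2) * (32 / 3)))"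
    by (intro mult_left_mono) auto
  also have "\<dots> = 3 / 32" by (simp add: field_simps)
  finally show ?thesis .
qed

theorem theorem2:
  shows "\<exists>C>0. \<forall>\<alpha>>0. \<forall>L>0. \<exists>K>0. \<forall>C\<^sub>0>0. \<exists>m>0. \<forall>\<delta>>0.
    \<exists>F :: (real ^ 'n::finite \<Rightarrow> real) set.
      finite F \<and> F \<noteq> {} \<and>
      (\<forall>p\<in>F. prob_density p \<and> p \<in> hoelder_class L \<alpha> \<and> cond_C p \<and> cond_S \<alpha> p \<and>
              (\<forall>x. p x \<le> C\<^sub>0) \<and> m \<le> sup_norm p) \<and>
      (\<forall>n::nat.
         real n \<ge> 4 ^ CARD('n) * 8 * ln 32 / unit_ball_volume TYPE('n) \<and>
         (\<forall>p\<in>F. \<delta> \<le> min (K / (16 powr \<alpha> * (7 * C\<^sub>0) powr (\<alpha> / real CARD('n))))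
                          (sup_norm p / 2 powr (real CARD('n) / 2 + 1))) \<longrightarrow>
         (\<forall>T. cluster_tree_estimator n T \<and> (\<forall>p\<in>F. accurate n p \<delta> (1 / 4) T) \<longrightarrow>
              real n \<ge> C\<^sub>0 * K powr (real CARD('n) / \<alpha>) / (C * \<delta> powr (2 + real CARD('n) / \<alpha>))))"
proof -
  have main: "\<exists>m>0. \<forall>\<delta>>0. \<exists>F :: (real ^ 'n \<Rightarrow> real) set.
      finite F \<and> F \<noteq> {} \<and>
      (\<forall>p\<in>F. prob_density p \<and> p \<in> hoelder_class L \<alpha> \<and> cond_C p \<and> cond_S \<alpha> p \<and>
              (\<forall>x. p x \<le> C\<^sub>0) \<and> m \<le> sup_norm p) \<and>
      (\<forall>n::nat.
         real n \<ge> 4 ^ CARD('n) * 8 * ln 32 / unit_ball_volume TYPE('n) \<and>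
         (\<forall>p\<in>F. \<delta> \<le> min (1 / (16 powr \<alpha> * (7 * C\<^sub>0) powr (\<alpha> / real CARD('n))))
                          (sup_norm p / 2 powr (real CARD('n) / 2 + 1))) \<longrightarrow>
         (\<forall>T. cluster_tree_estimator n T \<and> (\<forall>p\<in>F. accurate n p \<delta> (1 / 4) T) \<longrightarrow>
              real n \<ge> C\<^sub>0 * 1 powr (real CARD('n) / \<alpha>) / (1 * \<delta> powr (2 + real CARD('n) / \<alpha>))))"
    if pos: "0 < \<alpha>" "0 < L" "0 < C\<^sub>0" for \<alpha> L C\<^sub>0 :: real
  proof -
    let ?d = "CARD('n)"
    obtain w D A where bump_D: "smooth_bump (Suc (strict_floor \<alpha>)) w D A"
      using smooth_bump_exists[of "Suc (strict_floor \<alpha>)"] by (elim exE)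
    define c where "c = 4 * hoelder_factor ?d A / L"
    have "hoelder_factor ?d A > 0" using bump_D by (intro hoelder_factor_pos) (simp add: smooth_bump_def)
    then have c0: "c > 0" using pos by (simp add: c_def)
    define R where "R = max 1 (max (1 / C\<^sub>0) (c powr (1 / \<alpha>)))"
    have R: "1 \<le> R" "1 / C\<^sub>0 \<le> R" "c powr (1 / \<alpha>) \<le> R" by (auto simp: R_def)
    then have R0: "R > 0" by linarith
    define \<kappa> where "\<kappa> = 4 * (8 * R) ^ ?d * c powr (real ?d / \<alpha>)"
    have \<kappa>0: "\<kappa> > 0" using R0 c0 by (simp add: \<kappa>_def)
    define r where "r = 2 + real ?d / \<alpha>"
    have r0: "r > 0" using pos by (simp add: r_def add_pos_nonneg)
    \<comment> \<open>So many walls that their logarithm beats the constant \<open>C\<^sub>0\<close>.\<close>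
    obtain M :: nat where M: "exp (\<kappa> * C\<^sub>0) \<le> real M" using real_arch_simple by blast
    have "0 < real M" using M exp_gt_zero[of "\<kappa> * C\<^sub>0"] by linarith
    then have M1: "1 \<le> M" by simp
    define \<mu> where "\<mu> = 3 / (4 * 2 ^ ?d * (real M + 2))"
    have \<mu>0: "\<mu> > 0" by (simp add: \<mu>_def add_nonneg_pos)
    \<comment> \<open>The sample size from which on all slabs between these walls are hit.\<close>
    define n\<^sub>1 where "n\<^sub>1 = max 1 (ln ((real M + 2) * (32 / 3)) / \<mu>)"
    have n1: "n\<^sub>1 > 0" by (simp add: n\<^sub>1_def)
    have n1_ln: "ln ((real M + 2) * (32 / 3)) \<le> n\<^sub>1 * \<mu>"
      using \<mu>0 by (subst pos_divide_le_eq[symmetric]) (auto simp: n\<^sub>1_def)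
    obtain s\<^sub>1 where s1: "s\<^sub>1 > 0" "\<forall>t. 0 < t \<and> t \<le> s\<^sub>1 \<longrightarrow> (4 * c powr (1 / \<alpha>) * (real M + 2)) * t powr (1 / \<alpha>) \<le> R"
      using powr_small[of "1 / \<alpha>" "4 * c powr (1 / \<alpha>) * (real M + 2)" R] pos c0 R0
      by (auto simp: add_nonneg_pos)
    obtain s\<^sub>2 where s2: "s\<^sub>2 > 0" "\<forall>t. 0 < t \<and> t \<le> s\<^sub>2 \<longrightarrow> (n\<^sub>1 * \<kappa>) * t powr r \<le> ln (5 / 4)"
      using powr_small[of r "n\<^sub>1 * \<kappa>" "ln (5 / 4)"] r0 n1 \<kappa>0 by auto
    \<comment> \<open>Up to this value of \<open>\<delta>\<close> the walls fit on the plateau, two walls force \<open>n \<ge> n\<^sub>1\<close>, and the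
      depth of the walls is small against the height.\<close>
    define s where "s = min (min s\<^sub>1 s\<^sub>2) (1 / (4 * (4 * R) ^ ?d))"
    have s0: "s > 0" using s1 s2 R0 by (simp add: s_def)
    \<comment> \<open>For larger \<open>\<delta>\<close> the single density on a plateau of this size has supremum norm below \<open>\<delta>\<close>.\<close>
    define R' where "R' = max R (2 / s)"
    have R': "R \<le> R'" "2 / s \<le> R'" by (auto simp: R'_def)
    then have R'0: "R' > 0" using R0 by linarith
    define m where "m = 1 / (4 * R') ^ ?d"
    have m0: "m > 0" using R'0 by (simp add: m_def)
    have m_le: "m \<le> 1 / (4 * R) ^ ?d"
      unfolding m_def using R0 R' by (intro divide_left_mono power_mono) auto
    obtain q :: "real ^ 'n \<Rightarrow> real" where q: "regular_density L \<alpha> C\<^sub>0 m q" "sup_norm q \<le> 1 / R'"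
      using flat_density_exists[OF pos bump_D, of R', where 'n = 'n] R R' unfolding m_def c_def by auto
    have "\<exists>F :: (real ^ 'n \<Rightarrow> real) set.
        finite F \<and> F \<noteq> {} \<and> (\<forall>p\<in>F. regular_density L \<alpha> C\<^sub>0 m p) \<and>
        (\<forall>n::nat.
           real n \<ge> 4 ^ ?d * 8 * ln 32 / unit_ball_volume TYPE('n) \<and>
           (\<forall>p\<in>F. \<delta> \<le> min (1 / (16 powr \<alpha> * (7 * C\<^sub>0) powr (\<alpha> / real ?d)))
                            (sup_norm p / 2 powr (real ?d / 2 + 1))) \<longrightarrow>
           (\<forall>T. cluster_tree_estimator n T \<and> (\<forall>p\<in>F. accurate n p \<delta> (1 / 4) T) \<longrightarrow>
                real n \<ge> C\<^sub>0 * 1 powr (real ?d / \<alpha>) / (1 * \<delta> powr (2 + real ?d / \<alpha>))))"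
      if \<delta>: "0 < \<delta>" for \<delta>
    proof (cases "\<delta> \<le> s")
      case False
      have "1 / R' \<le> s / 2" using R'(2) R'0 s0 by (simp add: field_simps)
      then have small: "sup_norm q < \<delta>" using q(2) False s0 by linarith
      have "1 \<le> 2 powr (real ?d / 2 + 1)" by (intro ge_one_powr_ge_zero) auto
      then have "\<delta> * 1 \<le> \<delta> * 2 powr (real ?d / 2 + 1)" using \<delta> by (intro mult_left_mono) auto
      then have "\<not> \<delta> \<le> sup_norm q / 2 powr (real ?d / 2 + 1)"
        using small by (simp add: le_divide_eq)
      then show ?thesis using q(1) by (intro exI[of _ "{q}"]) simp
    next
      case True
      have ds: "\<delta> \<le> s\<^sub>1" "\<delta> \<le> s\<^sub>2" "\<delta> \<le> 1 / (4 * (4 * R) ^ ?d)" using True by (auto simp: s_def)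
      have d4: "4 * \<delta> * (4 * R) ^ ?d \<le> 1" using ds(3) R0 by (simp add: field_simps)
      have "(c * \<delta>) powr (1 / \<alpha>) = c powr (1 / \<alpha>) * \<delta> powr (1 / \<alpha>)" using c0 \<delta> by (intro powr_mult)
      then have hM: "4 * (c * \<delta>) powr (1 / \<alpha>) * (real M + 2) \<le> R" using s1(2) \<delta> ds(1) by (simp add: mult_ac)
      have "4 * (c * \<delta>) powr (1 / \<alpha>) * (real 1 + 2) \<le> 4 * (c * \<delta>) powr (1 / \<alpha>) * (real M + 2)"
        using M1 by (intro mult_left_mono) auto
      then have h1: "4 * (c * \<delta>) powr (1 / \<alpha>) * (real 1 + 2) \<le> R" using hM by linarith
      obtain F1 :: "(real ^ 'n \<Rightarrow> real) set" where F1: "finite F1" "F1 \<noteq> {}"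
        "\<forall>p\<in>F1. regular_density L \<alpha> C\<^sub>0 (1 / (4 * R) ^ ?d) p"
        and F1_bound: "\<forall>n T. cluster_tree_estimator n T \<and> (\<forall>p\<in>F1. accurate n p \<delta> (1 / 4) T) \<and>
             (real 1 + 2) * exp (- (real n * (3 / (4 * 2 ^ ?d * (real 1 + 2))))) \<le> 3 / 32 \<longrightarrow>
             ln (5 / 4 * real 1) \<le> real n * (\<kappa> * \<delta> powr r)"
        using hard_family_exists[OF pos bump_D c_def R le_refl \<delta> d4 h1] unfolding \<kappa>_def r_def
        by (elim exE conjE)
      obtain F2 :: "(real ^ 'n \<Rightarrow> real) set" where F2: "finite F2" "F2 \<noteq> {}"
        "\<forall>p\<in>F2. regular_density L \<alpha> C\<^sub>0 (1 / (4 * R) ^ ?d) p"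
        and F2_bound: "\<forall>n T. cluster_tree_estimator n T \<and> (\<forall>p\<in>F2. accurate n p \<delta> (1 / 4) T) \<and>
             (real M + 2) * exp (- (real n * \<mu>)) \<le> 3 / 32 \<longrightarrow>
             ln (5 / 4 * real M) \<le> real n * (\<kappa> * \<delta> powr r)"
        using hard_family_exists[OF pos bump_D c_def R M1 \<delta> d4 hM] unfolding \<kappa>_def r_def \<mu>_def
        by (elim exE conjE)
      have kd: "0 < \<kappa> * \<delta> powr r" using \<kappa>0 \<delta> by simp
      have bound: "C\<^sub>0 * 1 powr (real ?d / \<alpha>) / (1 * \<delta> powr (2 + real ?d / \<alpha>)) \<le> real n"
        if n: "4 ^ ?d * 8 * ln 32 / unit_ball_volume TYPE('n) \<le> real n"
          and T: "cluster_tree_estimator n T" "\<forall>p\<in>F1 \<union> F2. accurate n p \<delta> (1 / 4) T" for n :: nat and T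
      proof -
        have T12: "\<forall>p\<in>F1. accurate n p \<delta> (1 / 4) T" "\<forall>p\<in>F2. accurate n p \<delta> (1 / 4) T" using T(2) by blast+
        have "ln (5 / 4 * real 1) \<le> real n * (\<kappa> * \<delta> powr r)"
          using F1_bound T(1) T12(1) first_stage_sample_size[OF n] by blast
        moreover have "(n\<^sub>1 * \<kappa>) * \<delta> powr r \<le> ln (5 / 4)" using s2(2) \<delta> ds(2) by blast
        ultimately have "n\<^sub>1 * (\<kappa> * \<delta> powr r) \<le> real n * (\<kappa> * \<delta> powr r)" by simp
        then have "n\<^sub>1 \<le> real n" using kd by (simp only: mult_le_cancel_right_pos)
        then have "(real M + 2) * exp (- (real n * \<mu>)) \<le> 3 / 32"
          by (rule slabs_hit_eventually[OF _ n1_ln \<mu>0])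
        then have "ln (5 / 4 * real M) \<le> real n * (\<kappa> * \<delta> powr r)"
          using F2_bound T(1) T12(2) by blast
        moreover have "\<kappa> * C\<^sub>0 \<le> ln (5 / 4 * real M)"
        proof -
          have "exp (\<kappa> * C\<^sub>0) \<le> 5 / 4 * real M" using M by simp
          then show ?thesis using M1 by (subst ln_ge_iff) auto
        qed
        ultimately have "\<kappa> * C\<^sub>0 \<le> \<kappa> * (real n * \<delta> powr r)" by (simp add: mult_ac)
        then have "C\<^sub>0 \<le> real n * \<delta> powr r" using \<kappa>0 by (simp only: mult_le_cancel_left_pos)
        then show ?thesis using \<delta> by (simp add: divide_le_eq r_def)
      qed
      have "regular_density L \<alpha> C\<^sub>0 m p" if "p \<in> F1 \<union> F2" for p
      proof -
        have "regular_density L \<alpha> C\<^sub>0 (1 / (4 * R) ^ ?d) p" using that F1(3) F2(3) by blast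
        then show ?thesis using m_le by (auto simp: regular_density_def)
      qed
      then show ?thesis using F1(1,2) F2(1) bound by (intro exI[of _ "F1 \<union> F2"] conjI allI impI) (blast+)
    qed
    then show ?thesis using m0 unfolding regular_density_def by blast
  qed
  show ?thesis
    by (rule exI[of _ "1::real"], intro conjI allI impI, simp,
        rule exI[of _ "1::real"], intro conjI allI impI, simp, rule main)
qed

end
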